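(* Let $\xi=1$, let $\{x_k\}_{k\ge 0}$ be generated by $x_{k+1}=x_k+\alpha_k(F(x_k)+M_k)$ under assumptions (A1)–(A4) of the context, let $y_k=(x_k-x^* )/\sqrt{\alpha_k}$, and suppose that $\iota_V\alpha>2$, $3\delta\gamma\alpha>2$, and $K$ is large enough. Let $Z$ be a standard Gaussian vector in $\mathbb R^d$. Furthermore, let $k$ be large enough such that $d_{\mathcal W}\big(y_k,(\Sigma_k^{(\alpha,1)})^{1/2}Z\big)\le 0.5$. Then, for any $a>0$ and any unit vector $\mathfrak u\in\mathbb R^d$, $$\left|\mathbb P\big(\langle y_k,\mathfrak u\rangle>a\big)-\bar\Phi_G\left(\frac{a}{\|\mathfrak u^T(\Sigma_k^{(\alpha,1)})^{1/2}\|}\right)\right|\le \tilde{\mathcal O}\left(\frac{1}{(k+K)^{\delta/4}}\right)\frac1a ,$$ where $\bar\Phi_G$ is the complementary cumulative distribution function of the standard one-dimensional Gaussian.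
   Context: $\|\cdot\|$ is the Euclidean norm; $d_{\mathcal W}(X,Y)=\inf\mathbb E\|X-Y\|$ over all couplings of the laws of $X,Y$ (Wasserstein-1 distance). $F:\mathbb R^d\to\mathbb R^d$ is an operator with root $x^*$, i.e. $F(x^* )=0$; $x_0\in\mathbb R^d$ is the starting point. $\tilde{\mathcal O}(\cdot)$ hides multiplicative constants and polynomial log factors. (A1) There exist a Lyapunov function $\Phi$, a norm $\|\cdot\|_s$ and constants $\gamma,L_s,l,u>0$ with: $\langle\nabla\Phi(x-x^* ),F(x)\rangle\le-2\gamma\Phi(x-x^* )$; $\Phi(y)\le\Phi(x)+\langle\nabla\Phi(x),y-x\rangle+\frac{L_s}{2}\|x-y\|_s^2$; $l\Phi(x)\le\|x\|^2\le u\Phi(x)$. (A2) $F$ is continuously differentiable at $x^*$ with Jacobian $J_F$; $F(x)=J_F(x-x^* )+R(x)$ for all $x$ in the Euclidean ball of radius $r$ centered at $x^*$, where $\|R(x)\|\le C_r\|x-x^*\|^{1+\delta}$ with $\delta\in(0,1]$; the eigenvalues of $J_F$ have strictly negative real parts; and $\|F(x)-F(y)\|\le L_F\|x-y\|$ for a constant $L_F>0$. (A3) $\{v_k\}$ is a sequence of (possibly non-i.i.d.) random variables, $\{w_k\}$ is an i.i.d. sequence, $\mathcal F_k=\sigma(x_0,v_0,w_0,\dots,v_{k-1},w_{k-1})$, and $M_k=A(v_k,x_k)+b(w_k)$, where $\mathbb E[A(v_k,x_k)|\mathcal F_k]=0$, $\mathbb E[b(w_k)]=0$, $\mathbb E[\|A(v_k,x_k)\|^2|\mathcal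 F_k]\le A_1\|x_k-x^*\|^2$ almost surely for some constant $A_1$, $\mathbb E[b(w_k)b(w_k)^T]=\Sigma_b$, and $\mathbb E[\|b(w_k)\|^\mu]<\infty$ for all $\mu\in[0,3]$. (A4) $\alpha_k=\alpha/(k+K)$ (the case $\xi=1$ of $\alpha_k=\alpha/(k+K)^\xi$) with $\alpha>0$, $K\ge2$, and $\alpha_k\le1$ for all $k\ge0$. Covariances: with $J^{(\alpha,1)}=J_F+\frac1{2\alpha}I$, $\Sigma_0^{(\alpha,1)}=\mathbb E[y_0y_0^T]$ and $\Sigma_{k+1}^{(\alpha,1)}=(I+\alpha_kJ^{(\alpha,1)})\Sigma_k^{(\alpha,1)}(I+\alpha_kJ^{(\alpha,1)})^T+\alpha_k\Sigma_b$. $V$ is the solution of $J_FV+VJ_F^T+I=0$ and $\iota_V=1/(4\lambda_{\max}(V))$, with $\lambda_{\max}(V)$ the largest eigenvalue of $V$. *)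

theory Defs
  imports "HOL-Probability.Probability"
begin

section \<open>Linear algebra\<close>

text \<open>An arbitrary norm on a real vector space (the library's \<open>norm\<close> is the Euclidean one
  on \<open>real ^ 'd\<close>).\<close>

definition is_norm :: "('a::real_vector \<Rightarrow> real) \<Rightarrow> bool" where
  "is_norm N \<longleftrightarrow>
     (\<forall>x. 0 \<le> N x) \<and> (\<forall>x. N x = 0 \<longleftrightarrow> x = 0) \<and>
     (\<forall>c x. N (c *\<^sub>R x) = \<bar>c\<bar> * N x) \<and> (\<forall>x y. N (x + y) \<le> N x + N y)"

definition eigenvalue :: "'a::field ^ 'n ^ 'n \<Rightarrow> 'a \<Rightarrow> bool" where
  "eigenvalue A c \<longleftrightarrow> (\<exists>v. v \<noteq> 0 \<and> A *v v = c *s v)"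

definition lambda_max :: "real ^ 'n ^ 'n \<Rightarrow> real" where
  "lambda_max A = Max {c. eigenvalue A c}"

definition pos_semidef :: "real ^ 'n ^ 'n \<Rightarrow> bool" where
  "pos_semidef A \<longleftrightarrow> transpose A = A \<and> (\<forall>v. 0 \<le> v \<bullet> (A *v v))"

text \<open>The symmetric positive semidefinite square root, meant for positive semidefinite \<open>A\<close>.\<close>

definition mat_sqrt :: "real ^ 'n ^ 'n \<Rightarrow> real ^ 'n ^ 'n" where
  "mat_sqrt A = (THE B. pos_semidef B \<and> B ** B = A)"

definition outer :: "real ^ 'm \<Rightarrow> real ^ 'n \<Rightarrow> real ^ 'n ^ 'm" where
  "outer x y = (\<chi> i j. x $ i * y $ j)"

section \<open>Gaussian laws and Wasserstein distance\<close>

definition std_gaussian :: "(real ^ 'd) measure" where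
  "std_gaussian = distr (\<Pi>\<^sub>M i\<in>(UNIV :: 'd set). std_normal_distribution) borel (\<lambda>f. \<chi> i. f i)"

text \<open>The argument is extended so that the tail at \<open>a / s\<close> has its limit value \<open>0\<close> when the
  standard deviation \<open>s\<close> vanishes: \<open>ereal a / ereal 0 = \<infinity>\<close> for \<open>a > 0\<close>.\<close>

definition gauss_ccdf :: "ereal \<Rightarrow> real" where
  "gauss_ccdf t = measure std_normal_distribution {z. t < ereal z}"

definition couplings :: "(real ^ 'd) measure \<Rightarrow> (real ^ 'd) measure \<Rightarrow>
    ((real ^ 'd) \<times> (real ^ 'd)) measure set" where
  "couplings \<mu> \<nu> = {\<pi>. sets \<pi> = sets (borel \<Otimes>\<^sub>M borel) \<and>
     distr \<pi> borel fst = \<mu> \<and> distr \<pi> borel snd = \<nu>}"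

definition wasserstein1 :: "(real ^ 'd) measure \<Rightarrow> (real ^ 'd) measure \<Rightarrow> ennreal" where
  "wasserstein1 \<mu> \<nu> = (INF \<pi>\<in>couplings \<mu> \<nu>. \<integral>\<^sup>+ z. ennreal (norm (fst z - snd z)) \<partial>\<pi>)"

section \<open>Stochastic approximation\<close>

definition lyapunov_condition ::
    "(real ^ 'd \<Rightarrow> real ^ 'd) \<Rightarrow> real ^ 'd \<Rightarrow> (real ^ 'd \<Rightarrow> real) \<Rightarrow> (real ^ 'd \<Rightarrow> real ^ 'd) \<Rightarrow>
     (real ^ 'd \<Rightarrow> real) \<Rightarrow> real \<Rightarrow> real \<Rightarrow> real \<Rightarrow> real \<Rightarrow> bool" where
  "lyapunov_condition F xstar \<Phi> grad norm_s \<gamma> L\<^sub>s l u \<longleftrightarrow>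
     \<gamma> > 0 \<and> L\<^sub>s > 0 \<and> l > 0 \<and> u > 0 \<and> is_norm norm_s \<and>
     (\<forall>x. GDERIV \<Phi> x :> grad x) \<and>
     (\<forall>x. grad (x - xstar) \<bullet> F x \<le> - 2 * \<gamma> * \<Phi> (x - xstar)) \<and>
     (\<forall>x y. \<Phi> y \<le> \<Phi> x + grad x \<bullet> (y - x) + L\<^sub>s / 2 * (norm_s (x - y))\<^sup>2) \<and>
     (\<forall>x. l * \<Phi> x \<le> (norm x)\<^sup>2 \<and> (norm x)\<^sup>2 \<le> u * \<Phi> x)"

text \<open>Continuous differentiability at the point \<open>xstar\<close>: differentiability in a neighbourhood,
  with Jacobian continuous at \<open>xstar\<close>.\<close>

definition operator_condition ::
    "(real ^ 'd \<Rightarrow> real ^ 'd) \<Rightarrow> real ^ 'd \<Rightarrow> real ^ 'd ^ 'd \<Rightarrow> (real ^ 'd \<Rightarrow> real ^ 'd) \<Rightarrow>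
     real \<Rightarrow> real \<Rightarrow> real \<Rightarrow> real \<Rightarrow> bool" where
  "operator_condition F xstar J R r C\<^sub>r \<delta> L\<^sub>F \<longleftrightarrow>
     (\<forall>\<^sub>F x in nhds xstar. F differentiable (at x)) \<and>
     isCont (\<lambda>x. jacobian F (at x)) xstar \<and>
     J = jacobian F (at xstar) \<and>
     r > 0 \<and> 0 < \<delta> \<and> \<delta> \<le> 1 \<and>
     (\<forall>x\<in>ball xstar r. F x = J *v (x - xstar) + R x \<and>
        norm (R x) \<le> C\<^sub>r * norm (x - xstar) powr (1 + \<delta>)) \<and>
     (\<forall>c. eigenvalue (map_matrix complex_of_real J) c \<longrightarrow> Re c < 0) \<and>
     L\<^sub>F > 0 \<and> (\<forall>x y. norm (F x - F y) \<le> L\<^sub>F * norm (x - y))"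

definition step_size :: "real \<Rightarrow> real \<Rightarrow> nat \<Rightarrow> real" where
  "step_size \<alpha> K k = \<alpha> / (real k + K)"

text \<open>The sigma-algebra generated by \<open>x0, v 0, w 0, \<dots>, v (k - 1), w (k - 1)\<close>.\<close>

definition history ::
    "'m measure \<Rightarrow> 'v measure \<Rightarrow> 'w measure \<Rightarrow> ('m \<Rightarrow> real ^ 'd) \<Rightarrow> (nat \<Rightarrow> 'm \<Rightarrow> 'v) \<Rightarrow>
     (nat \<Rightarrow> 'm \<Rightarrow> 'w) \<Rightarrow> nat \<Rightarrow> 'm measure" where
  "history M Nv Nw x0 v w k = sigma (space M)
     ({x0 -` S \<inter> space M | S. S \<in> sets borel} \<union>
      (\<Union>j<k. {v j -` S \<inter> space M | S. S \<in> sets Nv}) \<union>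
      (\<Union>j<k. {w j -` S \<inter> space M | S. S \<in> sets Nw}))"

text \<open>Conditional expectations of vectors are taken componentwise; the conditional second moment
  is an extended nonnegative conditional expectation, so that its bound implies integrability.\<close>

definition noise_condition ::
    "'m measure \<Rightarrow> 'v measure \<Rightarrow> 'w measure \<Rightarrow> real ^ 'd \<Rightarrow> (nat \<Rightarrow> 'm \<Rightarrow> real ^ 'd) \<Rightarrow>
     (nat \<Rightarrow> 'm \<Rightarrow> 'v) \<Rightarrow> (nat \<Rightarrow> 'm \<Rightarrow> 'w) \<Rightarrow> ('v \<Rightarrow> real ^ 'd \<Rightarrow> real ^ 'd) \<Rightarrow> real \<Rightarrow>
     ('w \<Rightarrow> real ^ 'd) \<Rightarrow> real ^ 'd ^ 'd \<Rightarrow> bool" where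
  "noise_condition M Nv Nw xstar x v w A A\<^sub>1 b \<Sigma>\<^sub>b \<longleftrightarrow>
     (\<forall>k. v k \<in> measurable M Nv) \<and> (\<forall>k. w k \<in> measurable M Nw) \<and>
     case_prod A \<in> borel_measurable (Nv \<Otimes>\<^sub>M borel) \<and> b \<in> borel_measurable Nw \<and>
     prob_space.indep_vars M (\<lambda>_. Nw) w UNIV \<and>
     (\<forall>k. distr M Nw (w k) = distr M Nw (w 0)) \<and>
     (\<forall>k i. AE \<omega> in M. real_cond_exp M (history M Nv Nw (x 0) v w k)
        (\<lambda>\<omega>. A (v k \<omega>) (x k \<omega>) $ i) \<omega> = 0) \<and>
     (\<forall>k. AE \<omega> in M. nn_cond_exp M (history M Nv Nw (x 0) v w k)
        (\<lambda>\<omega>. ennreal ((norm (A (v k \<omega>) (x k \<omega>)))\<^sup>2)) \<omega>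
          \<le> ennreal (A\<^sub>1 * (norm (x k \<omega> - xstar))\<^sup>2)) \<and>
     (\<forall>k. (\<integral>\<omega>. b (w k \<omega>) \<partial>M) = 0) \<and>
     (\<forall>k. (\<integral>\<omega>. outer (b (w k \<omega>)) (b (w k \<omega>)) \<partial>M) = \<Sigma>\<^sub>b) \<and>
     (\<forall>k. \<forall>\<mu>\<in>{0..3}. integrable M (\<lambda>\<omega>. norm (b (w k \<omega>)) powr \<mu>))"

text \<open>The iterates, started from a square-integrable (for instance constant) \<open>x 0\<close>.\<close>

definition sa_iterates ::
    "'m measure \<Rightarrow> (real ^ 'd \<Rightarrow> real ^ 'd) \<Rightarrow> (nat \<Rightarrow> real) \<Rightarrow> (nat \<Rightarrow> 'm \<Rightarrow> real ^ 'd) \<Rightarrow>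
     (nat \<Rightarrow> 'm \<Rightarrow> 'v) \<Rightarrow> (nat \<Rightarrow> 'm \<Rightarrow> 'w) \<Rightarrow> ('v \<Rightarrow> real ^ 'd \<Rightarrow> real ^ 'd) \<Rightarrow>
     ('w \<Rightarrow> real ^ 'd) \<Rightarrow> bool" where
  "sa_iterates M F \<alpha>s x v w A b \<longleftrightarrow>
     x 0 \<in> borel_measurable M \<and> integrable M (\<lambda>\<omega>. (norm (x 0 \<omega>))\<^sup>2) \<and>
     (\<forall>k. \<forall>\<omega>\<in>space M. x (Suc k) \<omega> =
        x k \<omega> + \<alpha>s k *\<^sub>R (F (x k \<omega>) + (A (v k \<omega>) (x k \<omega>) + b (w k \<omega>))))"

definition scaled_error ::
    "(nat \<Rightarrow> real) \<Rightarrow> real ^ 'd \<Rightarrow> (nat \<Rightarrow> 'm \<Rightarrow> real ^ 'd) \<Rightarrow> nat \<Rightarrow> 'm \<Rightarrow> real ^ 'd" where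
  "scaled_error \<alpha>s xstar x k \<omega> = (x k \<omega> - xstar) /\<^sub>R sqrt (\<alpha>s k)"

definition shifted_jacobian :: "real \<Rightarrow> real ^ 'd ^ 'd \<Rightarrow> real ^ 'd ^ 'd" where
  "shifted_jacobian \<alpha> J = J + (1 / (2 * \<alpha>)) *\<^sub>R mat 1"

primrec covariance ::
    "(nat \<Rightarrow> real) \<Rightarrow> real ^ 'd ^ 'd \<Rightarrow> real ^ 'd ^ 'd \<Rightarrow> real ^ 'd ^ 'd \<Rightarrow> nat \<Rightarrow>
     real ^ 'd ^ 'd" where
  "covariance \<alpha>s J \<Sigma>\<^sub>b \<Sigma>\<^sub>0 0 = \<Sigma>\<^sub>0"
| "covariance \<alpha>s J \<Sigma>\<^sub>b \<Sigma>\<^sub>0 (Suc k) =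
     (mat 1 + \<alpha>s k *\<^sub>R J) ** covariance \<alpha>s J \<Sigma>\<^sub>b \<Sigma>\<^sub>0 k ** transpose (mat 1 + \<alpha>s k *\<^sub>R J)
     + \<alpha>s k *\<^sub>R \<Sigma>\<^sub>b"

end

theory Submission
  imports Defs
begin

text \<open>Write \<open>n = k + K\<close>. Only one-dimensional projections of \<open>y\<^sub>k\<close> matter. Split
  \<open>x\<^sub>k - x\<^sup>* = s\<^sub>k + z\<^sub>k\<close>, where \<open>s\<close> solves the recursion linearised at the root and driven by the
  noise \<open>b(w\<^sub>k)\<close> alone, started at \<open>0\<close>. Since \<open>s\<close> depends on no other noise, the argument never
  needs \<open>w\<^sub>k\<close> to be independent of the past. The quadratic form of \<open>V\<close> contracts under the
  adjoint linearised step, so that \<open>E \<langle>u, s\<^sub>k\<rangle>\<^sup>2 = O(1/n)\<close>; the Lyapunov function applied to \<open>z\<close> gives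
  \<open>E \<parallel>x\<^sub>k - x\<^sup>*\<parallel>\<^sup>2 = O(1/n)\<close>, and feeding this into the linear recursion of \<open>z\<close>, driven by the
  remainder of \<open>F\<close> and the martingale noise \<open>A\<close>, yields \<open>E \<bar>\<langle>u, z\<^sub>k\<rangle>\<bar> = O(n\<^bsup>-(1+\<delta>)/2\<^esup>)\<close>.

  The projection \<open>\<langle>u, s\<^sub>k\<rangle>\<close> is a sum of independent variables, and Stein's method compares it with a
  Gaussian of the same variance, which is within \<open>O(1/n)\<close> of \<open>\<langle>u, \<Sigma>\<^sub>k u\<rangle>\<close> after rescaling. Sandwiching
  the indicator of \<open>(a, \<infinity>)\<close> between ramps of width \<open>\<rho> a\<close> with \<open>\<rho> = n\<^bsup>-\<delta>/4\<^esup>/2\<close> turns these bounds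
  into an error \<open>O(\<rho>/a)\<close>, without a logarithmic factor.\<close>

section \<open>Symmetric matrices\<close>

text \<open>The obstacle is uniformity over the direction: the noise covariance may be singular, so
  the standard deviation in a given direction may be arbitrarily small or zero, and the final bound
  must not divide by it. Moment estimates therefore hold for all directions \<open>a\<close> at
  once, with the form of \<open>V\<close> as yardstick, and the dynamics acts on \<open>a\<close>
  instead of on the iterate. The hypothesis on \<iota> says that \<alpha> exceeds eight times the
  largest eigenvalue of \<open>V\<close>. This yields the rate \<open>7 / n\<close>, which beats the
  wanted exponents 1 and 2, beats \<open>(1 + \<delta>) / 2\<close> when halved for first moments,
  and leaves \<open>6 / n\<close> under the shifted Jacobian. Decay of the powers of
  \<open>I + h J\<close>, and from it the symmetry and definiteness of \<open>V\<close>, are read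
  off the Lyapunov function, which contracts under the linear step near the origin. The ramp width
  balances two errors: scaled by \<open>sqrt n\<close> the linearisation error is of order
  \<open>n^(-\<delta>/2)\<close>; a ramp of relative width \<rho> divides it by \<rho> and itself
  costs a multiple of \<rho>, so \<rho> is of order \<open>n^(-\<delta>/4)\<close>.\<close>

lemma symmetric_inner:
  fixes A :: "real^'n^'n"
  assumes "transpose A = A"
  shows "(A *v x) \<bullet> y = x \<bullet> (A *v y)"
  by (metis assms dot_lmul_matrix transpose_matrix_vector)

lemma matrix_eq_inner:
  fixes A B :: "real^'n^'m"
  assumes "\<And>x y. x \<bullet> (A *v y) = x \<bullet> (B *v y)"
  shows "A = B"
  by (metis assms matrix_eq vector_eq_rdot inner_commute)

text \<open>A maximiser \<open>e\<close> of the Rayleigh quotient on the unit sphere of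
  \<open>U\<close> is an eigenvector: moving it along the residual \<open>A e - m e\<close>, which
  stays in \<open>U\<close>, would otherwise increase the quotient. The version for an invariant
  subspace lets an eigenbasis be extended one vector at a time.\<close>

lemma invariant_subspace_eigenvector:
  fixes A :: "real^'n^'n"
  assumes sym: "transpose A = A" and U: "subspace U" "U \<noteq> {0}"
    and inv: "\<And>x. x \<in> U \<Longrightarrow> A *v x \<in> U"
  shows "\<exists>e\<in>U. norm e = 1 \<and> A *v e = (e \<bullet> (A *v e)) *\<^sub>R e \<and>
    (\<forall>x\<in>U. x \<bullet> (A *v x) \<le> (e \<bullet> (A *v e)) * (norm x)\<^sup>2)"
proof -
  let ?S = "sphere 0 1 \<inter> U"
  have cl: "compact ?S"
    using closed_subspace[OF U(1)] by (intro compact_Int_closed) auto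
  obtain z where z: "z \<in> U" "z \<noteq> 0"
    using U subspace_0 by blast
  have "z /\<^sub>R norm z \<in> ?S"
    using z U by (auto simp: subspace_scale)
  then have ne: "?S \<noteq> {}" by blast
  have "continuous_on ?S (\<lambda>x. x \<bullet> (A *v x))"
    by (intro continuous_intros matrix_vector_mult_linear_continuous_on)
  from continuous_attains_sup[OF cl ne this] obtain e where
    e: "e \<in> ?S" and max: "\<And>y. y \<in> ?S \<Longrightarrow> y \<bullet> (A *v y) \<le> e \<bullet> (A *v e)" by blast
  define m where "m = e \<bullet> (A *v e)"
  have eU: "e \<in> U" and e1: "norm e = 1" using e by auto
  have ray: "x \<bullet> (A *v x) \<le> m * (norm x)\<^sup>2" if "x \<in> U" for x
  proof (cases "x = 0")
    case False
    have "x /\<^sub>R norm x \<in> ?S" using that False U by (auto simp: subspace_scale)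
    from max[OF this] have "(x \<bullet> (A *v x)) / (norm x)\<^sup>2 \<le> m"
      by (simp add: matrix_vector_mult_scaleR m_def power2_eq_square field_simps)
    then show ?thesis using False by (simp add: field_simps)
  qed auto
  define r where "r = A *v e - m *\<^sub>R e"
  have ee: "e \<bullet> e = 1" using e1 by (simp add: norm_eq_1)
  have rU: "r \<in> U" unfolding r_def using U eU inv by (simp add: subspace_diff subspace_scale)
  have re: "r \<bullet> e = 0" "e \<bullet> r = 0"
    by (simp_all add: r_def m_def inner_diff_left inner_diff_right ee inner_commute)
  have rAe: "r \<bullet> (A *v e) = r \<bullet> r"
  proof -
    have "A *v e = r + m *\<^sub>R e" by (simp add: r_def)
    then show ?thesis by (simp add: inner_add_right re)
  qed
  define c where "c = m * (norm r)\<^sup>2 - r \<bullet> (A *v r)"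
  \<comment> \<open>Maximality tested at \<open>e + t r\<close>: the first-order gain
    \<open>2 t |r|^2\<close> cannot exceed the second-order term \<open>t^2 c\<close>. A small
    \<open>t\<close> then forces \<open>r = 0\<close>.\<close>
  have key: "2 * (r \<bullet> r) \<le> t * c" if t: "t > 0" for t
  proof -
    have "e + t *\<^sub>R r \<in> U" using U eU rU by (simp add: subspace_add subspace_scale)
    from ray[OF this] have "(e + t *\<^sub>R r) \<bullet> (A *v (e + t *\<^sub>R r)) \<le> m * (norm (e + t *\<^sub>R r))\<^sup>2" .
    also have "(norm (e + t *\<^sub>R r))\<^sup>2 = 1 + t\<^sup>2 * (norm r)\<^sup>2"
      unfolding power2_norm_eq_inner by (simp add: inner_add_left inner_add_right re ee power2_eq_square)
    also have "(e + t *\<^sub>R r) \<bullet> (A *v (e + t *\<^sub>R r)) = m + 2 * t * (r \<bullet> r) + t\<^sup>2 * (r \<bullet> (A *v r))"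
    proof -
      have "e \<bullet> (A *v r) = r \<bullet> r"
        using rAe symmetric_inner[OF sym, of e r] by (simp add: inner_commute)
      then show ?thesis
        by (simp add: matrix_vector_right_distrib matrix_vector_mult_scaleR inner_add_left
          inner_add_right rAe m_def[symmetric] power2_eq_square algebra_simps)
    qed
    finally have "t * (2 * (r \<bullet> r)) \<le> t * (t * c)"
      by (simp add: c_def power2_eq_square algebra_simps)
    then show ?thesis using t by (simp add: mult_le_cancel_left_pos)
  qed
  have "r \<bullet> r \<le> 0"
  proof (rule ccontr)
    assume "\<not> r \<bullet> r \<le> 0"
    then have p: "r \<bullet> r > 0" by (rule not_le_imp_less)
    have "(r \<bullet> r) / (\<bar>c\<bar> + 1) > 0" by (rule divide_pos_pos[OF p]) simp
    from key[OF this] have "2 * (r \<bullet> r) \<le> ((r \<bullet> r) / (\<bar>c\<bar> + 1)) * c" .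
    also have "\<dots> = (r \<bullet> r) * (c / (\<bar>c\<bar> + 1))" by simp
    also have "\<dots> \<le> (r \<bullet> r) * 1" 
    proof (intro mult_left_mono)
      show "c / (\<bar>c\<bar> + 1) \<le> 1" using abs_ge_self[of c] by (subst divide_le_eq_1_pos) linarith+
    qed (use p in simp)
    finally show False using p by simp
  qed
  then have "r = 0" by (metis inner_ge_zero inner_eq_zero_iff antisym)
  then show ?thesis using eU e1 ray unfolding r_def m_def by (intro bexI[of _ e]) auto
qed

text \<open>An orthonormal set of eigenvectors of maximal cardinality must span: its orthogonal
  complement is invariant by symmetry and would otherwise supply one more eigenvector.\<close>

lemma symmetric_eigenbasis:
  fixes A :: "real^'n^'n"
  assumes sym: "transpose A = A"
  shows "\<exists>E. finite E \<and> pairwise orthogonal E \<and> (\<forall>e\<in>E. norm e = 1) \<and> span E = UNIV \<and>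
    (\<forall>e\<in>E. A *v e = (e \<bullet> (A *v e)) *\<^sub>R e)"
proof -
  let ?P = "\<lambda>E :: (real^'n) set. pairwise orthogonal E \<and> (\<forall>e\<in>E. norm e = 1) \<and>
    (\<forall>e\<in>E. A *v e = (e \<bullet> (A *v e)) *\<^sub>R e)"
  have fin: "finite E" if "?P E" for E
    using that pairwise_orthogonal_imp_finite by blast
  have ind: "independent E" if "?P E" for E
  proof (rule pairwise_orthogonal_independent)
    show "0 \<notin> E" using that by force
  qed (use that in blast)
  have bd: "card E \<le> DIM(real^'n)" if "?P E" for E
    using independent_bound_general[OF ind[OF that]] dim_subset_UNIV[of E] by simp
  have "\<exists>E. ?P E \<and> (\<forall>E'. ?P E' \<longrightarrow> card E' \<le> card E)"
  proof (rule Lattices_Big.ex_has_greatest_nat[where b = "DIM(real^'n) + 1"])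
    show "?P {}" by simp
    show "\<forall>E. ?P E \<longrightarrow> card E < DIM(real^'n) + 1" using bd by force
  qed
  then obtain E where E: "?P E" and mx: "\<And>E'. ?P E' \<Longrightarrow> card E' \<le> card E" by blast
  have "span E = UNIV"
  proof (rule ccontr)
    assume n: "span E \<noteq> UNIV"
    define U where "U = {y. \<forall>x\<in>E. orthogonal x y}"
    have sU: "subspace U" unfolding U_def by (rule subspace_orthogonal_to_vectors)
    have "span E \<subset> span UNIV" using n by auto
    from orthogonal_to_subspace_exists_gen[OF this] obtain x where
      "x \<noteq> 0" "\<And>y. y \<in> span E \<Longrightarrow> orthogonal x y" by blast
    then have nz: "U \<noteq> {0}" unfolding U_def by (auto simp: orthogonal_commute span_base)
    have inv: "A *v y \<in> U" if "y \<in> U" for y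
    proof -
      have "x \<bullet> (A *v y) = 0" if x: "x \<in> E" for x
      proof -
        have "x \<bullet> (A *v y) = (A *v x) \<bullet> y" by (simp add: symmetric_inner[OF sym])
        also have "\<dots> = 0" using E x \<open>y \<in> U\<close>
          by (metis (no_types, lifting) U_def inner_scaleR_left mem_Collect_eq mult_zero_right orthogonal_def)
        finally show ?thesis .
      qed
      then show ?thesis by (simp add: U_def orthogonal_def)
    qed
    obtain e where e: "e \<in> U" "norm e = 1" "A *v e = (e \<bullet> (A *v e)) *\<^sub>R e"
      using invariant_subspace_eigenvector[OF sym sU nz inv] by blast
    have "e \<notin> E" using e unfolding U_def by (force simp: orthogonal_self)
    moreover have "?P (insert e E)"
      using E e unfolding U_def by (auto simp: pairwise_insert orthogonal_commute)
    ultimately show False using mx[of "insert e E"] fin[OF E] by simp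
  qed
  with E fin show ?thesis by blast
qed

lemma orthonormal_basis_inner:
  fixes x y :: "real^'n"
  assumes "finite E" "pairwise orthogonal E" "\<forall>e\<in>E. norm e = 1" "span E = UNIV"
  shows "x \<bullet> y = (\<Sum>e\<in>E. (x \<bullet> e) * (y \<bullet> e))"
proof -
  have "x \<bullet> y = x \<bullet> (\<Sum>e\<in>E. (y \<bullet> e) *\<^sub>R e)"
    using orthonormal_basis_expand[of E y] assms by simp
  then show ?thesis by (simp add: inner_sum_right mult.commute)
qed

lemma eigenbasis_quadratic:
  fixes A :: "real^'n^'n"
  assumes sym: "transpose A = A"
    and E: "finite E" "pairwise orthogonal E" "\<forall>e\<in>E. norm e = 1" "span E = UNIV"
    and eig: "\<forall>e\<in>E. A *v e = (e \<bullet> (A *v e)) *\<^sub>R e"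
  shows "x \<bullet> (A *v y) = (\<Sum>e\<in>E. (e \<bullet> (A *v e)) * ((x \<bullet> e) * (y \<bullet> e)))"
proof -
  have "x \<bullet> (A *v y) = (\<Sum>e\<in>E. (x \<bullet> e) * ((A *v y) \<bullet> e))"
    by (rule orthonormal_basis_inner[OF E])
  also have "\<dots> = (\<Sum>e\<in>E. (e \<bullet> (A *v e)) * ((x \<bullet> e) * (y \<bullet> e)))"
  proof (intro sum.cong refl)
    fix e assume "e \<in> E"
    then have "(A *v y) \<bullet> e = (e \<bullet> (A *v e)) * (y \<bullet> e)"
      using eig symmetric_inner[OF sym, of y e] by (metis inner_scaleR_right)
    then show "(x \<bullet> e) * ((A *v y) \<bullet> e) = (e \<bullet> (A *v e)) * ((x \<bullet> e) * (y \<bullet> e))" by simp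
  qed
  finally show ?thesis .
qed

text \<open>\<open>lambda_max\<close> is a \<open>Max\<close>, which is informative only for a
  finite set. An eigenvector has a nonzero component along some basis vector \<open>e\<close>, and
  symmetry then identifies its eigenvalue with that of \<open>e\<close>.\<close>

lemma symmetric_eigenvalues_finite:
  fixes A :: "real^'n^'n"
  assumes sym: "transpose A = A"
  shows "finite {c. eigenvalue A c}"
proof -
  obtain E where E: "finite E" "pairwise orthogonal E" "\<forall>e\<in>E. norm e = 1" "span E = UNIV"
    "\<forall>e\<in>E. A *v e = (e \<bullet> (A *v e)) *\<^sub>R e"
    using symmetric_eigenbasis[OF sym] by blast
  have "{c. eigenvalue A c} \<subseteq> (\<lambda>e. e \<bullet> (A *v e)) ` E"
  proof safe
    fix c assume "eigenvalue A c"
    then obtain v where v: "v \<noteq> 0" "A *v v = c *\<^sub>R v"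
      by (auto simp: eigenvalue_def scalar_mult_eq_scaleR)
    have "\<exists>e\<in>E. v \<bullet> e \<noteq> 0"
    proof (rule ccontr)
      assume "\<not> ?thesis"
      then have "v \<bullet> v = 0" by (simp add: orthonormal_basis_inner[OF E(1-4), of v v])
      with v show False by simp
    qed
    then obtain e where e: "e \<in> E" "v \<bullet> e \<noteq> 0" by blast
    have "c * (v \<bullet> e) = v \<bullet> (A *v e)" using symmetric_inner[OF sym, of v e] v by simp
    also have "\<dots> = (e \<bullet> (A *v e)) * (v \<bullet> e)" using E(5) e by (metis inner_scaleR_right)
    finally show "c \<in> (\<lambda>e. e \<bullet> (A *v e)) ` E" using e by auto
  qed
  then show ?thesis using E(1) finite_surj by blast
qed

lemma lambda_max_rayleigh:
  fixes A :: "real^'n^'n"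
  assumes sym: "transpose A = A"
  shows "x \<bullet> (A *v x) \<le> lambda_max A * (norm x)\<^sup>2"
proof -
  have "(UNIV :: (real^'n) set) \<noteq> {0}"
    by (metis UNIV_I singletonD zero_neq_one)
  then obtain e where e: "norm e = 1" "A *v e = (e \<bullet> (A *v e)) *\<^sub>R e"
    and r: "\<And>x. x \<bullet> (A *v x) \<le> (e \<bullet> (A *v e)) * (norm x)\<^sup>2"
    using invariant_subspace_eigenvector[OF sym, of UNIV] by auto
  have "eigenvalue A (e \<bullet> (A *v e))"
    unfolding eigenvalue_def scalar_mult_eq_scaleR using e by (metis norm_zero zero_neq_one)
  then have "e \<bullet> (A *v e) \<le> lambda_max A"
    unfolding lambda_max_def using symmetric_eigenvalues_finite[OF sym] by (intro Max_ge) auto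
  then show ?thesis using r[of x] by (meson mult_right_mono order_trans zero_le_power2)
qed

lemma pos_semidef_sqrt_exists:
  fixes A :: "real^'n^'n"
  assumes "pos_semidef A"
  shows "\<exists>B. pos_semidef B \<and> B ** B = A"
proof -
  have sym: "transpose A = A" and pos: "\<And>v. 0 \<le> v \<bullet> (A *v v)"
    using assms by (auto simp: pos_semidef_def)
  obtain E where E: "finite E" "pairwise orthogonal E" "\<forall>e\<in>E. norm e = 1" "span E = UNIV"
    and eig: "\<forall>e\<in>E. A *v e = (e \<bullet> (A *v e)) *\<^sub>R e"
    using symmetric_eigenbasis[OF sym] by blast
  define c where "c e = sqrt (e \<bullet> (A *v e))" for e
  define f where "f x = (\<Sum>e\<in>E. (c e * (x \<bullet> e)) *\<^sub>R e)" for x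
  have lin: "linear f"
    unfolding f_def by (intro linearI)
      (simp_all add: inner_add_left algebra_simps sum.distrib scaleR_sum_right)
  define B where "B = matrix f"
  have Bf: "B *v x = f x" for x unfolding B_def using lin by (simp add: matrix_works)
  have fe: "f x \<bullet> e = c e * (x \<bullet> e)" if "e \<in> E" for x e
  proof -
    have "f x \<bullet> e = (\<Sum>i\<in>E. if i = e then c e * (x \<bullet> e) else 0)"
      unfolding f_def inner_sum_left
      using E that by (intro sum.cong refl) (auto simp: pairwise_def orthogonal_def norm_eq_1)
    then show ?thesis using E that by simp
  qed
  have q: "x \<bullet> (B *v y) = (\<Sum>e\<in>E. c e * ((x \<bullet> e) * (y \<bullet> e)))" for x y
    unfolding Bf orthonormal_basis_inner[OF E, of x "f y"] by (intro sum.cong) (auto simp: fe)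
  have "transpose B = B"
  proof (rule matrix_eq_inner)
    fix x y
    have "x \<bullet> (transpose B *v y) = y \<bullet> (B *v x)"
      by (metis dot_lmul_matrix inner_commute transpose_matrix_vector)
    then show "x \<bullet> (transpose B *v y) = x \<bullet> (B *v y)" by (simp add: q mult.commute)
  qed
  moreover have "0 \<le> v \<bullet> (B *v v)" for v
    unfolding q c_def using pos by (intro sum_nonneg) auto
  moreover have "B ** B = A"
  proof (rule matrix_eq_inner)
    fix x y
    have "x \<bullet> ((B ** B) *v y) = x \<bullet> (B *v f y)" by (simp add: matrix_vector_mul_assoc[symmetric] Bf)
    also have "\<dots> = (\<Sum>e\<in>E. c e * c e * ((x \<bullet> e) * (y \<bullet> e)))"
      unfolding q by (intro sum.cong) (auto simp: fe)
    also have "\<dots> = x \<bullet> (A *v y)"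
      using eigenbasis_quadratic[OF sym E eig, of x y] pos by (simp add: c_def)
    finally show "x \<bullet> ((B ** B) *v y) = x \<bullet> (A *v y)" .
  qed
  ultimately show ?thesis unfolding pos_semidef_def by blast
qed

lemma symmetric_no_eigenvalue_zero:
  fixes D :: "real^'n^'n"
  assumes sym: "transpose D = D" and ev: "\<And>v c. D *v v = c *\<^sub>R v \<Longrightarrow> v \<noteq> 0 \<Longrightarrow> c = 0"
  shows "D = 0"
proof -
  obtain E where E: "finite E" "pairwise orthogonal E" "\<forall>e\<in>E. norm e = 1" "span E = UNIV"
    and eig: "\<forall>e\<in>E. D *v e = (e \<bullet> (D *v e)) *\<^sub>R e"
    using symmetric_eigenbasis[OF sym] by blast
  have "e \<bullet> (D *v e) = 0" if "e \<in> E" for e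
  proof (rule ev)
    show "D *v e = (e \<bullet> (D *v e)) *\<^sub>R e" using eig that by blast
    show "e \<noteq> 0" using E that by force
  qed
  then have "x \<bullet> (D *v y) = 0" for x y
    using eigenbasis_quadratic[OF sym E eig, of x y] by simp
  then show ?thesis by (intro matrix_eq_inner) simp
qed

text \<open>If \<open>v\<close> is an eigenvector of \<open>B - C\<close> with eigenvalue
  \<open>c\<close>, equality of the squares gives
  \<open>c (v \<bullet> B v + v \<bullet> C v) = 0\<close>. For \<open>c \<noteq> 0\<close> both
  forms vanish at \<open>v\<close>, hence so does \<open>v \<bullet> (B - C) v = c |v|^2\<close>,
  which is absurd.\<close>

lemma pos_semidef_sqrt_unique:
  fixes B C :: "real^'n^'n"
  assumes B: "pos_semidef B" and C: "pos_semidef C" and eq: "B ** B = C ** C"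
  shows "B = C"
proof -
  have sB: "transpose B = B" and sC: "transpose C = C"
    and pB: "\<And>v. 0 \<le> v \<bullet> (B *v v)" and pC: "\<And>v. 0 \<le> v \<bullet> (C *v v)"
    using B C by (auto simp: pos_semidef_def)
  have "B - C = 0"
  proof (rule symmetric_no_eigenvalue_zero)
    show "transpose (B - C) = B - C" using sB sC by (simp add: transpose_def vec_eq_iff)
    fix v c assume ev: "(B - C) *v v = c *\<^sub>R v" and v: "v \<noteq> 0"
    have d: "B *v v - C *v v = c *\<^sub>R v" using ev by (simp add: matrix_vector_mult_diff_rdistrib)
    have "0 = v \<bullet> (B *v (B *v v)) - v \<bullet> (C *v (C *v v))"
      by (simp add: matrix_vector_mul_assoc eq)
    also have "\<dots> = (B *v v) \<bullet> (B *v v) - (C *v v) \<bullet> (C *v v)"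
      by (simp add: symmetric_inner[OF sB] symmetric_inner[OF sC])
    also have "\<dots> = (B *v v - C *v v) \<bullet> (B *v v + C *v v)"
      by (simp add: inner_diff_left inner_add_right inner_diff_right inner_commute[of "C *v v" "B *v v"])
    also have "\<dots> = c * (v \<bullet> (B *v v) + v \<bullet> (C *v v))"
      unfolding d by (simp add: inner_add_right distrib_left)
    finally have z: "c * (v \<bullet> (B *v v) + v \<bullet> (C *v v)) = 0" by simp
    show "c = 0"
    proof (rule ccontr)
      assume "c \<noteq> 0"
      with z have "v \<bullet> (B *v v) = 0" "v \<bullet> (C *v v) = 0" using pB[of v] pC[of v] by auto
      then have "v \<bullet> (B *v v - C *v v) = 0" by (simp add: inner_diff_right)
      then show False using \<open>c \<noteq> 0\<close> v by (simp add: d)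
    qed
  qed
  then show ?thesis by simp
qed

lemma mat_sqrt_correct:
  fixes A :: "real^'n^'n"
  assumes "pos_semidef A"
  shows "pos_semidef (mat_sqrt A)" "mat_sqrt A ** mat_sqrt A = A"
proof -
  have "\<exists>!B. pos_semidef B \<and> B ** B = A"
    using pos_semidef_sqrt_exists[OF assms] pos_semidef_sqrt_unique by metis
  from theI'[OF this] show "pos_semidef (mat_sqrt A)" "mat_sqrt A ** mat_sqrt A = A"
    unfolding mat_sqrt_def by auto
qed

text \<open>Removes the matrix square root from the claim: the standard deviation in direction
  \<open>x\<close> is the root of the quadratic form of the covariance.\<close>

lemma norm_mat_sqrt:
  fixes A :: "real^'n^'n"
  assumes "pos_semidef A"
  shows "(norm (x v* mat_sqrt A))\<^sup>2 = x \<bullet> (A *v x)"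
proof -
  let ?B = "mat_sqrt A"
  have s: "transpose ?B = ?B" using mat_sqrt_correct(1)[OF assms] by (simp add: pos_semidef_def)
  have "x v* ?B = ?B *v x" by (metis s transpose_matrix_vector)
  then have "(norm (x v* ?B))\<^sup>2 = x \<bullet> (?B *v (?B *v x))"
    by (simp add: power2_norm_eq_inner symmetric_inner[OF s])
  then show ?thesis by (simp add: matrix_vector_mul_assoc mat_sqrt_correct(2)[OF assms])
qed

section \<open>Stable linear recursions and the Lyapunov equation\<close>

text \<open>One half of the equivalence of norms; it turns smoothness with respect to
  \<open>norm_s\<close> into smoothness with respect to the Euclidean norm.\<close>

lemma is_norm_bounded:
  fixes N :: "real^'n \<Rightarrow> real"
  assumes "is_norm N"
  shows "\<exists>C>0. \<forall>x. N x \<le> C * norm x"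
proof -
  have N0: "N 0 = 0" and tri: "\<And>x y. N (x + y) \<le> N x + N y" and nn: "\<And>x. 0 \<le> N x"
    and sc: "\<And>c x. N (c *\<^sub>R x) = \<bar>c\<bar> * N x"
    using assms by (auto simp: is_norm_def)
  have sm: "N (\<Sum>i\<in>I. f i) \<le> (\<Sum>i\<in>I. N (f i))" if "finite I" for I and f :: "'n \<Rightarrow> real^'n"
    using that
  proof induction
    case (insert i I)
    then show ?case using tri[of "f i" "sum f I"] by simp
  qed (simp add: N0)
  let ?C = "(\<Sum>i\<in>UNIV. N (axis i 1)) + 1"
  have "N x \<le> ?C * norm x" for x
  proof -
    have "N x = N (\<Sum>i\<in>UNIV. x $ i *\<^sub>R axis i 1)"
      using basis_expansion[of x] by (simp add: scalar_mult_eq_scaleR)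
    also have "\<dots> \<le> (\<Sum>i\<in>UNIV. N (x $ i *\<^sub>R axis i 1))" by (rule sm) simp
    also have "\<dots> \<le> (\<Sum>i\<in>UNIV. norm x * N (axis i 1))"
      unfolding sc by (intro sum_mono mult_right_mono nn component_le_norm_cart)
    also have "\<dots> \<le> ?C * norm x" by (simp add: sum_distrib_left[symmetric] algebra_simps)
    finally show ?thesis .
  qed
  moreover have "?C > 0" using nn by (simp add: sum_nonneg add_nonneg_pos)
  ultimately show ?thesis by blast
qed

lemma uminus_matrix_vector: "(- A) *v x = - (A *v x)" for A :: "real^'n^'m"
  using matrix_vector_mult_diff_rdistrib[of 0 A x] by simp

lemma cauchy_schwarz_mult:
  fixes x y :: "'a::real_inner"
  assumes "norm x \<le> b" "norm y \<le> c"
  shows "\<bar>x \<bullet> y\<bar> \<le> b * c"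
  by (meson Cauchy_Schwarz_ineq2 assms mult_mono norm_ge_zero order_trans)

section \<open>Consequences of the Lyapunov and operator conditions\<close>

locale stable_operator =
  fixes F R :: "real ^ 'd \<Rightarrow> real ^ 'd" and xstar :: "real ^ 'd"
    and \<Phi> norm_s :: "real ^ 'd \<Rightarrow> real" and grad :: "real ^ 'd \<Rightarrow> real ^ 'd"
    and \<gamma> L\<^sub>s l u r C\<^sub>r \<delta> L\<^sub>F :: real
    and J :: "real ^ 'd ^ 'd"
  assumes root: "F xstar = 0"
    and A1: "lyapunov_condition F xstar \<Phi> grad norm_s \<gamma> L\<^sub>s l u"
    and A2: "operator_condition F xstar J R r C\<^sub>r \<delta> L\<^sub>F"
begin

lemma pos: "\<gamma> > 0" "L\<^sub>s > 0" "l > 0" "u > 0" "r > 0" "\<delta> > 0" "\<delta> \<le> 1" "L\<^sub>F > 0"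
  using A1 A2 by (auto simp: lyapunov_condition_def operator_condition_def)

lemma F_lipschitz: "norm (F x - F y) \<le> L\<^sub>F * norm (x - y)"
  using A2 by (auto simp: operator_condition_def)

lemma F_lipschitz': "norm (F (xstar + x) - F (xstar + y)) \<le> L\<^sub>F * norm (x - y)"
  using F_lipschitz[of "xstar + x" "xstar + y"] by simp

lemma norm_F: "norm (F (xstar + x)) \<le> L\<^sub>F * norm x"
  using F_lipschitz[of "xstar + x" xstar] by (simp add: root)

lemma Phi_upper: "l * \<Phi> x \<le> (norm x)\<^sup>2" and Phi_lower: "(norm x)\<^sup>2 \<le> u * \<Phi> x"
  using A1 by (auto simp: lyapunov_condition_def)

lemma Phi_nonneg: "0 \<le> \<Phi> x"
  using Phi_lower[of x] pos(4) by (meson order_trans zero_le_mult_iff zero_le_power2 not_less)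

lemma grad_F: "grad x \<bullet> F (xstar + x) \<le> - 2 * \<gamma> * \<Phi> x"
proof -
  have "grad ((xstar + x) - xstar) \<bullet> F (xstar + x) \<le> - 2 * \<gamma> * \<Phi> ((xstar + x) - xstar)"
    using A1 unfolding lyapunov_condition_def by blast
  then show ?thesis by simp
qed

lemma Phi_smooth: "\<exists>L>0. \<forall>x y. \<Phi> (x + y) \<le> \<Phi> x + grad x \<bullet> y + L / 2 * (norm y)\<^sup>2"
proof -
  obtain C where C: "C > 0" "\<And>x. norm_s x \<le> C * norm x"
    using is_norm_bounded A1 unfolding lyapunov_condition_def by blast
  have n0: "0 \<le> norm_s x" for x using A1 by (auto simp: lyapunov_condition_def is_norm_def)
  have "\<Phi> (x + y) \<le> \<Phi> x + grad x \<bullet> y + (L\<^sub>s * C\<^sup>2) / 2 * (norm y)\<^sup>2" for x y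
  proof -
    have "\<Phi> (x + y) \<le> \<Phi> x + grad x \<bullet> ((x + y) - x) + L\<^sub>s / 2 * (norm_s (x - (x + y)))\<^sup>2"
      using A1 unfolding lyapunov_condition_def by blast
    moreover have "(norm_s (x - (x + y)))\<^sup>2 \<le> (C * norm y)\<^sup>2"
      using C(2)[of "- y"] n0[of "- y"] by (intro power_mono) auto
    then have "L\<^sub>s / 2 * (norm_s (x - (x + y)))\<^sup>2 \<le> L\<^sub>s / 2 * (C * norm y)\<^sup>2"
      using pos by (intro mult_left_mono) auto
    ultimately show ?thesis by (simp add: power_mult_distrib)
  qed
  moreover have "L\<^sub>s * C\<^sup>2 > 0" using C pos by simp
  ultimately show ?thesis by blast
qed

definition L where "L = (SOME L. L > 0 \<and> (\<forall>x y. \<Phi> (x + y) \<le> \<Phi> x + grad x \<bullet> y + L / 2 * (norm y)\<^sup>2))"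

lemma L_pos: "L > 0" and Phi_step: "\<Phi> (x + y) \<le> \<Phi> x + grad x \<bullet> y + L / 2 * (norm y)\<^sup>2"
proof -
  have "L > 0 \<and> (\<forall>x y. \<Phi> (x + y) \<le> \<Phi> x + grad x \<bullet> y + L / 2 * (norm y)\<^sup>2)"
    unfolding L_def by (rule someI_ex) (use Phi_smooth in blast)
  then show "L > 0" "\<Phi> (x + y) \<le> \<Phi> x + grad x \<bullet> y + L / 2 * (norm y)\<^sup>2" by auto
qed

text \<open>The constant of \<open>norm_grad\<close>: \<open>|grad x|^2 \<le> 2 L \<Phi> x\<close>
  by smoothness and nonnegativity, and \<open>\<Phi> x \<le> |x|^2 / l\<close>.\<close>

definition G where "G = sqrt (2 * L / l)"

lemma G_pos: "G > 0" using L_pos pos by (simp add: G_def)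

text \<open>Compare \<open>x\<close> with the point reached by one gradient step.\<close>

lemma norm_grad: "norm (grad x) \<le> G * norm x"
proof -
  let ?g = "(norm (grad x))\<^sup>2"
  have "0 \<le> \<Phi> (x + (- (1 / L)) *\<^sub>R grad x)" by (rule Phi_nonneg)
  also have "\<dots> \<le> \<Phi> x + grad x \<bullet> ((- (1 / L)) *\<^sub>R grad x) + L / 2 * (norm ((- (1 / L)) *\<^sub>R grad x))\<^sup>2"
    by (rule Phi_step)
  also have "\<dots> = \<Phi> x - ?g / (2 * L)"
    using L_pos by (simp add: power_mult_distrib power2_norm_eq_inner[symmetric] power2_eq_square[of L] field_simps)
  finally have "?g \<le> 2 * L * \<Phi> x" using L_pos by (simp add: field_simps)
  also have "\<dots> \<le> 2 * L * ((norm x)\<^sup>2 / l)"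
    using Phi_upper[of x] L_pos pos by (intro mult_left_mono) (auto simp: field_simps)
  also have "\<dots> = (G * norm x)\<^sup>2"
    using L_pos pos by (simp add: G_def power_mult_distrib)
  finally show ?thesis using G_pos by (simp add: power2_le_iff_abs_le)
qed

definition L\<^sub>J where "L\<^sub>J = (SOME b. b > 0 \<and> (\<forall>x. norm (J *v x) \<le> b * norm x))"

lemma LJ_pos: "L\<^sub>J > 0" and norm_J: "norm (J *v x) \<le> L\<^sub>J * norm x"
proof -
  have "bounded_linear ((*v) J)" by (rule matrix_vector_mul_bounded_linear)
  from bounded_linear.pos_bounded[OF this] obtain b where "b > 0" "\<And>x. norm (J *v x) \<le> b * norm x"
    by (auto simp: mult.commute)
  then have "\<exists>b. b > 0 \<and> (\<forall>x. norm (J *v x) \<le> b * norm x)" by blast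
  from someI_ex[OF this] show "L\<^sub>J > 0" "norm (J *v x) \<le> L\<^sub>J * norm x"
    unfolding L\<^sub>J_def by auto
qed

text \<open>The transpose obeys the bound of \<open>J\<close> itself, because the squared norm of
  its value at \<open>a\<close> is \<open>a \<bullet> J (a v* J)\<close>; one factor
  cancels.\<close>

lemma norm_JT: "norm (a v* J) \<le> L\<^sub>J * norm a"
proof (cases "norm (a v* J) = 0")
  case False
  have "norm (a v* J) * norm (a v* J) = a \<bullet> (J *v (a v* J))"
    by (simp add: dot_lmul_matrix[symmetric] power2_norm_eq_inner[symmetric] power2_eq_square)
  also have "\<dots> \<le> norm a * (L\<^sub>J * norm (a v* J))"
    using cauchy_schwarz_mult[OF order_refl norm_J] by (meson abs_le_D1)
  finally have "norm (a v* J) * norm (a v* J) \<le> (L\<^sub>J * norm a) * norm (a v* J)"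
    by (simp add: mult_ac)
  then show ?thesis using False by (simp add: mult_le_cancel_right)
qed (use LJ_pos in simp)

definition Rem where "Rem x = F (xstar + x) - J *v x"

text \<open>Makes the local expansion global. Outside the ball of radius \<open>r\<close> the
  remainder grows at most linearly, and there
  \<open>|x| \<le> |x|^(1+\<delta>) / r^\<delta>\<close>.\<close>

lemma norm_Rem: "\<exists>C>0. \<forall>x. norm (Rem x) \<le> C * norm x powr (1 + \<delta>)"
proof -
  let ?C = "\<bar>C\<^sub>r\<bar> + (L\<^sub>F + L\<^sub>J) / r powr \<delta>"
  have "norm (Rem x) \<le> ?C * norm x powr (1 + \<delta>)" for x
  proof (cases "norm x < r")
    case True
    then have "xstar + x \<in> ball xstar r" by (simp add: dist_norm)
    then have "F (xstar + x) = J *v (xstar + x - xstar) + R (xstar + x)"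
      "norm (R (xstar + x)) \<le> C\<^sub>r * norm (xstar + x - xstar) powr (1 + \<delta>)"
      using A2 unfolding operator_condition_def by blast+
    then have "norm (Rem x) \<le> C\<^sub>r * norm x powr (1 + \<delta>)" by (simp add: Rem_def)
    also have "\<dots> \<le> ?C * norm x powr (1 + \<delta>)"
      using pos LJ_pos by (intro mult_right_mono) (auto intro: add_increasing2)
    finally show ?thesis .
  next
    case False
    then have x: "norm x \<ge> r" "norm x > 0" using pos by auto
    have "norm (Rem x) \<le> norm (F (xstar + x)) + norm (J *v x)"
      unfolding Rem_def by (rule norm_triangle_ineq4)
    also have "\<dots> \<le> (L\<^sub>F + L\<^sub>J) * norm x" using norm_F[of x] norm_J[of x] by (simp add: algebra_simps)
    also have "\<dots> \<le> (L\<^sub>F + L\<^sub>J) * (norm x * (norm x powr \<delta> / r powr \<delta>))"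
    proof (intro mult_left_mono)
      have "r powr \<delta> \<le> norm x powr \<delta>" using x pos by (intro powr_mono2) auto
      then have "1 \<le> norm x powr \<delta> / r powr \<delta>" using pos by simp
      then have "norm x * 1 \<le> norm x * (norm x powr \<delta> / r powr \<delta>)" by (rule mult_left_mono) simp
      then show "norm x \<le> norm x * (norm x powr \<delta> / r powr \<delta>)" by (simp only: mult_1_right)
    qed (use pos LJ_pos in simp)
    also have "\<dots> = (L\<^sub>F + L\<^sub>J) / r powr \<delta> * norm x powr (1 + \<delta>)"
      using x by (simp add: powr_add)
    also have "\<dots> \<le> ?C * norm x powr (1 + \<delta>)" by (intro mult_right_mono) auto
    finally show ?thesis .
  qed
  moreover have "?C > 0" using pos LJ_pos by (intro add_nonneg_pos divide_pos_pos) auto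
  ultimately show ?thesis by blast
qed

section \<open>The Euler step of the linearisation, its adjoint, and the decay of their
  powers\<close>

definition step where "step h x = x + h *\<^sub>R (J *v x)"
definition stepT where "stepT h a = a + h *\<^sub>R (a v* J)"

lemma step_adjoint: "stepT h a \<bullet> x = a \<bullet> step h x"
  by (simp add: step_def stepT_def inner_add_left inner_add_right dot_lmul_matrix)

lemma step_pow_adjoint: "((stepT h ^^ n) a) \<bullet> x = a \<bullet> ((step h ^^ n) x)"
proof (induction n arbitrary: a)
  case (Suc n)
  have "(stepT h ^^ Suc n) a \<bullet> x = (stepT h ^^ n) (stepT h a) \<bullet> x" by (simp add: funpow_swap1)
  also have "\<dots> = a \<bullet> ((step h ^^ Suc n) x)" by (simp add: Suc step_adjoint)
  finally show ?case .
qed simp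

lemma step_pow_scaleR: "(step h ^^ n) (c *\<^sub>R x) = c *\<^sub>R (step h ^^ n) x"
  by (induction n) (simp_all add: step_def matrix_vector_mult_scaleR algebra_simps)

text \<open>Near the origin \<Phi> also decreases along the linear field: of the drift
  \<open>-2 \<gamma> \<Phi>\<close> of \<open>F\<close>, the remainder costs
  \<open>\<gamma> / 2\<close> and the second-order term of the step another
  \<open>\<gamma> / 2\<close>, which leaves \<open>-\<gamma>\<close>.\<close>

lemma Phi_step_contract:
  "\<exists>\<rho>>0. \<exists>h\<^sub>0>0. \<forall>h x. 0 < h \<longrightarrow> h \<le> h\<^sub>0 \<longrightarrow> \<Phi> x \<le> \<rho> \<longrightarrow> \<Phi> (step h x) \<le> (1 - \<gamma> * h) * \<Phi> x"
proof -
  obtain C where C: "C > 0" "\<And>x. norm (Rem x) \<le> C * norm x powr (1 + \<delta>)"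
    using norm_Rem by blast
  \<comment> \<open>\<kappa> solves \<open>G C u \<kappa> = \<gamma> / 2\<close>, the share allotted
    to the remainder. The radius \<open>r1\<close> guarantees
    \<open>|x|^\<delta> \<le> \<kappa>\<close>, the sublevel set
    \<open>\<Phi> x \<le> r1^2 / u\<close> lies in that ball, and \<open>h0\<close> limits the
    second-order term to its share.\<close>
  define \<kappa> where "\<kappa> = \<gamma> / (2 * G * C * u)"
  have kp: "\<kappa> > 0" unfolding \<kappa>_def using pos C G_pos by simp
  define r1 where "r1 = \<kappa> powr (1 / \<delta>)"
  have r1: "r1 > 0" unfolding r1_def using kp by simp
  define h0 where "h0 = \<gamma> / (L * L\<^sub>J\<^sup>2 * u)"
  have h0: "h0 > 0" unfolding h0_def using pos L_pos LJ_pos by simp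
  have "\<Phi> (step h x) \<le> (1 - \<gamma> * h) * \<Phi> x" if h: "0 < h" "h \<le> h0" and x: "\<Phi> x \<le> r1\<^sup>2 / u" for h x
  proof -
    have "(norm x)\<^sup>2 \<le> r1\<^sup>2" using Phi_lower[of x] x pos by (simp add: field_simps)
    then have nx: "norm x \<le> r1" using r1 by (simp add: power2_le_iff_abs_le)
    have "norm x powr \<delta> \<le> r1 powr \<delta>" using nx pos by (intro powr_mono2) auto
    also have "\<dots> = \<kappa>" using kp pos by (simp add: r1_def powr_powr)
    finally have nxd: "norm x powr \<delta> \<le> \<kappa>" .
    have "\<bar>grad x \<bullet> Rem x\<bar> \<le> (G * norm x) * (C * norm x powr (1 + \<delta>))"
      by (intro cauchy_schwarz_mult norm_grad C)
    also have "\<dots> = (G * C * (norm x)\<^sup>2) * norm x powr \<delta>"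
      by (cases "x = 0") (simp_all add: powr_add power2_eq_square)
    also have "\<dots> \<le> (G * C * (norm x)\<^sup>2) * \<kappa>" using G_pos C nxd by (intro mult_left_mono) auto
    also have "\<dots> \<le> (G * C * (u * \<Phi> x)) * \<kappa>"
      using G_pos C kp Phi_lower[of x] by (intro mult_right_mono mult_left_mono) auto
    also have "\<dots> = \<gamma> / 2 * \<Phi> x" using G_pos C pos by (simp add: \<kappa>_def field_simps)
    finally have gr: "\<bar>grad x \<bullet> Rem x\<bar> \<le> \<gamma> / 2 * \<Phi> x" .
    have "L / 2 * (norm (h *\<^sub>R (J *v x)))\<^sup>2 = L / 2 * h\<^sup>2 * (norm (J *v x))\<^sup>2"
      by (simp add: power_mult_distrib)
    also have "\<dots> \<le> L / 2 * h\<^sup>2 * (L\<^sub>J\<^sup>2 * (u * \<Phi> x))"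
    proof (intro mult_left_mono)
      have "(norm (J *v x))\<^sup>2 \<le> (L\<^sub>J * norm x)\<^sup>2" by (intro power_mono norm_J) auto
      also have "\<dots> \<le> L\<^sub>J\<^sup>2 * (u * \<Phi> x)"
        unfolding power_mult_distrib by (intro mult_left_mono Phi_lower) auto
      finally show "(norm (J *v x))\<^sup>2 \<le> L\<^sub>J\<^sup>2 * (u * \<Phi> x)" .
    qed (use L_pos in simp)
    also have "\<dots> = h * (L * L\<^sub>J\<^sup>2 * u) * (h / 2 * \<Phi> x)" by (simp add: power2_eq_square)
    also have "\<dots> \<le> h0 * (L * L\<^sub>J\<^sup>2 * u) * (h / 2 * \<Phi> x)"
      using h pos L_pos LJ_pos Phi_nonneg[of x] by (intro mult_right_mono) auto
    also have "\<dots> = \<gamma> * h / 2 * \<Phi> x" using pos L_pos LJ_pos by (simp add: h0_def)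
    finally have sq: "L / 2 * (norm (h *\<^sub>R (J *v x)))\<^sup>2 \<le> \<gamma> * h / 2 * \<Phi> x" .
    have "grad x \<bullet> (J *v x) = grad x \<bullet> F (xstar + x) - grad x \<bullet> Rem x"
      by (simp add: Rem_def inner_diff_right)
    also have "\<dots> \<le> - 2 * \<gamma> * \<Phi> x + \<gamma> / 2 * \<Phi> x" using grad_F[of x] gr by linarith
    finally have "h * (grad x \<bullet> (J *v x)) \<le> h * (- 2 * \<gamma> * \<Phi> x + \<gamma> / 2 * \<Phi> x)"
      using h by (intro mult_left_mono) auto
    with sq Phi_step[of x "h *\<^sub>R (J *v x)"] show ?thesis
      unfolding step_def by (simp add: algebra_simps)
  qed
  moreover have "r1\<^sup>2 / u > 0" using r1 pos by simp
  ultimately show ?thesis using h0 by blast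
qed

text \<open>The contraction holds only on a sublevel set of \<Phi>, but the step is linear, so
  rescaling extends the decay to every vector; \<open>u / l\<close> is the price of passing between
  \<Phi> and the squared norm. Duality carries the bound over to the adjoint.\<close>

lemma stepT_pow_decay:
  "\<exists>h\<^sub>0>0. \<forall>h a n. 0 < h \<longrightarrow> h \<le> h\<^sub>0 \<longrightarrow> \<gamma> * h < 1 \<and>
     (norm ((stepT h ^^ n) a))\<^sup>2 \<le> u / l * (1 - \<gamma> * h) ^ n * (norm a)\<^sup>2"
proof -
  obtain \<rho> h1 where rho: "\<rho> > 0" and h1: "h1 > 0"
    and c: "\<And>h x. 0 < h \<Longrightarrow> h \<le> h1 \<Longrightarrow> \<Phi> x \<le> \<rho> \<Longrightarrow> \<Phi> (step h x) \<le> (1 - \<gamma> * h) * \<Phi> x"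
    using Phi_step_contract by blast
  define h0 where "h0 = min h1 (1 / (2 * \<gamma>))"
  have "h0 > 0" using h1 pos by (simp add: h0_def)
  moreover have "\<gamma> * h < 1 \<and> (norm ((stepT h ^^ n) a))\<^sup>2 \<le> u / l * (1 - \<gamma> * h) ^ n * (norm a)\<^sup>2"
    if h: "0 < h" "h \<le> h0" for h a n
  proof -
    have "\<gamma> * h \<le> \<gamma> * (1 / (2 * \<gamma>))" using h pos by (intro mult_left_mono) (auto simp: h0_def)
    then have gh: "\<gamma> * h < 1" using pos by simp
    have hh: "h \<le> h1" using h by (simp add: h0_def)
    have P: "\<Phi> ((step h ^^ n) x) \<le> (1 - \<gamma> * h) ^ n * \<Phi> x \<and> \<Phi> ((step h ^^ n) x) \<le> \<rho>"
      if x: "\<Phi> x \<le> \<rho>" for x n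
    proof (induction n)
      case (Suc n)
      let ?y = "(step h ^^ n) x"
      have s: "\<Phi> (step h ?y) \<le> (1 - \<gamma> * h) * \<Phi> ?y" using c[OF h(1) hh] Suc by blast
      also have "\<dots> \<le> (1 - \<gamma> * h) * ((1 - \<gamma> * h) ^ n * \<Phi> x)"
        using Suc gh by (intro mult_left_mono) auto
      finally have a: "\<Phi> (step h ?y) \<le> (1 - \<gamma> * h) ^ Suc n * \<Phi> x" by simp
      have "(1 - \<gamma> * h) * \<Phi> ?y \<le> 1 * \<Phi> ?y"
        using Phi_nonneg h pos by (intro mult_right_mono) auto
      with s Suc a show ?case by simp
    qed (use x in simp)
    have S: "(norm ((step h ^^ n) x))\<^sup>2 \<le> u / l * (1 - \<gamma> * h) ^ n * (norm x)\<^sup>2" for x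
    proof (cases "x = 0")
      case True
      then show ?thesis using step_pow_scaleR[where h = h and n = n and c = 0 and x = x] by simp
    next
      case False
      \<comment> \<open>Scales \<open>x\<close> to squared norm \<open>l \<rho>\<close>, so that the
        upper bound on \<Phi> puts the scaled point into the sublevel set where the contraction
        holds.\<close>
      define t where "t = sqrt (l * \<rho>) / norm x"
      have t: "t > 0" using False pos rho by (simp add: t_def)
      have tn: "(norm (t *\<^sub>R x))\<^sup>2 = l * \<rho>"
        using False pos rho by (simp add: t_def power_divide power_mult_distrib)
      have "l * \<Phi> (t *\<^sub>R x) \<le> l * \<rho>" using Phi_upper[of "t *\<^sub>R x"] tn by simp
      then have "\<Phi> (t *\<^sub>R x) \<le> \<rho>" using pos by simp
      from P[OF this] have "\<Phi> ((step h ^^ n) (t *\<^sub>R x)) \<le> (1 - \<gamma> * h) ^ n * \<Phi> (t *\<^sub>R x)" by blast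
      also have "\<dots> \<le> (1 - \<gamma> * h) ^ n * ((norm (t *\<^sub>R x))\<^sup>2 / l)"
        using gh Phi_upper[of "t *\<^sub>R x"] pos
        by (intro mult_left_mono) (auto simp: field_simps simp del: norm_scaleR)
      finally have "u * \<Phi> ((step h ^^ n) (t *\<^sub>R x)) \<le> u * ((1 - \<gamma> * h) ^ n * ((norm (t *\<^sub>R x))\<^sup>2 / l))"
        using pos by (intro mult_left_mono) auto
      with Phi_lower[of "(step h ^^ n) (t *\<^sub>R x)"]
      have "t\<^sup>2 * (norm ((step h ^^ n) x))\<^sup>2 \<le> t\<^sup>2 * (u / l * (1 - \<gamma> * h) ^ n * (norm x)\<^sup>2)"
        by (simp add: step_pow_scaleR power_mult_distrib mult_ac)
      then show ?thesis using t by (subst (asm) mult_le_cancel_left_pos) auto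
    qed
    let ?b = "(stepT h ^^ n) a" and ?c = "u / l * (1 - \<gamma> * h) ^ n"
    have "(norm ?b)\<^sup>2 \<le> ?c * (norm a)\<^sup>2"
    proof (cases "?b = 0")
      case True
      then show ?thesis using pos gh by simp
    next
      case False
      \<comment> \<open>Transposition: \<open>|b|^2\<close> is at most \<open>|a|\<close> times the
        norm of the forward power at \<open>b\<close>. After squaring and inserting the forward
        bound, one factor \<open>|b|^2\<close> cancels.\<close>
      have "(norm ?b)\<^sup>2 = a \<bullet> ((step h ^^ n) ?b)"
        by (simp add: power2_norm_eq_inner step_pow_adjoint)
      also have "\<dots> \<le> norm a * norm ((step h ^^ n) ?b)" by (rule norm_cauchy_schwarz)
      finally have "((norm ?b)\<^sup>2)\<^sup>2 \<le> (norm a * norm ((step h ^^ n) ?b))\<^sup>2" by (intro power_mono) auto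
      also have "\<dots> \<le> (norm a)\<^sup>2 * (?c * (norm ?b)\<^sup>2)"
        unfolding power_mult_distrib by (intro mult_left_mono S) auto
      finally have "(norm ?b)\<^sup>2 * (norm ?b)\<^sup>2 \<le> (?c * (norm a)\<^sup>2) * (norm ?b)\<^sup>2"
        by (simp add: power2_eq_square mult_ac)
      moreover have "(norm ?b)\<^sup>2 > 0" using False by simp
      ultimately show ?thesis by (rule mult_right_le_imp_le)
    qed
    with gh show ?thesis by blast
  qed
  ultimately show ?thesis by blast
qed

text \<open>Used with \<open>Y = 0\<close> for uniqueness, and with \<open>Y = -I\<close> for the
  decrease of the form of \<open>V\<close>.\<close>

lemma stepT_form:
  assumes X: "J ** X + X ** transpose J = Y"
  shows "stepT h a \<bullet> (X *v stepT h b) = a \<bullet> (X *v b) + h * (a \<bullet> (Y *v b)) + h\<^sup>2 * ((a v* J) \<bullet> (X *v (b v* J)))"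
proof -
  have "a \<bullet> (Y *v b) = (a v* J) \<bullet> (X *v b) + a \<bullet> (X *v (b v* J))"
    by (simp add: X[symmetric] matrix_vector_mult_add_rdistrib inner_add_right
      matrix_vector_mul_assoc[symmetric] dot_lmul_matrix)
  then show ?thesis
    by (simp add: stepT_def inner_add_left inner_add_right matrix_vector_right_distrib
      matrix_vector_mult_scaleR power2_eq_square algebra_simps)
qed

text \<open>With \<open>T = I + h J\<close>, the equation reads \<open>X = T X T\<^sup>T - h\<^sup>2 J X J\<^sup>T\<close>. Iterating it along the decaying
  powers of \<open>T\<close> bounds \<open>X\<close> by \<open>O(h)\<close> times any bound for \<open>X\<close>, with a constant independent of \<open>h\<close>.\<close>

lemma lyapunov_homogeneous_unique:
  assumes X: "J ** X + X ** transpose J = 0"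
  shows "X = 0"
proof -
  obtain h1 where h1: "h1 > 0" and d: "\<And>h a n. 0 < h \<Longrightarrow> h \<le> h1 \<Longrightarrow> \<gamma> * h < 1 \<and>
     (norm ((stepT h ^^ n) a))\<^sup>2 \<le> u / l * (1 - \<gamma> * h) ^ n * (norm a)\<^sup>2"
    using stepT_pow_decay by blast
  \<comment> \<open>Since \<open>1 - q = \<gamma> h\<close>, the geometric series of correction
    terms sums to at most \<open>h c\<close> times the current bound; \<open>h\<close> is then
    chosen with \<open>h c \<le> 1 / 2\<close>.\<close>
  define c where "c = L\<^sub>J\<^sup>2 * (u / l) / \<gamma>"
  have c: "c > 0" using LJ_pos pos by (simp add: c_def)
  define h where "h = min h1 (1 / (2 * c))"
  have h: "h > 0" "h \<le> h1" and hc: "h * c \<le> 1 / 2"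
    using h1 c by (auto simp: h_def min_def field_simps)
  define q where "q = 1 - \<gamma> * h"
  have q: "0 < q" "q < 1" using d[OF h, of 0 0] h pos by (auto simp: q_def)
  let ?p = "\<lambda>n a. (stepT h ^^ n) a"
  have nb: "norm (?p n a) * norm (?p n b) \<le> u / l * q ^ n * (norm a * norm b)" for n a b
  proof -
    have "(norm (?p n a) * norm (?p n b))\<^sup>2 \<le> (u / l * q ^ n * (norm a)\<^sup>2) * (u / l * q ^ n * (norm b)\<^sup>2)"
      unfolding power_mult_distrib q_def using pos q
      by (intro mult_mono conjunct2[OF d[OF h]]) (auto simp: q_def)
    also have "\<dots> = (u / l * q ^ n * (norm a * norm b))\<^sup>2" by (simp add: power2_eq_square)
    finally show ?thesis
      by (rule power2_le_imp_le)
        (intro mult_nonneg_nonneg divide_nonneg_nonneg zero_le_power norm_ge_zero less_imp_le pos q(1))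
  qed
  \<comment> \<open>Self-improvement: any bound \<open>m\<close> on the bilinear form of
    \<open>X\<close> can be halved. Started from an operator-norm bound and repeated, this forces
    \<open>X = 0\<close>.\<close>
  have half: "\<bar>a \<bullet> (X *v b)\<bar> \<le> m / 2 * (norm a * norm b)"
    if m: "\<And>a b. \<bar>a \<bullet> (X *v b)\<bar> \<le> m * (norm a * norm b)" for m a b
  proof -
    have m0: "m \<ge> 0"
    proof -
      obtain a :: "real^'d" where "norm a = 1" using vector_choose_size zero_le_one by blast
      then show ?thesis using m[of a a] by simp
    qed
    have it: "\<bar>a \<bullet> (X *v b)\<bar> \<le> m * norm (?p n a) * norm (?p n b)
        + (\<Sum>i<n. h\<^sup>2 * (m * L\<^sub>J\<^sup>2) * (norm (?p i a) * norm (?p i b)))" for n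
    proof (induction n)
      case 0
      then show ?case using m[of a b] by simp
    next
      case (Suc n)
      have "\<bar>a \<bullet> (X *v b)\<bar> \<le> \<bar>?p n a \<bullet> (X *v ?p n b)\<bar>
          + (\<Sum>i<n. h\<^sup>2 * (m * L\<^sub>J\<^sup>2) * (norm (?p i a) * norm (?p i b)))" for n
      proof (induction n)
        case (Suc n)
        let ?a = "?p n a" and ?b = "?p n b"
        have "?a \<bullet> (X *v ?b) = stepT h ?a \<bullet> (X *v stepT h ?b) - h\<^sup>2 * ((?a v* J) \<bullet> (X *v (?b v* J)))"
          using stepT_form[OF X, of h ?a ?b] by simp
        moreover have "\<bar>h\<^sup>2 * ((?a v* J) \<bullet> (X *v (?b v* J)))\<bar> \<le> h\<^sup>2 * (m * ((L\<^sub>J * norm ?a) * (L\<^sub>J * norm ?b)))"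
          unfolding abs_mult
          using m0 by (intro mult_mono order_trans[OF m] mult_left_mono norm_JT) (auto simp: LJ_pos less_imp_le)
        ultimately have "\<bar>?a \<bullet> (X *v ?b)\<bar> \<le> \<bar>stepT h ?a \<bullet> (X *v stepT h ?b)\<bar>
            + h\<^sup>2 * (m * L\<^sub>J\<^sup>2) * (norm ?a * norm ?b)"
          by (simp add: power2_eq_square mult_ac)
        with Suc show ?case by simp
      qed simp
      from this[of "Suc n"] m[of "?p (Suc n) a" "?p (Suc n) b"] show ?case by (simp add: mult.assoc)
    qed
    have "\<bar>a \<bullet> (X *v b)\<bar> \<le> m * (u / l) * (norm a * norm b) * q ^ n + m / 2 * (norm a * norm b)" for n
    proof -
      have "(\<Sum>i<n. h\<^sup>2 * (m * L\<^sub>J\<^sup>2) * (norm (?p i a) * norm (?p i b)))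
          \<le> (\<Sum>i<n. h\<^sup>2 * (m * L\<^sub>J\<^sup>2) * (u / l * q ^ i * (norm a * norm b)))"
        using m0 by (intro sum_mono mult_left_mono nb) auto
      also have "\<dots> = h\<^sup>2 * (m * L\<^sub>J\<^sup>2) * (u / l) * (norm a * norm b) * (\<Sum>i<n. q ^ i)"
        unfolding sum_distrib_left by (intro sum.cong refl) (simp add: mult_ac)
      also have "\<dots> \<le> h\<^sup>2 * (m * L\<^sub>J\<^sup>2) * (u / l) * (norm a * norm b) * (1 / (1 - q))"
        using q m0 pos by (intro mult_left_mono) (auto simp: sum_gp_strict divide_simps)
      also have "\<dots> = (h * c) * (m * (norm a * norm b))"
        using h pos by (simp add: q_def c_def power2_eq_square)
      also have "\<dots> \<le> 1 / 2 * (m * (norm a * norm b))" using hc m0 by (intro mult_right_mono) auto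
      finally have "(\<Sum>i<n. h\<^sup>2 * (m * L\<^sub>J\<^sup>2) * (norm (?p i a) * norm (?p i b))) \<le> m / 2 * (norm a * norm b)"
        by simp
      moreover have "m * norm (?p n a) * norm (?p n b) \<le> m * (u / l * q ^ n * (norm a * norm b))"
        unfolding mult.assoc using nb[of n a b] m0 by (intro mult_left_mono) (auto simp: mult.assoc)
      ultimately show ?thesis using it[of n] by (simp add: mult_ac)
    qed
    moreover have "(\<lambda>n. m * (u / l) * (norm a * norm b) * q ^ n + m / 2 * (norm a * norm b))
        \<longlonglongrightarrow> m * (u / l) * (norm a * norm b) * 0 + m / 2 * (norm a * norm b)"
      using q by (intro tendsto_intros LIMSEQ_realpow_zero) auto
    ultimately show ?thesis
      by (intro LIMSEQ_le_const[of _ "m / 2 * (norm a * norm b)"]) auto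
  qed
  obtain m where m: "\<And>a b. \<bar>a \<bullet> (X *v b)\<bar> \<le> m * (norm a * norm b)"
  proof -
    have "bounded_linear ((*v) X)" by (rule matrix_vector_mul_bounded_linear)
    from bounded_linear.bounded[OF this] obtain K where K: "\<And>x. norm (X *v x) \<le> norm x * K" by blast
    have "\<bar>a \<bullet> (X *v b)\<bar> \<le> K * (norm a * norm b)" for a b
      using cauchy_schwarz_mult[OF order_refl K, of a b] by (simp add: mult_ac)
    then show thesis by (rule that)
  qed
  have it: "\<bar>a \<bullet> (X *v b)\<bar> \<le> m * (norm a * norm b) * (1 / 2) ^ n" for n a b
  proof -
    have "\<forall>a b. \<bar>a \<bullet> (X *v b)\<bar> \<le> (m / 2 ^ n) * (norm a * norm b)"
    proof (induction n)
      case (Suc n)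
      then show ?case using half[of "m / 2 ^ n"] by (simp add: mult.commute)
    qed (use m in simp)
    then show ?thesis by (simp add: power_one_over field_simps)
  qed
  have "a \<bullet> (X *v b) = 0" for a b
  proof -
    have "(\<lambda>n. m * (norm a * norm b) * (1 / 2) ^ n) \<longlonglongrightarrow> m * (norm a * norm b) * 0"
      by (intro tendsto_intros LIMSEQ_realpow_zero) auto
    then have "\<bar>a \<bullet> (X *v b)\<bar> \<le> 0" using it by (intro LIMSEQ_le_const[of _ 0]) auto
    then show ?thesis by simp
  qed
  then show ?thesis by (intro matrix_eq_inner) simp
qed

end

section \<open>The quadratic form of the Lyapunov solution\<close>

locale stable_step = stable_operator F R xstar \<Phi> norm_s grad \<gamma> L\<^sub>s l u r C\<^sub>r \<delta> L\<^sub>F J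
  for F R :: "real ^ 'd \<Rightarrow> real ^ 'd" and xstar \<Phi> norm_s grad \<gamma> L\<^sub>s l u r C\<^sub>r \<delta> L\<^sub>F J +
  fixes \<alpha> :: real and V :: "real ^ 'd ^ 'd"
  assumes alpha_pos: "\<alpha> > 0"
    and V: "J ** V + V ** transpose J + mat 1 = 0"
    and iota: "1 / (4 * lambda_max V) * \<alpha> > 2"
begin

lemma V_eq: "J ** V + V ** transpose J = - mat 1"
  using V by (simp add: eq_neg_iff_add_eq_0)

text \<open>The transpose solves the same equation, so the difference solves the homogeneous one.
  Symmetry is what gives \<open>lambda_max V\<close> its Rayleigh bound.\<close>

lemma V_sym: "transpose V = V"
proof -
  have t1: "transpose (A + B) = transpose A + transpose B" for A B :: "real^'d^'d"
    by (simp add: transpose_def vec_eq_iff)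
  have t2: "transpose (- A) = - transpose A" for A :: "real^'d^'d"
    by (simp add: transpose_def vec_eq_iff)
  have "transpose (J ** V + V ** transpose J) = - mat 1"
    unfolding V_eq t2 by simp
  then have V': "J ** transpose V + transpose V ** transpose J = - mat 1"
    by (simp add: t1 matrix_transpose_mul add.commute)
  have "J ** (V - transpose V) + (V - transpose V) ** transpose J
      = (J ** V + V ** transpose J) - (J ** transpose V + transpose V ** transpose J)"
    by (rule matrix_eq_inner) (simp add: matrix_vector_mult_add_rdistrib matrix_vector_mult_diff_rdistrib
      matrix_vector_mul_assoc[symmetric] matrix_vector_mult_diff_distrib inner_diff_right inner_add_right)
  also have "\<dots> = 0" using V_eq V' by simp
  finally have "V - transpose V = 0" by (rule lyapunov_homogeneous_unique)
  then show ?thesis by simp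
qed

definition q where "q a = a \<bullet> (V *v a)"

lemma lambda_pos: "lambda_max V > 0" and lambda_less: "8 * lambda_max V < \<alpha>"
proof -
  show p: "lambda_max V > 0"
  proof (rule ccontr)
    assume "\<not> lambda_max V > 0"
    then have "1 / (4 * lambda_max V) \<le> 0" by (simp add: divide_le_0_iff)
    from mult_nonpos_nonneg[OF this less_imp_le[OF alpha_pos]] iota show False by linarith
  qed
  show "8 * lambda_max V < \<alpha>" using iota p by (simp add: field_simps)
qed

lemma q_upper: "q a \<le> lambda_max V * (norm a)\<^sup>2"
  unfolding q_def by (rule lambda_max_rayleigh[OF V_sym])

lemma q_stepT: "q (stepT h a) = q a - h * (norm a)\<^sup>2 + h\<^sup>2 * q (a v* J)"
  unfolding q_def stepT_form[OF V_eq] by (simp add: power2_norm_eq_inner uminus_matrix_vector)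

text \<open>Each adjoint step lowers \<open>q\<close> by at least \<open>h / 2\<close> times the
  squared norm, and \<open>q\<close> tends to 0 along the powers; hence already the first drop
  bounds \<open>q a\<close> from below.\<close>

lemma q_lower_ex: "\<exists>c>0. \<forall>a. c * (norm a)\<^sup>2 \<le> q a"
proof -
  obtain h1 where h1: "h1 > 0" and d: "\<And>h a n. 0 < h \<Longrightarrow> h \<le> h1 \<Longrightarrow> \<gamma> * h < 1 \<and>
     (norm ((stepT h ^^ n) a))\<^sup>2 \<le> u / l * (1 - \<gamma> * h) ^ n * (norm a)\<^sup>2"
    using stepT_pow_decay by blast
  obtain K where K: "K > 0" "\<And>a. \<bar>q a\<bar> \<le> K * (norm a)\<^sup>2"
  proof -
    have "bounded_linear ((*v) V)" by (rule matrix_vector_mul_bounded_linear)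
    from bounded_linear.pos_bounded[OF this] obtain K where K: "K > 0" "\<And>x. norm (V *v x) \<le> norm x * K" by blast
    have "\<bar>q a\<bar> \<le> K * (norm a)\<^sup>2" for a
      unfolding q_def using cauchy_schwarz_mult[OF order_refl K(2), of a a] by (simp add: mult_ac power2_eq_square)
    with K show thesis using that by blast
  qed
  \<comment> \<open>The second argument lets the \<open>h^2\<close> term of \<open>q_stepT\<close>
    consume at most half of the drop \<open>h |a|^2\<close>; \<open>h1\<close> ensures the decay of
    the powers.\<close>
  define h where "h = min h1 (1 / (2 * K * L\<^sub>J\<^sup>2))"
  have h: "h > 0" "h \<le> h1" using h1 K LJ_pos by (auto simp: h_def)
  have "h \<le> 1 / (2 * K * L\<^sub>J\<^sup>2)" by (simp add: h_def)
  then have hK: "h * (K * L\<^sub>J\<^sup>2) \<le> 1 / 2" using K LJ_pos by (simp add: field_simps)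
  have st: "h / 2 * (norm a)\<^sup>2 + q (stepT h a) \<le> q a" for a
  proof -
    have "h\<^sup>2 * q (a v* J) \<le> h\<^sup>2 * (K * (L\<^sub>J * norm a)\<^sup>2)"
    proof (intro mult_left_mono)
      have "q (a v* J) \<le> K * (norm (a v* J))\<^sup>2" using K(2)[of "a v* J"] by linarith
      also have "\<dots> \<le> K * (L\<^sub>J * norm a)\<^sup>2" using K norm_JT by (intro mult_left_mono power_mono) auto
      finally show "q (a v* J) \<le> K * (L\<^sub>J * norm a)\<^sup>2" .
    qed simp
    also have "\<dots> = h * (K * L\<^sub>J\<^sup>2) * (h * (norm a)\<^sup>2)" by (simp add: power2_eq_square)
    also have "\<dots> \<le> 1 / 2 * (h * (norm a)\<^sup>2)" using hK h by (intro mult_right_mono) auto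
    finally show ?thesis unfolding q_stepT by simp
  qed
  have ge: "h / 2 * (norm a)\<^sup>2 + q ((stepT h ^^ Suc n) a) \<le> q a" for a n
  proof (induction n)
    case 0
    then show ?case using st by simp
  next
    case (Suc n)
    have "0 \<le> h / 2 * (norm ((stepT h ^^ Suc n) a))\<^sup>2" using h by simp
    then show ?case using Suc st[of "(stepT h ^^ Suc n) a"] by simp
  qed
  have "h / 2 * (norm a)\<^sup>2 \<le> q a" for a
  proof -
    have "h / 2 * (norm a)\<^sup>2 - K * (u / l) * (norm a)\<^sup>2 * (1 - \<gamma> * h) ^ Suc n \<le> q a" for n
    proof -
      have "- q ((stepT h ^^ Suc n) a) \<le> K * (norm ((stepT h ^^ Suc n) a))\<^sup>2"
        using K(2)[of "(stepT h ^^ Suc n) a"] by linarith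
      also have "\<dots> \<le> K * (u / l * (1 - \<gamma> * h) ^ Suc n * (norm a)\<^sup>2)"
        using K by (intro mult_left_mono conjunct2[OF d[OF h]]) auto
      finally show ?thesis using ge[of a n] by (simp add: mult_ac)
    qed
    moreover have "(\<lambda>n. h / 2 * (norm a)\<^sup>2 - K * (u / l) * (norm a)\<^sup>2 * (1 - \<gamma> * h) ^ Suc n)
        \<longlonglongrightarrow> h / 2 * (norm a)\<^sup>2 - K * (u / l) * (norm a)\<^sup>2 * 0"
      using d[OF h, of 0 0] h pos
      by (intro tendsto_intros LIMSEQ_realpow_zero[THEN LIMSEQ_Suc]) auto
    ultimately show ?thesis by (intro LIMSEQ_le_const2[of _ "h / 2 * (norm a)\<^sup>2"]) auto
  qed
  with h show ?thesis by (intro exI[of _ "h / 2"]) auto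
qed

definition c\<^sub>q where "c\<^sub>q = (SOME c. c > 0 \<and> (\<forall>a. c * (norm a)\<^sup>2 \<le> q a))"

lemma cq_pos: "c\<^sub>q > 0" and q_lower: "c\<^sub>q * (norm a)\<^sup>2 \<le> q a"
proof -
  have "c\<^sub>q > 0 \<and> (\<forall>a. c\<^sub>q * (norm a)\<^sup>2 \<le> q a)"
    unfolding c\<^sub>q_def by (rule someI_ex) (use q_lower_ex in blast)
  then show "c\<^sub>q > 0" "c\<^sub>q * (norm a)\<^sup>2 \<le> q a" by auto
qed

lemma q_nonneg: "0 \<le> q a"
  using q_lower[of a] cq_pos by (meson order_trans zero_le_mult_iff zero_le_power2 less_imp_le)

lemma norm_le_q: "(norm a)\<^sup>2 \<le> q a / c\<^sub>q"
  using q_lower[of a] cq_pos by (simp add: field_simps)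

lemma q_scaleR: "q (c *\<^sub>R a) = c\<^sup>2 * q a"
  by (simp add: q_def matrix_vector_mult_scaleR power2_eq_square)

text \<open>With \<Lambda> the largest eigenvalue, the smallness of \<open>h\<close> bounds the
  second-order term by \<open>h (\<Lambda> / \<alpha>) |a|^2\<close>. Because
  \<open>8 \<Lambda> < \<alpha>\<close>, the remaining drop is at least
  \<open>7 h (\<Lambda> / \<alpha>) |a|^2\<close>, hence at least
  \<open>(7 h / \<alpha>) q a\<close>. With step \<open>\<alpha> / n\<close> this is the rate
  \<open>7 / n\<close>.\<close>

lemma q_contract:
  assumes h: "0 < h" "h \<le> 1 / (\<alpha> * L\<^sub>J\<^sup>2)"
  shows "q (stepT h a) \<le> (1 - 7 * h / \<alpha>) * q a"
proof -
  define \<Lambda> where "\<Lambda> = lambda_max V"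
  have Lp: "\<Lambda> > 0" and La: "8 * \<Lambda> < \<alpha>" using lambda_pos lambda_less by (auto simp: \<Lambda>_def)
  have "q (a v* J) \<le> \<Lambda> * (norm (a v* J))\<^sup>2" unfolding \<Lambda>_def by (rule q_upper)
  also have "\<dots> \<le> \<Lambda> * (L\<^sub>J * norm a)\<^sup>2" using Lp norm_JT by (intro mult_left_mono power_mono) auto
  finally have "h\<^sup>2 * q (a v* J) \<le> h\<^sup>2 * (\<Lambda> * (L\<^sub>J * norm a)\<^sup>2)" by (intro mult_left_mono) auto
  also have "\<dots> = (h * (\<alpha> * L\<^sub>J\<^sup>2)) * (h * \<Lambda> / \<alpha> * (norm a)\<^sup>2)"
    using alpha_pos by (simp add: power2_eq_square)
  also have "\<dots> \<le> 1 * (h * \<Lambda> / \<alpha> * (norm a)\<^sup>2)"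
    using h alpha_pos LJ_pos Lp by (intro mult_right_mono) (auto simp: field_simps)
  finally have "q (stepT h a) \<le> q a - h * (1 - \<Lambda> / \<alpha>) * (norm a)\<^sup>2"
    unfolding q_stepT by (simp add: algebra_simps)
  also have "\<dots> \<le> q a - h * (7 * \<Lambda> / \<alpha>) * (norm a)\<^sup>2"
    using La alpha_pos h by (intro diff_left_mono mult_right_mono mult_left_mono) (auto simp: field_simps)
  also have "\<dots> = q a - h * 7 / \<alpha> * (\<Lambda> * (norm a)\<^sup>2)" by simp
  also have "\<dots> \<le> q a - h * 7 / \<alpha> * q a"
    using h alpha_pos q_upper[of a] by (intro diff_left_mono mult_left_mono) (auto simp: \<Lambda>_def)
  finally show ?thesis by (simp add: algebra_simps)
qed

end

section \<open>Stein's method on the real line\<close>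

lemma std_normal_density_deriv:
  "(std_normal_density has_real_derivative - x * std_normal_density x) (at x)"
  unfolding std_normal_density_def
  by (auto intro!: derivative_eq_intros simp: field_simps)

definition gauss_tail :: "real \<Rightarrow> real" where
  "gauss_tail x = (LINT t:{x..}|lborel. std_normal_density t)"

lemma set_integrable_std_normal_density: "S \<in> sets borel \<Longrightarrow> set_integrable lborel S std_normal_density"
  unfolding set_integrable_def by (intro integrable_mult_indicator) auto

lemma gauss_tail_nonneg: "0 \<le> gauss_tail x"
  unfolding gauss_tail_def set_lebesgue_integral_def by (intro Bochner_Integration.integral_nonneg) auto

lemma gauss_tail_le_1: "gauss_tail x \<le> 1"
proof -
  have "gauss_tail x \<le> (\<integral>t. std_normal_density t \<partial>lborel)"
    unfolding gauss_tail_def set_lebesgue_integral_def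
    using set_integrable_std_normal_density[of "{x..}"]
    by (intro integral_mono) (auto simp: set_integrable_def indicator_def)
  then show ?thesis by simp
qed

text \<open>On \<open>t \<ge> x\<close> the density is at most \<open>t / x\<close> times itself,
  and that product has an explicit primitive.\<close>

lemma mills_ratio:
  assumes x: "x > 0"
  shows "gauss_tail x \<le> std_normal_density x / x"
proof -
  let ?f = "\<lambda>t. t / x * std_normal_density t"
  let ?F = "\<lambda>t. - std_normal_density t / x"
  have lim: "(?F \<longlongrightarrow> - 0 / x) at_top"
  proof (intro tendsto_divide tendsto_minus tendsto_const)
    have "filterlim (\<lambda>t::real. 1 / 2 * t ^ 2) at_top at_top"
      by (intro filterlim_tendsto_pos_mult_at_top[OF tendsto_const] filterlim_pow_at_top filterlim_ident) auto
    then have "filterlim (\<lambda>t::real. - (1 / 2 * t ^ 2)) at_bot at_top"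
      by (rule filterlim_uminus_at_top[THEN iffD1])
    then have "((\<lambda>t::real. exp (- (1 / 2 * t ^ 2))) \<longlongrightarrow> 0) at_top"
      by (rule filterlim_compose[OF exp_at_bot])
    then have "((\<lambda>t::real. 1 / sqrt (2 * pi) * exp (- (1 / 2 * t ^ 2))) \<longlongrightarrow> 1 / sqrt (2 * pi) * 0) at_top"
      by (intro tendsto_intros)
    then show "(std_normal_density \<longlongrightarrow> 0) at_top"
      by (simp add: std_normal_density_def[abs_def])
  qed (use x in auto)
  have nn: "(\<integral>\<^sup>+t. ennreal (?f t) * indicator {x..} t \<partial>lborel) = ennreal (- 0 / x - ?F x)"
  proof (rule nn_integral_FTC_atLeast[OF _ _ _ lim])
    show "\<And>t. x \<le> t \<Longrightarrow> (?F has_real_derivative ?f t) (at t)"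
      using x by (auto intro!: derivative_eq_intros std_normal_density_deriv simp: field_simps)
  qed (use x in auto)
  have "ennreal (gauss_tail x) = (\<integral>\<^sup>+t. ennreal (std_normal_density t) * indicator {x..} t \<partial>lborel)"
    unfolding gauss_tail_def set_lebesgue_integral_def
    using set_integrable_std_normal_density[of "{x..}"]
    by (subst nn_integral_eq_integral[symmetric])
      (auto simp: set_integrable_def intro!: nn_integral_cong split: split_indicator)
  also have "\<dots> \<le> (\<integral>\<^sup>+t. ennreal (?f t) * indicator {x..} t \<partial>lborel)"
  proof (intro nn_integral_mono)
    fix t
    have "std_normal_density t \<le> ?f t" if "t \<ge> x"
      using that x mult_right_mono[of 1 "t / x" "std_normal_density t"] by simp
    then show "ennreal (std_normal_density t) * indicator {x..} t \<le> ennreal (?f t) * indicator {x..} t"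
      by (auto split: split_indicator intro: ennreal_leI)
  qed
  finally have "ennreal (gauss_tail x) \<le> ennreal (- 0 / x - ?F x)" unfolding nn .
  then show ?thesis using x by (subst (asm) ennreal_le_iff) auto
qed

lemma std_normal_density_lower:
  assumes "\<bar>x\<bar> \<le> 1"
  shows "1 / 6 \<le> std_normal_density x"
proof -
  have "sqrt (2 * pi) \<le> sqrt (3\<^sup>2)" using pi_less_4 by (intro real_sqrt_le_mono) auto
  then have s: "sqrt (2 * pi) \<le> 3" by simp
  have "exp (1 :: real) \<le> 2\<^sup>2" using exp_le by simp
  then have "(exp (1 / 2 :: real))\<^sup>2 \<le> 2\<^sup>2" by (simp add: exp_double[symmetric])
  then have e: "exp (1 / 2 :: real) \<le> 2" by (rule power2_le_imp_le) simp
  have "x\<^sup>2 \<le> 1" using assms by (simp add: abs_square_le_1)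
  then have "exp (x\<^sup>2 / 2) \<le> exp (1 / 2)" by simp
  with e have e': "exp (x\<^sup>2 / 2) \<le> 2" by linarith
  have "sqrt (2 * pi) * exp (x\<^sup>2 / 2) \<le> 3 * 2" using s e' by (intro mult_mono) auto
  then show ?thesis by (simp add: std_normal_density_def exp_minus field_simps)
qed

text \<open>The constant 6 comes from the unit interval, where the density is at least
  \<open>1 / 6\<close> and the tail at most 1; beyond 1 the Mills bound is stronger.\<close>

lemma gauss_tail_bounds:
  shows "x \<ge> 0 \<Longrightarrow> gauss_tail x \<le> 6 * std_normal_density x"
    and "x \<ge> 0 \<Longrightarrow> x * gauss_tail x \<le> std_normal_density x"
proof -
  have 2: "x * gauss_tail x \<le> std_normal_density x" if "x \<ge> 0" for x
    using mills_ratio[of x] that by (cases "x = 0") (auto simp: field_simps)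
  have 1: "gauss_tail x \<le> 6 * std_normal_density x" if "x \<ge> 0" for x
  proof (cases "x \<le> 1")
    case True
    then show ?thesis using std_normal_density_lower[of x] gauss_tail_le_1[of x] that by simp
  next
    case False
    then have "gauss_tail x \<le> x * gauss_tail x" using gauss_tail_nonneg[of x] by (simp add: mult_le_cancel_right1)
    then show ?thesis using 2[OF that] by (smt (verit) normal_density_nonneg)
  qed
  show "x \<ge> 0 \<Longrightarrow> gauss_tail x \<le> 6 * std_normal_density x"
    "x \<ge> 0 \<Longrightarrow> x * gauss_tail x \<le> std_normal_density x" using 1 2 by auto
qed

lemma gauss_tail_reflect: "(LINT t:{..x}|lborel. std_normal_density t) = gauss_tail (- x)"
proof -
  have "(LINT t:{..x}|lborel. std_normal_density t)
      = \<bar>-1\<bar> *\<^sub>R (\<integral>t. indicator {..x} (0 + (-1) * t) *\<^sub>R std_normal_density (0 + (-1) * t) \<partial>lborel)"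
    unfolding set_lebesgue_integral_def by (rule lborel_integral_real_affine) simp
  also have "\<dots> = gauss_tail (- x)"
    unfolding gauss_tail_def set_lebesgue_integral_def
    by (auto intro!: Bochner_Integration.integral_cong simp: std_normal_density_def split: split_indicator)
  finally show ?thesis .
qed

text \<open>The weak bounds on \<open>f\<close> suffice here, because only test functions
  with values in the unit interval occur.\<close>

lemma stein_solution:
  fixes h :: "real \<Rightarrow> real"
  assumes cont: "\<And>x. isCont h x" and h01: "\<And>x. 0 \<le> h x" "\<And>x. h x \<le> 1"
  defines "m \<equiv> (\<integral>t. std_normal_density t * h t \<partial>lborel)"
  shows "\<exists>f. (\<forall>x. (f has_real_derivative (x * f x + h x - m)) (at x)) \<and>
     (\<forall>x. \<bar>f x\<bar> \<le> 6) \<and> (\<forall>x. \<bar>x * f x\<bar> \<le> 1) \<and> (\<forall>x. \<bar>x * f x + h x - m\<bar> \<le> 2)"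
proof -
  have [measurable]: "h \<in> borel_measurable borel"
    using cont by (intro borel_measurable_continuous_onI continuous_at_imp_continuous_on) auto
  define g where "g t = std_normal_density t * h t - m * std_normal_density t" for t
  have ih: "integrable lborel (\<lambda>t. std_normal_density t * h t)"
    using h01 by (intro Bochner_Integration.integrable_bound[OF integrable_normal_density[of 1 0]])
      (auto simp: abs_mult mult_left_le)
  have m0: "0 \<le> m" unfolding m_def using h01 by (intro Bochner_Integration.integral_nonneg) auto
  have "m \<le> (\<integral>t. std_normal_density t \<partial>lborel)"
    unfolding m_def using h01 by (intro integral_mono ih) (auto simp: mult_left_le)
  then have m1: "m \<le> 1" by simp
  have hm: "\<bar>h t - m\<bar> \<le> 1" for t using h01(1)[of t] h01(2)[of t] m0 m1 by linarith
  have gi: "integrable lborel g" unfolding g_def using ih by auto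
  have gs: "set_integrable lborel S g" if "S \<in> sets borel" for S
    unfolding set_integrable_def using that gi by (intro integrable_mult_indicator) auto
  have g0: "(\<integral>t. g t \<partial>lborel) = 0" unfolding g_def using ih by (simp add: m_def)
  have gb: "\<bar>g t\<bar> \<le> std_normal_density t" for t
  proof -
    have "g t = (h t - m) * std_normal_density t" by (simp add: g_def algebra_simps)
    then show ?thesis using hm[of t] by (simp add: abs_mult mult_left_le_one_le)
  qed
  have gcont: "isCont g x" for x
    unfolding g_def std_normal_density_def using cont by (intro continuous_intros) auto
  \<comment> \<open>The solution is \<open>H\<close> divided by the density. As \<open>g\<close>
    integrates to 0, \<open>H x\<close> is also minus the integral over the upper half line, so the
    tail on the side away from 0 controls it for either sign of \<open>x\<close>.\<close>
  define H where "H x = (LINT t:{..x}|lborel. g t)" for x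
  have H': "(H has_real_derivative g x) (at x)" for x
  proof -
    \<comment> \<open>Splitting off the half line below \<open>x - 1\<close> reduces the derivative
      of an improper integral to the fundamental theorem on a compact interval.\<close>
    have eq: "H y = H (x - 1) + integral {x - 1..y} g" if "y \<in> {x - 1..x + 1}" for y
    proof -
      have "{..y} = {..x - 1} \<union> {x - 1<..y}" using that by auto
      then have "H y = H (x - 1) + (LINT t:{x - 1<..y}|lborel. g t)"
        unfolding H_def by (simp only:) (rule set_integral_Un; (rule gs)?; auto)
      also have sd: "(LINT t:{x - 1<..y}|lborel. g t) = (LINT t:{x - 1..y}|lborel. g t)"
      proof (rule set_integral_null_delta)
        have "sym_diff {x - 1<..y} {x - 1..y} = {x - 1}" using that by auto
        then show "sym_diff {x - 1<..y} {x - 1..y} \<in> null_sets lborel" by (simp add: null_sets_def)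
      qed (use gi in auto)
      also have "\<dots> = integral {x - 1..y} g" using gs by (intro set_borel_integral_eq_integral) auto
      finally show ?thesis .
    qed
    have "((\<lambda>y. H (x - 1) + integral {x - 1..y} g) has_real_derivative 0 + g x) (at x within {x - 1..x + 1})"
      using gcont by (intro DERIV_add DERIV_const integral_has_real_derivative continuous_at_imp_continuous_on) auto
    then have "((\<lambda>y. H (x - 1) + integral {x - 1..y} g) has_real_derivative g x) (at x within {x - 1..x + 1})"
      by simp
    then have "(H has_real_derivative g x) (at x within {x - 1..x + 1})"
      by (rule has_field_derivative_transform_within[where d = 1]) (auto intro: eq[symmetric])
    then show ?thesis by (simp add: at_within_Icc_at)
  qed
  have Hpos: "\<bar>H x\<bar> \<le> gauss_tail x" for x
  proof -
    have "H x + (LINT t:{x<..}|lborel. g t) = (LINT t:{..x} \<union> {x<..}|lborel. g t)"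
      unfolding H_def using gs by (subst set_integral_Un) auto
    also have "{..x} \<union> {x<..} = UNIV" by auto
    also have "(LINT t:UNIV|lborel. g t) = 0" by (simp add: set_lebesgue_integral_def g0)
    finally have "\<bar>H x\<bar> = \<bar>LINT t:{x<..}|lborel. g t\<bar>" by linarith
    also have "\<dots> \<le> (\<integral>t. norm (indicator {x<..} t *\<^sub>R g t) \<partial>lborel)"
      unfolding set_lebesgue_integral_def by (rule order_trans[OF _ integral_norm_bound]) simp
    also have "\<dots> \<le> gauss_tail x"
      unfolding gauss_tail_def set_lebesgue_integral_def
      using gs[of "{x<..}"] set_integrable_std_normal_density[of "{x..}"] gb
      by (intro integral_mono) (auto simp: set_integrable_def split: split_indicator)
    finally show ?thesis .
  qed
  have Hneg: "\<bar>H x\<bar> \<le> gauss_tail (- x)" for x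
  proof -
    have "\<bar>H x\<bar> \<le> (\<integral>t. norm (indicator {..x} t *\<^sub>R g t) \<partial>lborel)"
      unfolding H_def set_lebesgue_integral_def by (rule order_trans[OF _ integral_norm_bound]) simp
    also have "\<dots> \<le> (LINT t:{..x}|lborel. std_normal_density t)"
      unfolding set_lebesgue_integral_def
      using gs[of "{..x}"] set_integrable_std_normal_density[of "{..x}"] gb
      by (intro integral_mono) (auto simp: set_integrable_def split: split_indicator)
    finally show ?thesis by (simp add: gauss_tail_reflect)
  qed
  have even: "std_normal_density \<bar>x\<bar> = std_normal_density x" for x by (simp add: std_normal_density_def)
  have Habs: "\<bar>H x\<bar> \<le> gauss_tail \<bar>x\<bar>" for x using Hpos[of x] Hneg[of x] by (cases "x < 0") auto
  have dp: "std_normal_density x > 0" for x by (rule normal_density_pos) simp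
  define f where "f x = H x / std_normal_density x" for x
  have f6: "\<bar>f x\<bar> \<le> 6" for x
  proof -
    have "\<bar>H x\<bar> \<le> 6 * std_normal_density x"
      using Habs[of x] gauss_tail_bounds(1)[of "\<bar>x\<bar>"] unfolding even by linarith
    then show ?thesis using dp[of x] by (simp add: f_def divide_le_eq)
  qed
  have xf: "\<bar>x * f x\<bar> \<le> 1" for x
  proof -
    have "\<bar>x\<bar> * \<bar>H x\<bar> \<le> std_normal_density x"
      using mult_left_mono[OF Habs[of x], of "\<bar>x\<bar>"] gauss_tail_bounds(2)[of "\<bar>x\<bar>"] unfolding even
      by linarith
    then show ?thesis using dp[of x] by (simp add: f_def abs_mult divide_le_eq)
  qed
  have f': "(f has_real_derivative (x * f x + h x - m)) (at x)" for x
  proof -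
    have "(f has_real_derivative
        (g x * std_normal_density x - H x * (- x * std_normal_density x)) / (std_normal_density x * std_normal_density x)) (at x)"
      unfolding f_def[abs_def] by (rule DERIV_divide[OF H' std_normal_density_deriv]) (use dp[of x] in simp)
    moreover have "(g x * std_normal_density x - H x * (- x * std_normal_density x)) / (std_normal_density x * std_normal_density x)
        = x * f x + h x - m"
      using dp[of x] by (simp add: f_def g_def field_simps)
    ultimately show ?thesis by simp
  qed
  have "\<bar>x * f x + h x - m\<bar> \<le> 2" for x using xf[of x] hm[of x] by linarith
  with f' f6 xf show ?thesis by blast
qed

section \<open>Sums of independent variables and the leave-one-out comparison\<close>

lemma (in prob_space) indep_vars_second_moment_sum:
  fixes \<xi> :: "'i \<Rightarrow> 'a \<Rightarrow> real"
  assumes "finite I" "indep_vars (\<lambda>_. borel) \<xi> I"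
    and "\<And>i. i \<in> I \<Longrightarrow> integrable M (\<lambda>\<omega>. (\<xi> i \<omega>)\<^sup>2)" "\<And>i. i \<in> I \<Longrightarrow> integrable M (\<xi> i)"
    and "\<And>i. i \<in> I \<Longrightarrow> expectation (\<xi> i) = 0"
  shows "integrable M (\<lambda>\<omega>. (\<Sum>i\<in>I. \<xi> i \<omega>)\<^sup>2) \<and>
    expectation (\<lambda>\<omega>. (\<Sum>i\<in>I. \<xi> i \<omega>)\<^sup>2) = (\<Sum>i\<in>I. expectation (\<lambda>\<omega>. (\<xi> i \<omega>)\<^sup>2))"
  using assms
proof (induction I)
  case (insert i I)
  let ?S = "\<lambda>\<omega>. \<Sum>i\<in>I. \<xi> i \<omega>"
  have ii: "integrable M (\<xi> i)" "integrable M (\<lambda>\<omega>. (\<xi> i \<omega>)\<^sup>2)" "expectation (\<xi> i) = 0"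
    using insert.prems by auto
  have IH: "integrable M (\<lambda>\<omega>. (?S \<omega>)\<^sup>2)"
    "expectation (\<lambda>\<omega>. (?S \<omega>)\<^sup>2) = (\<Sum>i\<in>I. expectation (\<lambda>\<omega>. (\<xi> i \<omega>)\<^sup>2))"
    using insert.IH insert.prems indep_vars_subset[of _ \<xi> "insert i I" I] by auto
  have iS: "integrable M ?S" using insert.prems by auto
  have ind: "indep_var borel (\<xi> i) borel ?S"
    using insert.hyps insert.prems by (intro indep_vars_sum) auto
  have p: "integrable M (\<lambda>\<omega>. \<xi> i \<omega> * ?S \<omega>)" "expectation (\<lambda>\<omega>. \<xi> i \<omega> * ?S \<omega>) = 0"
    using indep_var_integrable[OF ind ii(1) iS] indep_var_lebesgue_integral[OF ind ii(1) iS] ii by auto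
  have eq: "(\<Sum>i\<in>insert i I. \<xi> i \<omega>)\<^sup>2 = (\<xi> i \<omega>)\<^sup>2 + 2 * (\<xi> i \<omega> * ?S \<omega>) + (?S \<omega>)\<^sup>2" for \<omega>
    using insert.hyps by (simp add: power2_eq_square algebra_simps)
  show ?case unfolding eq using IH ii p insert.hyps by simp
qed simp

text \<open>With \<open>s\<close> the root of the second moment, the claim is
  \<open>s^2 E|X| \<le> s^3 \<le> E|X|^3\<close>; both halves come from integrating pointwise
  inequalities.\<close>

lemma (in prob_space) expectation_square_abs_le_cube:
  fixes X :: "'a \<Rightarrow> real"
  assumes i3: "integrable M (\<lambda>\<omega>. \<bar>X \<omega>\<bar> ^ 3)" and i2: "integrable M (\<lambda>\<omega>. (X \<omega>)\<^sup>2)" and i1: "integrable M X"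
  shows "expectation (\<lambda>\<omega>. (X \<omega>)\<^sup>2) * expectation (\<lambda>\<omega>. \<bar>X \<omega>\<bar>) \<le> expectation (\<lambda>\<omega>. \<bar>X \<omega>\<bar> ^ 3)"
proof -
  let ?m = "expectation (\<lambda>\<omega>. (X \<omega>)\<^sup>2)"
  define s where "s = sqrt ?m"
  have m0: "?m \<ge> 0" by (intro Bochner_Integration.integral_nonneg) auto
  then have s: "s \<ge> 0" "s\<^sup>2 = ?m" by (auto simp: s_def)
  have "expectation (\<lambda>\<omega>. s * \<bar>X \<omega>\<bar>) \<le> expectation (\<lambda>\<omega>. (s\<^sup>2 + (X \<omega>)\<^sup>2) / 2)"
  proof (intro integral_mono)
    fix \<omega>
    show "s * \<bar>X \<omega>\<bar> \<le> (s\<^sup>2 + (X \<omega>)\<^sup>2) / 2"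
      using sum_squares_bound[of s "\<bar>X \<omega>\<bar>"] by simp
  qed (use i1 i2 in auto)
  also have "\<dots> = s * s" using i2 s by (simp add: prob_space power2_eq_square)
  finally have "s * expectation (\<lambda>\<omega>. \<bar>X \<omega>\<bar>) \<le> s * s" by simp
  then have "s * (s * expectation (\<lambda>\<omega>. \<bar>X \<omega>\<bar>)) \<le> s * (s * s)" by (rule mult_left_mono) (use s in auto)
  then have a: "?m * expectation (\<lambda>\<omega>. \<bar>X \<omega>\<bar>) \<le> s ^ 3"
    unfolding s(2)[symmetric] by (simp add: power2_eq_square power3_eq_cube)
  have "expectation (\<lambda>\<omega>. 3 / 2 * s * (X \<omega>)\<^sup>2 - s ^ 3 / 2) \<le> expectation (\<lambda>\<omega>. \<bar>X \<omega>\<bar> ^ 3)"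
  proof (intro integral_mono)
    fix \<omega>
    let ?x = "\<bar>X \<omega>\<bar>"
    \<comment> \<open>Expanded, this says that the cube lies above its tangent at \<open>s\<close>
      when both are viewed as functions of the square.\<close>
    have "0 \<le> (?x - s)\<^sup>2 * (?x + s / 2)" using s by simp
    also have "\<dots> = ?x ^ 3 - (3 / 2 * s * ?x\<^sup>2 - s ^ 3 / 2)"
      by (simp add: power2_eq_square power3_eq_cube algebra_simps)
    finally show "3 / 2 * s * (X \<omega>)\<^sup>2 - s ^ 3 / 2 \<le> ?x ^ 3" by simp
  qed (use i2 i3 in auto)
  moreover have "expectation (\<lambda>\<omega>. 3 / 2 * s * (X \<omega>)\<^sup>2 - s ^ 3 / 2) = s ^ 3"
    using i2 s by (simp add: prob_space power2_eq_square[of s] power3_eq_cube flip: s(2))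
  ultimately show ?thesis using a by simp
qed

text \<open>Stein's equation turns the error into \<open>E f'(X) - E X f(X)\<close>, and total
  variance 1 distributes \<open>E f'(X)\<close> over the summands. For each index, \<open>f\<close>
  is expanded around the sum \<open>Y i\<close> of the others, which is independent of
  \<open>\<xi> i\<close> and removes the zeroth-order term. Two errors remain, each at most
  \<open>8 + B\<close> times the third moment: the Taylor remainder, and the replacement of
  \<open>f' (Y i)\<close> by \<open>f' X\<close>, where
  \<open>expectation_square_abs_le_cube\<close> enters.\<close>

theorem (in prob_space) stein_bound:
  fixes \<xi> :: "'i \<Rightarrow> 'a \<Rightarrow> real" and h :: "real \<Rightarrow> real"
  assumes I: "finite I" and ind: "indep_vars (\<lambda>_. borel) \<xi> I"
    and i3: "\<And>i. i \<in> I \<Longrightarrow> integrable M (\<lambda>\<omega>. \<bar>\<xi> i \<omega>\<bar> ^ 3)"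
    and mean: "\<And>i. i \<in> I \<Longrightarrow> expectation (\<xi> i) = 0"
    and var: "(\<Sum>i\<in>I. expectation (\<lambda>\<omega>. (\<xi> i \<omega>)\<^sup>2)) = 1"
    and h01: "\<And>x. 0 \<le> h x" "\<And>x. h x \<le> 1"
    and lip: "\<And>x y. \<bar>h x - h y\<bar> \<le> B * \<bar>x - y\<bar>"
  shows "\<bar>expectation (\<lambda>\<omega>. h (\<Sum>i\<in>I. \<xi> i \<omega>)) - (\<integral>t. std_normal_density t * h t \<partial>lborel)\<bar>
    \<le> 2 * (8 + B) * (\<Sum>i\<in>I. expectation (\<lambda>\<omega>. \<bar>\<xi> i \<omega>\<bar> ^ 3))"
proof -
  have cont: "isCont h x" for x
  proof -
    have "((\<lambda>y. B * \<bar>y - x\<bar>) \<longlongrightarrow> B * \<bar>x - x\<bar>) (at x)" by (intro tendsto_intros)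
    then have l: "((\<lambda>y. B * \<bar>y - x\<bar>) \<longlongrightarrow> 0) (at x)" by simp
    have "((\<lambda>y. h y - h x) \<longlongrightarrow> 0) (at x)"
      by (rule Lim_null_comparison[OF _ l]) (simp add: lip)
    then show ?thesis unfolding isCont_def by (rule LIM_zero_cancel)
  qed
  have B0: "B \<ge> 0" using lip[of 1 0] by simp
  define m where "m = (\<integral>t. std_normal_density t * h t \<partial>lborel)"
  obtain f where fd: "\<And>x. (f has_real_derivative (x * f x + h x - m)) (at x)"
    and f6: "\<And>x. \<bar>f x\<bar> \<le> 6" and f2: "\<And>x. \<bar>x * f x + h x - m\<bar> \<le> 2"
    using stein_solution[of h, OF cont h01] unfolding m_def by blast
  define f' where "f' x = x * f x + h x - m" for x
  have [measurable]: "h \<in> borel_measurable borel"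
    using cont by (intro borel_measurable_continuous_onI continuous_at_imp_continuous_on) auto
  have [measurable]: "f \<in> borel_measurable borel"
    using DERIV_isCont[OF fd] by (intro borel_measurable_continuous_onI continuous_at_imp_continuous_on) auto
  have [measurable]: "f' \<in> borel_measurable borel" unfolding f'_def by measurable
  have fdiff: "\<bar>f (x + t) - f x\<bar> \<le> 2 * \<bar>t\<bar>" for x t
    using field_differentiable_bound[of UNIV f f' 2 "x + t" x] fd f2
    by (auto simp: f'_def)
  \<comment> \<open>The product \<open>x f x\<close> inside \<open>f'\<close> makes the modulus of
    continuity grow with \<open>x\<close>. The weight is tolerable because it will be evaluated at
    \<open>Y i\<close>, which is independent of the increment.\<close>
  have f'diff: "\<bar>f' (x + t) - f' x\<bar> \<le> \<bar>t\<bar> * (6 + 2 * \<bar>x\<bar> + B)" for x t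
  proof -
    have "f' (x + t) - f' x = t * f (x + t) + x * (f (x + t) - f x) + (h (x + t) - h x)"
      by (simp add: f'_def algebra_simps)
    moreover have "\<bar>t * f (x + t)\<bar> \<le> \<bar>t\<bar> * 6" unfolding abs_mult by (intro mult_left_mono f6) auto
    moreover have "\<bar>x * (f (x + t) - f x)\<bar> \<le> \<bar>x\<bar> * (2 * \<bar>t\<bar>)"
      unfolding abs_mult by (intro mult_left_mono fdiff) auto
    moreover have "\<bar>h (x + t) - h x\<bar> \<le> B * \<bar>t\<bar>" using lip[of "x + t" x] by simp
    ultimately have "\<bar>f' (x + t) - f' x\<bar> \<le> \<bar>t\<bar> * 6 + \<bar>x\<bar> * (2 * \<bar>t\<bar>) + B * \<bar>t\<bar>" by linarith
    then show ?thesis by (simp add: algebra_simps)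
  qed
  have taylor: "\<bar>f (x + t) - f x - t * f' x\<bar> \<le> \<bar>t\<bar>\<^sup>2 * (6 + 2 * \<bar>x\<bar> + B)" for x t
  proof -
    have "\<bar>(f (x + t) - (x + t) * f' x) - (f x - x * f' x)\<bar> \<le> (\<bar>t\<bar> * (6 + 2 * \<bar>x\<bar> + B)) * \<bar>(x + t) - x\<bar>"
      using ends_in_segment[of x "x + t"]
    proof (intro field_differentiable_bound[of "closed_segment x (x + t)" "\<lambda>y. f y - y * f' x" "\<lambda>y. f' y - f' x", unfolded real_norm_def])
      fix y assume y: "y \<in> closed_segment x (x + t)"
      show "((\<lambda>y. f y - y * f' x) has_field_derivative f' y - f' x) (at y within closed_segment x (x + t))"
        using fd[of y, folded f'_def, THEN DERIV_subset] by (auto intro!: derivative_eq_intros)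
      have "\<bar>y - x\<bar> \<le> \<bar>t\<bar>" using y segment_bound1[of y x "x + t"] by simp
      have "\<bar>f' y - f' x\<bar> \<le> \<bar>y - x\<bar> * (6 + 2 * \<bar>x\<bar> + B)" using f'diff[of x "y - x"] by simp
      also have "\<dots> \<le> \<bar>t\<bar> * (6 + 2 * \<bar>x\<bar> + B)"
        using \<open>\<bar>y - x\<bar> \<le> \<bar>t\<bar>\<close> B0 by (intro mult_right_mono) auto
      finally show "\<bar>f' y - f' x\<bar> \<le> \<bar>t\<bar> * (6 + 2 * \<bar>x\<bar> + B)" .
    qed (auto)
    then show ?thesis by (simp add: power2_eq_square algebra_simps)
  qed
  define X where "X \<omega> = (\<Sum>i\<in>I. \<xi> i \<omega>)" for \<omega>
  define Y where "Y i \<omega> = (\<Sum>j\<in>I - {i}. \<xi> j \<omega>)" for i \<omega>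
  have rv[measurable]: "\<xi> i \<in> borel_measurable M" if "i \<in> I" for i
    using ind that by (auto simp: indep_vars_def)
  have [measurable]: "X \<in> borel_measurable M" unfolding X_def by measurable
  have [measurable]: "Y i \<in> borel_measurable M" for i unfolding Y_def by measurable
  have b1: "\<bar>x\<bar> \<le> 1 + \<bar>x\<bar> ^ 3" and b2: "x\<^sup>2 \<le> 1 + \<bar>x\<bar> ^ 3" for x :: real
  proof -
    show "\<bar>x\<bar> \<le> 1 + \<bar>x\<bar> ^ 3"
      using self_le_power[of "\<bar>x\<bar>" 3] by (cases "\<bar>x\<bar> \<ge> 1") (auto intro: order_trans[of _ 1])
    show "x\<^sup>2 \<le> 1 + \<bar>x\<bar> ^ 3"
    proof (cases "\<bar>x\<bar> \<ge> 1")
      case True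
      then show ?thesis using power_increasing[of 2 3 "\<bar>x\<bar>"] by simp
    next
      case False
      then have "x\<^sup>2 \<le> 1" by (simp add: abs_square_le_1)
      then show ?thesis by (simp add: add_increasing2)
    qed
  qed
  have i1: "integrable M (\<xi> i)" if "i \<in> I" for i
    using b1 that by (intro Bochner_Integration.integrable_bound[of M "\<lambda>\<omega>. 1 + \<bar>\<xi> i \<omega>\<bar> ^ 3" "\<xi> i"] Bochner_Integration.integrable_add i3) (auto simp: abs_of_nonneg add_nonneg_nonneg)
  have i2: "integrable M (\<lambda>\<omega>. (\<xi> i \<omega>)\<^sup>2)" if "i \<in> I" for i
    using b2 that by (intro Bochner_Integration.integrable_bound[of M "\<lambda>\<omega>. 1 + \<bar>\<xi> i \<omega>\<bar> ^ 3" "\<lambda>\<omega>. (\<xi> i \<omega>)\<^sup>2"] Bochner_Integration.integrable_add i3) (auto simp: abs_of_nonneg add_nonneg_nonneg)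
  have If: "integrable M (\<lambda>\<omega>. f (Z \<omega>))" "integrable M (\<lambda>\<omega>. f' (Z \<omega>))" if [measurable]: "Z \<in> borel_measurable M" for Z
    using f6 order_trans[OF f2, of 6] by (auto intro!: integrable_const_bound[of _ 6] simp: f'_def)
  have Xint: "integrable M (\<lambda>\<omega>. \<xi> i \<omega> * f (X \<omega>))" if "i \<in> I" for i
  proof (rule Bochner_Integration.integrable_bound)
    show "integrable M (\<lambda>\<omega>. 6 * \<xi> i \<omega>)" using i1[OF that] by simp
    note [measurable] = rv[OF that]
    show "(\<lambda>\<omega>. \<xi> i \<omega> * f (X \<omega>)) \<in> borel_measurable M" by measurable
    have "\<bar>\<xi> i \<omega>\<bar> * \<bar>f (X \<omega>)\<bar> \<le> \<bar>\<xi> i \<omega>\<bar> * 6" for \<omega> by (intro mult_left_mono f6) auto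
    then show "AE \<omega> in M. norm (\<xi> i \<omega> * f (X \<omega>)) \<le> norm (6 * \<xi> i \<omega>)"
      by (simp add: abs_mult mult.commute)
  qed
  define T where "T i = expectation (\<lambda>\<omega>. \<bar>\<xi> i \<omega>\<bar> ^ 3)" for i
  have main: "\<bar>expectation (\<lambda>\<omega>. (\<xi> i \<omega>)\<^sup>2) * expectation (\<lambda>\<omega>. f' (X \<omega>)) - expectation (\<lambda>\<omega>. \<xi> i \<omega> * f (X \<omega>))\<bar>
      \<le> 2 * (8 + B) * T i" if iI: "i \<in> I" for i
  proof -
    have XY: "X \<omega> = Y i \<omega> + \<xi> i \<omega>" for \<omega>
      unfolding X_def Y_def using I iI by (simp add: sum.remove)
    have ij: "indep_var borel (\<xi> i) borel (Y i)"
      unfolding Y_def using I iI ind by (intro indep_vars_sum) (auto simp: insert_absorb)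
    have comp: "indep_var borel (\<lambda>\<omega>. p (\<xi> i \<omega>)) borel (\<lambda>\<omega>. r (Y i \<omega>))"
      if "p \<in> borel_measurable borel" "r \<in> borel_measurable borel" for p r :: "real \<Rightarrow> real"
      using indep_var_compose[OF ij that] by (simp add: comp_def)
    have iY: "integrable M (Y i)" unfolding Y_def using i1 by auto
    have Y2: "integrable M (\<lambda>\<omega>. (Y i \<omega>)\<^sup>2)" "expectation (\<lambda>\<omega>. (Y i \<omega>)\<^sup>2) \<le> 1"
    proof -
      have *: "integrable M (\<lambda>\<omega>. (Y i \<omega>)\<^sup>2) \<and>
         expectation (\<lambda>\<omega>. (Y i \<omega>)\<^sup>2) = (\<Sum>j\<in>I - {i}. expectation (\<lambda>\<omega>. (\<xi> j \<omega>)\<^sup>2))"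
        unfolding Y_def using I i1 i2 mean indep_vars_subset[OF ind, of "I - {i}"]
        by (intro indep_vars_second_moment_sum) auto
      have "(\<Sum>j\<in>I - {i}. expectation (\<lambda>\<omega>. (\<xi> j \<omega>)\<^sup>2)) \<le> (\<Sum>j\<in>I. expectation (\<lambda>\<omega>. (\<xi> j \<omega>)\<^sup>2))"
        using I by (intro sum_mono2) auto
      with * var show "integrable M (\<lambda>\<omega>. (Y i \<omega>)\<^sup>2)" "expectation (\<lambda>\<omega>. (Y i \<omega>)\<^sup>2) \<le> 1" by auto
    qed
    \<comment> \<open>The variance of \<open>Y i\<close> is at most the total variance 1, so
      \<open>E|Y i| \<le> 1\<close> and the expected weight is at most \<open>8 + B\<close>.\<close>
    have "expectation (\<lambda>\<omega>. 2 * \<bar>Y i \<omega>\<bar>) \<le> expectation (\<lambda>\<omega>. 1 + (Y i \<omega>)\<^sup>2)"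
    proof (intro integral_mono)
      fix \<omega>
      show "2 * \<bar>Y i \<omega>\<bar> \<le> 1 + (Y i \<omega>)\<^sup>2" using sum_squares_bound[of 1 "\<bar>Y i \<omega>\<bar>"] by simp
    qed (use iY Y2 in auto)
    also have "\<dots> \<le> 2" using Y2 by (simp add: prob_space)
    finally have EY: "expectation (\<lambda>\<omega>. 6 + 2 * \<bar>Y i \<omega>\<bar> + B) \<le> 8 + B"
      using iY by (simp add: prob_space)
    have wint: "integrable M (\<lambda>\<omega>. 6 + 2 * \<bar>Y i \<omega>\<bar> + B)" using iY by auto
    have e1: "expectation (\<lambda>\<omega>. \<xi> i \<omega> * f (Y i \<omega>)) = 0" "integrable M (\<lambda>\<omega>. \<xi> i \<omega> * f (Y i \<omega>))"
      using indep_var_lebesgue_integral[OF comp[of "\<lambda>x. x" f]] indep_var_integrable[OF comp[of "\<lambda>x. x" f]]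
        i1[OF iI] If(1)[of "Y i"] mean[OF iI] by auto
    have e2: "expectation (\<lambda>\<omega>. (\<xi> i \<omega>)\<^sup>2 * f' (Y i \<omega>)) = expectation (\<lambda>\<omega>. (\<xi> i \<omega>)\<^sup>2) * expectation (\<lambda>\<omega>. f' (Y i \<omega>))"
      "integrable M (\<lambda>\<omega>. (\<xi> i \<omega>)\<^sup>2 * f' (Y i \<omega>))"
      using indep_var_lebesgue_integral[OF comp[of "\<lambda>x. x\<^sup>2" f']] indep_var_integrable[OF comp[of "\<lambda>x. x\<^sup>2" f']]
        i2[OF iI] If(2)[of "Y i"] by auto
    have e3: "expectation (\<lambda>\<omega>. \<bar>\<xi> i \<omega>\<bar> ^ 3 * (6 + 2 * \<bar>Y i \<omega>\<bar> + B)) = T i * expectation (\<lambda>\<omega>. 6 + 2 * \<bar>Y i \<omega>\<bar> + B)"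
      "integrable M (\<lambda>\<omega>. \<bar>\<xi> i \<omega>\<bar> ^ 3 * (6 + 2 * \<bar>Y i \<omega>\<bar> + B))"
      using indep_var_lebesgue_integral[OF comp[of "\<lambda>x. \<bar>x\<bar> ^ 3" "\<lambda>y. 6 + 2 * \<bar>y\<bar> + B"]]
        indep_var_integrable[OF comp[of "\<lambda>x. \<bar>x\<bar> ^ 3" "\<lambda>y. 6 + 2 * \<bar>y\<bar> + B"]] i3[OF iI] wint
      by (auto simp: T_def)
    have e4: "expectation (\<lambda>\<omega>. \<bar>\<xi> i \<omega>\<bar> * (6 + 2 * \<bar>Y i \<omega>\<bar> + B)) = expectation (\<lambda>\<omega>. \<bar>\<xi> i \<omega>\<bar>) * expectation (\<lambda>\<omega>. 6 + 2 * \<bar>Y i \<omega>\<bar> + B)"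
      "integrable M (\<lambda>\<omega>. \<bar>\<xi> i \<omega>\<bar> * (6 + 2 * \<bar>Y i \<omega>\<bar> + B))"
      using indep_var_lebesgue_integral[OF comp[of abs "\<lambda>y. 6 + 2 * \<bar>y\<bar> + B"]]
        indep_var_integrable[OF comp[of abs "\<lambda>y. 6 + 2 * \<bar>y\<bar> + B"]] i1[OF iI] wint
      by auto
    have T0: "T i \<ge> 0" unfolding T_def by (intro Bochner_Integration.integral_nonneg) auto
    have "\<bar>expectation (\<lambda>\<omega>. \<xi> i \<omega> * f (X \<omega>) - \<xi> i \<omega> * f (Y i \<omega>) - (\<xi> i \<omega>)\<^sup>2 * f' (Y i \<omega>))\<bar>
        \<le> expectation (\<lambda>\<omega>. \<bar>\<xi> i \<omega>\<bar> ^ 3 * (6 + 2 * \<bar>Y i \<omega>\<bar> + B))"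
    proof (rule order_trans[OF integral_abs_bound], rule integral_mono)
      fix \<omega>
      have "\<xi> i \<omega> * f (X \<omega>) - \<xi> i \<omega> * f (Y i \<omega>) - (\<xi> i \<omega>)\<^sup>2 * f' (Y i \<omega>)
          = \<xi> i \<omega> * (f (Y i \<omega> + \<xi> i \<omega>) - f (Y i \<omega>) - \<xi> i \<omega> * f' (Y i \<omega>))"
        by (simp add: XY power2_eq_square algebra_simps)
      then have "\<bar>\<xi> i \<omega> * f (X \<omega>) - \<xi> i \<omega> * f (Y i \<omega>) - (\<xi> i \<omega>)\<^sup>2 * f' (Y i \<omega>)\<bar>
          \<le> \<bar>\<xi> i \<omega>\<bar> * (\<bar>\<xi> i \<omega>\<bar>\<^sup>2 * (6 + 2 * \<bar>Y i \<omega>\<bar> + B))"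
        by (simp only:) (subst abs_mult, intro mult_left_mono taylor abs_ge_zero)
      then show "\<bar>\<xi> i \<omega> * f (X \<omega>) - \<xi> i \<omega> * f (Y i \<omega>) - (\<xi> i \<omega>)\<^sup>2 * f' (Y i \<omega>)\<bar>
          \<le> \<bar>\<xi> i \<omega>\<bar> ^ 3 * (6 + 2 * \<bar>Y i \<omega>\<bar> + B)"
        by (simp add: power2_eq_square power3_eq_cube mult_ac)
    qed (use Xint[OF iI] e1 e2 e3 in auto)
    also have "\<dots> \<le> T i * (8 + B)" unfolding e3 using T0 EY by (intro mult_left_mono) auto
    finally have 1: "\<bar>expectation (\<lambda>\<omega>. \<xi> i \<omega> * f (X \<omega>)) - expectation (\<lambda>\<omega>. (\<xi> i \<omega>)\<^sup>2) * expectation (\<lambda>\<omega>. f' (Y i \<omega>))\<bar>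
        \<le> T i * (8 + B)"
      using Xint[OF iI] e1 e2 by simp
    have "\<bar>expectation (\<lambda>\<omega>. f' (X \<omega>) - f' (Y i \<omega>))\<bar> \<le> expectation (\<lambda>\<omega>. \<bar>\<xi> i \<omega>\<bar> * (6 + 2 * \<bar>Y i \<omega>\<bar> + B))"
    proof (rule order_trans[OF integral_abs_bound], rule integral_mono)
      fix \<omega>
      show "\<bar>f' (X \<omega>) - f' (Y i \<omega>)\<bar> \<le> \<bar>\<xi> i \<omega>\<bar> * (6 + 2 * \<bar>Y i \<omega>\<bar> + B)"
        unfolding XY by (rule f'diff)
    qed (use If e4 in auto)
    also have "\<dots> \<le> expectation (\<lambda>\<omega>. \<bar>\<xi> i \<omega>\<bar>) * (8 + B)"
      unfolding e4 using EY by (intro mult_left_mono Bochner_Integration.integral_nonneg) auto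
    finally have 2: "\<bar>expectation (\<lambda>\<omega>. f' (X \<omega>)) - expectation (\<lambda>\<omega>. f' (Y i \<omega>))\<bar> \<le> expectation (\<lambda>\<omega>. \<bar>\<xi> i \<omega>\<bar>) * (8 + B)"
      using If by simp
    have "\<bar>expectation (\<lambda>\<omega>. (\<xi> i \<omega>)\<^sup>2) * expectation (\<lambda>\<omega>. f' (X \<omega>)) - expectation (\<lambda>\<omega>. (\<xi> i \<omega>)\<^sup>2) * expectation (\<lambda>\<omega>. f' (Y i \<omega>))\<bar>
        = expectation (\<lambda>\<omega>. (\<xi> i \<omega>)\<^sup>2) * \<bar>expectation (\<lambda>\<omega>. f' (X \<omega>)) - expectation (\<lambda>\<omega>. f' (Y i \<omega>))\<bar>"
      by (simp add: right_diff_distrib[symmetric] abs_mult)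
    also have "\<dots> \<le> expectation (\<lambda>\<omega>. (\<xi> i \<omega>)\<^sup>2) * (expectation (\<lambda>\<omega>. \<bar>\<xi> i \<omega>\<bar>) * (8 + B))"
      by (intro mult_left_mono 2 Bochner_Integration.integral_nonneg) auto
    also have "\<dots> \<le> T i * (8 + B)"
      unfolding T_def mult.assoc[symmetric] using B0
      by (intro mult_right_mono expectation_square_abs_le_cube i3 i2 i1 iI) auto
    finally show ?thesis using 1 by (simp add: algebra_simps abs_le_iff) 
  qed
  have "expectation (\<lambda>\<omega>. h (X \<omega>)) - m = expectation (\<lambda>\<omega>. f' (X \<omega>) - X \<omega> * f (X \<omega>))"
  proof -
    have "expectation (\<lambda>\<omega>. f' (X \<omega>) - X \<omega> * f (X \<omega>)) = expectation (\<lambda>\<omega>. h (X \<omega>) - m)"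
      by (simp add: f'_def)
    also have "\<dots> = expectation (\<lambda>\<omega>. h (X \<omega>)) - m"
      using h01 by (subst Bochner_Integration.integral_diff)
        (auto intro!: integrable_const_bound[of _ 1] simp: prob_space)
    finally show ?thesis by simp
  qed
  also have "\<dots> = expectation (\<lambda>\<omega>. f' (X \<omega>)) - (\<Sum>i\<in>I. expectation (\<lambda>\<omega>. \<xi> i \<omega> * f (X \<omega>)))"
  proof -
    have *: "X \<omega> * f (X \<omega>) = (\<Sum>i\<in>I. \<xi> i \<omega> * f (X \<omega>))" for \<omega>
      by (subst (1) X_def) (simp add: sum_distrib_right)
    show ?thesis unfolding *
      using If(2)[of X] Xint by simp
  qed
  also have "\<dots> = (\<Sum>i\<in>I. expectation (\<lambda>\<omega>. (\<xi> i \<omega>)\<^sup>2) * expectation (\<lambda>\<omega>. f' (X \<omega>)) - expectation (\<lambda>\<omega>. \<xi> i \<omega> * f (X \<omega>)))"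
    unfolding sum_subtractf sum_distrib_right[symmetric] var by simp
  finally have "\<bar>expectation (\<lambda>\<omega>. h (X \<omega>)) - m\<bar> \<le> (\<Sum>i\<in>I. 2 * (8 + B) * T i)"
    using main by (auto intro!: order_trans[OF sum_abs] sum_mono)
  then show ?thesis unfolding X_def m_def T_def by (simp add: sum_distrib_left)
qed

section \<open>Recursive inequalities and square-integrable variables\<close>

text \<open>The target \<open>n^(-p)\<close> loses at most the factor \<open>1 - p / n\<close> in
  one step, since \<open>ln (1 + 1/n) \<le> 1/n\<close>. A contraction rate above \<open>p\<close>
  therefore keeps up with it.\<close>

lemma powr_minus_step:
  fixes n p :: real
  assumes "n > 0" "p \<ge> 0"
  shows "n powr (- p) * (1 - p / n) \<le> (n + 1) powr (- p)"
proof -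
  have n1: "n + 1 = n * (1 + 1 / n)" using assms by (simp add: field_simps)
  have "1 - p * (1 / n) \<le> 1 - p * ln (1 + 1 / n)"
    using assms by (intro diff_left_mono mult_left_mono ln_add_one_self_le_self) auto
  also have "\<dots> \<le> exp (- (p * ln (1 + 1 / n)))" using exp_ge_add_one_self[of "- (p * ln (1 + 1 / n))"] by simp
  also have "\<dots> = (1 + 1 / n) powr (- p)" using assms by (simp add: powr_def add_pos_pos less_imp_neq[symmetric])
  finally have "n powr (- p) * (1 - p / n) \<le> n powr (- p) * (1 + 1 / n) powr (- p)"
    by (intro mult_left_mono) auto
  also have "\<dots> = (n + 1) powr (- p)" unfolding n1 using assms by (subst powr_mult) auto
  finally show ?thesis .
qed

lemma powr_minus_Suc:
  fixes n :: real
  assumes "n > 0"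
  shows "n powr (- (1 + p)) = n powr (- p) / n"
proof -
  have eq: "- (1 + p) = - p - 1" by simp
  have "n powr (- p - 1) = n powr (- p) / n powr 1" by (rule powr_diff)
  then show ?thesis unfolding eq using assms by (simp only: powr_one)
qed

text \<open>Under the induction hypothesis the step yields
  \<open>n^(-p) (C - (c C - D) / n)\<close>. Any \<open>C \<ge> D / (c - p)\<close> has
  \<open>c C - D \<ge> p C\<close>, and the loss \<open>p / n\<close> is exactly what
  \<open>powr_minus_step\<close> allows. \<open>K \<ge> c\<close> keeps the contraction factor
  nonnegative.\<close>

lemma recursion_decay:
  fixes e :: "nat \<Rightarrow> real"
  assumes rec: "\<And>k. e (Suc k) \<le> (1 - c / (real k + K)) * e k + D * (real k + K) powr (- (1 + p))"
    and cp: "p \<ge> 0" "c > p" "K \<ge> c" "K > 0" and D: "D \<ge> 0"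
  shows "\<exists>C\<ge>0. \<forall>k. e k \<le> C * (real k + K) powr (- p)"
proof -
  define C where "C = max 0 (max (e 0 * K powr p) (D / (c - p)))"
  have C0: "C \<ge> 0" and Ce: "e 0 * K powr p \<le> C" and CD: "D / (c - p) \<le> C" by (auto simp: C_def)
  have CD': "D + p * C \<le> c * C" using CD cp by (simp add: divide_le_eq algebra_simps)
  have "e k \<le> C * (real k + K) powr (- p)" for k
  proof (induction k)
    case 0
    have "e 0 = (e 0 * K powr p) * K powr (- p)" using cp by (simp add: powr_minus)
    also have "\<dots> \<le> C * K powr (- p)" using Ce by (intro mult_right_mono) auto
    finally show ?case by simp
  next
    case (Suc k)
    define n where "n = real k + K"
    have n: "n > 0" "n \<ge> c" using cp by (auto simp: n_def)
    have "e (Suc k) \<le> (1 - c / n) * e k + D * n powr (- (1 + p))" using rec[of k] by (simp add: n_def)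
    also have "\<dots> \<le> (1 - c / n) * (C * n powr (- p)) + D * n powr (- (1 + p))"
      using Suc n by (intro add_right_mono mult_left_mono) (auto simp: n_def)
    also have "n powr (- (1 + p)) = n powr (- p) / n" by (rule powr_minus_Suc) (use n in simp)
    also have "(1 - c / n) * (C * n powr (- p)) + D * (n powr (- p) / n)
        = n powr (- p) * (C - (c * C - D) / n)" using n by (simp add: field_simps)
    also have "\<dots> \<le> n powr (- p) * (C - p * C / n)"
      using CD' n by (intro mult_left_mono diff_left_mono divide_right_mono) auto
    also have "\<dots> = C * (n powr (- p) * (1 - p / n))" by (simp add: algebra_simps)
    also have "\<dots> \<le> C * (n + 1) powr (- p)" using n cp C0 by (intro mult_left_mono powr_minus_step) auto
    finally show ?case by (simp add: n_def add_ac)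
  qed
  with C0 show ?thesis by blast
qed

section \<open>Random vectors with finite second moments\<close>

lemma outer_inner: "u \<bullet> (outer x y *v z) = (x \<bullet> u) * (y \<bullet> z)"
  by (simp add: outer_def inner_vec_def matrix_vector_mult_def sum_distrib_left sum_distrib_right mult_ac)
    (rule sum.swap)

lemma integrable_vec_componentwise:
  fixes f :: "'m \<Rightarrow> 'a::euclidean_space ^ 'n"
  assumes "\<And>i. integrable M (\<lambda>\<omega>. f \<omega> $ i)"
  shows "integrable M f"
proof -
  have bl: "bounded_linear (axis i :: 'a \<Rightarrow> 'a ^ 'n)" for i
    by (intro linear_conv_bounded_linear[THEN iffD1] linearI) (auto simp: axis_def vec_eq_iff)
  have "integrable M (\<lambda>\<omega>. \<Sum>i\<in>UNIV. axis i (f \<omega> $ i))"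
    by (intro Bochner_Integration.integrable_sum integrable_bounded_linear[OF bl] assms)
  also have "(\<lambda>\<omega>. \<Sum>i\<in>UNIV. axis i (f \<omega> $ i)) = f"
    by (auto simp: vec_eq_iff axis_def if_distrib cong: if_cong)
  finally show ?thesis .
qed

lemma matrix_vector_measurable[measurable (raw)]:
  fixes B :: "real^'n^'m"
  assumes "f \<in> borel_measurable N"
  shows "(\<lambda>\<omega>. B *v f \<omega>) \<in> borel_measurable N"
  by (rule borel_measurable_continuous_on[OF _ assms])
    (intro matrix_vector_mult_linear_continuous_on)

definition (in prob_space) square_integrable :: "('a \<Rightarrow> 'b::euclidean_space) \<Rightarrow> bool" where
  "square_integrable X \<longleftrightarrow> X \<in> borel_measurable M \<and> integrable M (\<lambda>\<omega>. (norm (X \<omega>))\<^sup>2)"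

context prob_space
begin

lemma square_integrableD[dest]:
  assumes "square_integrable X"
  shows "X \<in> borel_measurable M" "integrable M (\<lambda>\<omega>. (norm (X \<omega>))\<^sup>2)"
  using assms by (auto simp: square_integrable_def)

lemma square_integrable_bound:
  assumes X: "square_integrable X" and Y: "square_integrable Y" and [measurable]: "Z \<in> borel_measurable M"
    and le: "\<And>\<omega>. \<omega> \<in> space M \<Longrightarrow> norm (Z \<omega>) \<le> c * norm (X \<omega>) + d * norm (Y \<omega>)"
  shows "square_integrable Z"
  unfolding square_integrable_def
proof
  show "integrable M (\<lambda>\<omega>. (norm (Z \<omega>))\<^sup>2)"
  proof (rule Bochner_Integration.integrable_bound)
    show "integrable M (\<lambda>\<omega>. 2 * c\<^sup>2 * (norm (X \<omega>))\<^sup>2 + 2 * d\<^sup>2 * (norm (Y \<omega>))\<^sup>2)"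
      using X Y by (intro Bochner_Integration.integrable_add integrable_mult_right) auto
    show "AE \<omega> in M. norm ((norm (Z \<omega>))\<^sup>2) \<le> norm (2 * c\<^sup>2 * (norm (X \<omega>))\<^sup>2 + 2 * d\<^sup>2 * (norm (Y \<omega>))\<^sup>2)"
    proof (rule AE_I2)
      fix \<omega> assume "\<omega> \<in> space M"
      then have "(norm (Z \<omega>))\<^sup>2 \<le> (c * norm (X \<omega>) + d * norm (Y \<omega>))\<^sup>2"
        by (intro power_mono le) auto
      also have "\<dots> \<le> 2 * (c * norm (X \<omega>))\<^sup>2 + 2 * (d * norm (Y \<omega>))\<^sup>2"
        using sum_squares_bound[of "c * norm (X \<omega>)" "d * norm (Y \<omega>)"] by (simp add: power2_sum)
      finally show "norm ((norm (Z \<omega>))\<^sup>2) \<le> norm (2 * c\<^sup>2 * (norm (X \<omega>))\<^sup>2 + 2 * d\<^sup>2 * (norm (Y \<omega>))\<^sup>2)"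
        by (simp add: power_mult_distrib)
    qed
  qed measurable
qed measurable

lemma square_integrable_bound1:
  assumes X: "square_integrable X" and Z: "Z \<in> borel_measurable M"
    and le: "\<And>\<omega>. \<omega> \<in> space M \<Longrightarrow> norm (Z \<omega>) \<le> c * norm (X \<omega>)"
  shows "square_integrable Z"
  using square_integrable_bound[OF X X Z, of c 0] le by simp

lemma square_integrable_add:
  assumes "square_integrable X" "square_integrable Y"
  shows "square_integrable (\<lambda>\<omega>. X \<omega> + Y \<omega>)"
  using assms by (intro square_integrable_bound[OF assms, of _ 1 1] borel_measurable_add) (auto intro: norm_triangle_ineq)

lemma square_integrable_diff:
  assumes "square_integrable X" "square_integrable Y"
  shows "square_integrable (\<lambda>\<omega>. X \<omega> - Y \<omega>)"
  using assms by (intro square_integrable_bound[OF assms, of _ 1 1] borel_measurable_diff) (auto intro: norm_triangle_ineq4)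

lemma square_integrable_scaleR:
  assumes "square_integrable X"
  shows "square_integrable (\<lambda>\<omega>. c *\<^sub>R X \<omega>)"
  using assms by (intro square_integrable_bound1[OF assms, of _ "\<bar>c\<bar>"]) auto

lemma square_integrable_const: "square_integrable (\<lambda>_. c)"
  by (simp add: square_integrable_def)

lemma square_integrable_norm_mult:
  assumes "square_integrable X" "square_integrable Y"
  shows "integrable M (\<lambda>\<omega>. norm (X \<omega>) * norm (Y \<omega>))"
proof (rule Bochner_Integration.integrable_bound)
  note [measurable] = square_integrableD(1)[OF assms(1)] square_integrableD(1)[OF assms(2)]
  show "integrable M (\<lambda>\<omega>. (norm (X \<omega>))\<^sup>2 + (norm (Y \<omega>))\<^sup>2)" using assms by auto
  show "(\<lambda>\<omega>. norm (X \<omega>) * norm (Y \<omega>)) \<in> borel_measurable M" by measurable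
  have "norm (X \<omega>) * norm (Y \<omega>) \<le> (norm (X \<omega>))\<^sup>2 + (norm (Y \<omega>))\<^sup>2" for \<omega>
    using sum_squares_bound[of "norm (X \<omega>)" "norm (Y \<omega>)"] zero_le_power2[of "norm (X \<omega>)"] zero_le_power2[of "norm (Y \<omega>)"]
    by linarith
  then show "AE \<omega> in M. norm (norm (X \<omega>) * norm (Y \<omega>)) \<le> norm ((norm (X \<omega>))\<^sup>2 + (norm (Y \<omega>))\<^sup>2)"
    by simp
qed

lemma square_integrable_inner:
  assumes "square_integrable X" "square_integrable Y"
  shows "integrable M (\<lambda>\<omega>. X \<omega> \<bullet> Y \<omega>)"
proof (rule Bochner_Integration.integrable_bound[OF square_integrable_norm_mult[OF assms]])
  note [measurable] = square_integrableD(1)[OF assms(1)] square_integrableD(1)[OF assms(2)]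
  show "(\<lambda>\<omega>. X \<omega> \<bullet> Y \<omega>) \<in> borel_measurable M" by measurable
qed (simp add: Cauchy_Schwarz_ineq2)

lemma square_integrable_mult:
  fixes X Y :: "'a \<Rightarrow> real"
  assumes "square_integrable X" "square_integrable Y"
  shows "integrable M (\<lambda>\<omega>. X \<omega> * Y \<omega>)"
  using square_integrable_inner[OF assms] by simp

lemma square_integrable_integrable:
  assumes "square_integrable X"
  shows "integrable M X"
proof (rule integrable_norm_cancel)
  show "integrable M (\<lambda>\<omega>. norm (X \<omega>))"
    using square_integrable_norm_mult[OF assms square_integrable_const[of "1 :: real"]] by simp
qed (use assms in auto)

lemma square_integrable_inner_left:
  assumes "square_integrable X"
  shows "square_integrable (\<lambda>\<omega>. u \<bullet> X \<omega>)"
proof -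
  have [measurable]: "X \<in> borel_measurable M" using assms by auto
  show ?thesis by (rule square_integrable_bound1[OF assms, of _ "norm u"]) (auto simp: Cauchy_Schwarz_ineq2)
qed

lemma square_integrable_real: 
  fixes X :: "'a \<Rightarrow> real"
  shows "square_integrable X \<longleftrightarrow> X \<in> borel_measurable M \<and> integrable M (\<lambda>\<omega>. (X \<omega>)\<^sup>2)"
  by (simp add: square_integrable_def)

lemma integrable_outer:
  fixes X :: "'a \<Rightarrow> real^'n"
  assumes "square_integrable X"
  shows "integrable M (\<lambda>\<omega>. outer (X \<omega>) (X \<omega>))"
proof (intro integrable_vec_componentwise)
  fix i j
  have c: "square_integrable (\<lambda>\<omega>. X \<omega> $ i)" for i
    using square_integrable_inner_left[OF assms, of "axis i 1"] by (simp add: inner_axis')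
  show "integrable M (\<lambda>\<omega>. outer (X \<omega>) (X \<omega>) $ i $ j)"
    using square_integrable_mult[OF c c] by (simp add: outer_def)
qed

lemma integral_outer:
  fixes X :: "'a \<Rightarrow> real^'n"
  assumes "square_integrable X"
  shows "u \<bullet> ((\<integral>\<omega>. outer (X \<omega>) (X \<omega>) \<partial>M) *v y) = expectation (\<lambda>\<omega>. (u \<bullet> X \<omega>) * (y \<bullet> X \<omega>))"
proof -
  have "bounded_linear (\<lambda>B :: real^'n^'n. u \<bullet> (B *v y))"
    by (intro linear_conv_bounded_linear[THEN iffD1] linearI)
      (auto simp: matrix_vector_mult_add_rdistrib inner_add_right scaleR_matrix_vector_assoc[symmetric])
  from integral_bounded_linear[OF this integrable_outer[OF assms]]
  show ?thesis by (simp add: outer_inner inner_commute)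
qed

lemma expectation_abs_le_sqrt:
  fixes X :: "'a \<Rightarrow> real"
  assumes "square_integrable X"
  shows "expectation (\<lambda>\<omega>. \<bar>X \<omega>\<bar>) \<le> sqrt (expectation (\<lambda>\<omega>. (X \<omega>)\<^sup>2))"
proof -
  have i2: "integrable M (\<lambda>\<omega>. (X \<omega>)\<^sup>2)" and i1: "integrable M X"
    using assms square_integrable_integrable[OF assms] by (auto simp: square_integrable_real)
  define m where "m = expectation (\<lambda>\<omega>. \<bar>X \<omega>\<bar>)"
  have "m * m + m * m - m\<^sup>2 = expectation (\<lambda>\<omega>. 2 * m * \<bar>X \<omega>\<bar> - m\<^sup>2)"
    using i1 by (simp add: prob_space m_def)
  also have "\<dots> \<le> expectation (\<lambda>\<omega>. (X \<omega>)\<^sup>2)"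
  proof (intro integral_mono)
    fix \<omega>
    show "2 * m * \<bar>X \<omega>\<bar> - m\<^sup>2 \<le> (X \<omega>)\<^sup>2" using sum_squares_bound[of m "\<bar>X \<omega>\<bar>"] by simp
  qed (use i1 i2 in auto)
  finally have "m\<^sup>2 \<le> expectation (\<lambda>\<omega>. (X \<omega>)\<^sup>2)" by (simp add: power2_eq_square)
  then show ?thesis unfolding m_def by (rule real_le_rsqrt)
qed

end

section \<open>The stochastic approximation process\<close>

text \<open>The three thresholds in turn keep \<open>1 - 7 / n\<close> nonnegative, keep every step
  below the bound demanded by \<open>q_contract\<close>, and limit the second-order term of the
  Lyapunov drift to \<open>1 / (12 n)\<close>. The argument stands for the noise constant
  \<open>A\<^sub>1\<close>.\<close>

definition (in stable_step) K_min where
  "K_min B = max 7 (max (\<alpha>\<^sup>2 * L\<^sub>J\<^sup>2) (12 * (L / 2 * (3 * L\<^sub>F\<^sup>2 + 6 * \<bar>B\<bar>) * u) * \<alpha>\<^sup>2))"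

locale sa_process = stable_step F R xstar \<Phi> norm_s grad \<gamma> L\<^sub>s l u r C\<^sub>r \<delta> L\<^sub>F J \<alpha> V + prob_space M
  for F R :: "real ^ 'd \<Rightarrow> real ^ 'd" and xstar \<Phi> norm_s grad \<gamma> L\<^sub>s l u r C\<^sub>r \<delta> L\<^sub>F J \<alpha> V
    and M :: "'m measure" +
  fixes Nv :: "'v measure" and Nw :: "'w measure"
    and A :: "'v \<Rightarrow> real ^ 'd \<Rightarrow> real ^ 'd" and A\<^sub>1 :: real
    and b :: "'w \<Rightarrow> real ^ 'd" and \<Sigma>\<^sub>b :: "real ^ 'd ^ 'd" and K :: real
    and x :: "nat \<Rightarrow> 'm \<Rightarrow> real ^ 'd" and v :: "nat \<Rightarrow> 'm \<Rightarrow> 'v" and w :: "nat \<Rightarrow> 'm \<Rightarrow> 'w"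
  assumes gamma: "\<gamma> * \<alpha> > 2 / 3"
    and K: "K \<ge> K_min A\<^sub>1"
    and noise: "noise_condition M Nv Nw xstar x v w A A\<^sub>1 b \<Sigma>\<^sub>b"
    and iter: "sa_iterates M F (step_size \<alpha> K) x v w A b"
begin

definition h where "h k = \<alpha> / (real k + K)"
definition e where "e k \<omega> = x k \<omega> - xstar"
definition bn where "bn k \<omega> = b (w k \<omega>)"
definition An where "An k \<omega> = A (v k \<omega>) (x k \<omega>)"
definition Hist where "Hist k = history M Nv Nw (x 0) v w k"

primrec s where
  "s 0 \<omega> = 0"
| "s (Suc k) \<omega> = step (h k) (s k \<omega>) + h k *\<^sub>R bn k \<omega>"

lemma K_ge: "K \<ge> 7" "K \<ge> \<alpha>\<^sup>2 * L\<^sub>J\<^sup>2" "K \<ge> 12 * (L / 2 * (3 * L\<^sub>F\<^sup>2 + 6 * \<bar>A\<^sub>1\<bar>) * u) * \<alpha>\<^sup>2"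
  using K by (auto simp: K_min_def)

lemma n_ge: "real k + K \<ge> 7" "real k + K > 0"
  using K_ge(1) by (simp_all add: add_nonneg_pos)

lemma h_pos: "h k > 0"
  unfolding h_def using alpha_pos n_ge by simp

lemma h_small: "h k \<le> 1 / (\<alpha> * L\<^sub>J\<^sup>2)"
proof -
  have "\<alpha>\<^sup>2 * L\<^sub>J\<^sup>2 \<le> real k + K" using K_ge(2) by (simp add: add_increasing)
  then show ?thesis unfolding h_def using alpha_pos LJ_pos n_ge[of k]
    by (simp add: field_simps power2_eq_square)
qed

lemma h_eq: "step_size \<alpha> K k = h k"
  by (simp add: step_size_def h_def)

lemma e_step:
  assumes "\<omega> \<in> space M"
  shows "e (Suc k) \<omega> = e k \<omega> + h k *\<^sub>R (F (xstar + e k \<omega>) + (An k \<omega> + bn k \<omega>))"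
  using iter assms by (simp add: sa_iterates_def e_def An_def bn_def h_eq)

lemma v_meas: "v k \<in> measurable M Nv" and w_meas: "w k \<in> measurable M Nw"
  and A_meas: "case_prod A \<in> borel_measurable (Nv \<Otimes>\<^sub>M borel)" and b_meas: "b \<in> borel_measurable Nw"
  and w_indep: "indep_vars (\<lambda>_. Nw) w UNIV"
  and w_distr: "distr M Nw (w k) = distr M Nw (w 0)"
  using noise by (auto simp: noise_condition_def)

lemma F_meas: "F \<in> borel_measurable borel"
proof -
  have "L\<^sub>F-lipschitz_on UNIV F"
    using F_lipschitz pos by (intro lipschitz_onI) (auto simp: dist_norm)
  then show ?thesis by (intro borel_measurable_continuous_onI lipschitz_on_continuous_on)
qed

text \<open>The \<sigma>-algebra \<open>N\<close> is left free so that one induction serves both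
  \<open>M\<close> and the history at time \<open>k\<close>, which knows the noise of indices below
  \<open>k\<close> only.\<close>

lemma iterates_measurable:
  assumes sp: "space N = space M" and x0: "x 0 \<in> borel_measurable N"
    and v: "\<And>j. j < k \<Longrightarrow> v j \<in> measurable N Nv" and w: "\<And>j. j < k \<Longrightarrow> w j \<in> measurable N Nw"
    and "j \<le> k"
  shows "x j \<in> borel_measurable N \<and> s j \<in> borel_measurable N"
  using \<open>j \<le> k\<close>
proof (induction j)
  case 0
  then show ?case using x0 by simp
next
  case (Suc j)
  note [measurable] = F_meas A_meas b_meas v[of j] w[of j]
  have [measurable]: "x j \<in> borel_measurable N" "s j \<in> borel_measurable N"
    "v j \<in> measurable N Nv" "w j \<in> measurable N Nw" using Suc v w by auto
  have [measurable]: "(\<lambda>\<omega>. A (v j \<omega>) (x j \<omega>)) \<in> borel_measurable N"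
    using measurable_compose[of "\<lambda>\<omega>. (v j \<omega>, x j \<omega>)" N "Nv \<Otimes>\<^sub>M borel" "case_prod A" borel] A_meas by simp
  have "x (Suc j) \<in> borel_measurable N \<longleftrightarrow>
    (\<lambda>\<omega>. x j \<omega> + h j *\<^sub>R (F (x j \<omega>) + (A (v j \<omega>) (x j \<omega>) + b (w j \<omega>)))) \<in> borel_measurable N"
    using iter by (intro measurable_cong) (simp add: sp sa_iterates_def h_eq)
  moreover have "(\<lambda>\<omega>. x j \<omega> + h j *\<^sub>R (F (x j \<omega>) + (A (v j \<omega>) (x j \<omega>) + b (w j \<omega>)))) \<in> borel_measurable N"
    by measurable
  moreover have "s (Suc j) \<in> borel_measurable N"
    unfolding s.simps[abs_def] step_def bn_def by measurable
  ultimately show ?case by blast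
qed

lemma x_meas: "x k \<in> borel_measurable M"
  using iterates_measurable[of M k k] iter v_meas w_meas by (auto simp: sa_iterates_def)

lemma e_meas: "e k \<in> borel_measurable M"
  unfolding e_def[abs_def] using x_meas[of k] by measurable

lemma An_meas: "An k \<in> borel_measurable M"
  using measurable_compose[of "\<lambda>\<omega>. (v k \<omega>, x k \<omega>)" M "Nv \<Otimes>\<^sub>M borel" "case_prod A" borel]
    A_meas v_meas x_meas by (simp add: An_def[abs_def])

lemma bn_meas: "bn k \<in> borel_measurable M"
  unfolding bn_def[abs_def] using measurable_compose[OF w_meas b_meas] .

lemma Hist_generators:
  "{x 0 -` S \<inter> space M | S. S \<in> sets borel} \<union>
      (\<Union>j<k. {v j -` S \<inter> space M | S. S \<in> sets Nv}) \<union>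
      (\<Union>j<k. {w j -` S \<inter> space M | S. S \<in> sets Nw}) \<subseteq> sets M"
  using iter v_meas w_meas by (auto simp: sa_iterates_def measurable_sets)

lemma space_Hist: "space (Hist k) = space M"
  and sets_Hist: "sets (Hist k) = sigma_sets (space M) ({x 0 -` S \<inter> space M | S. S \<in> sets borel} \<union>
      (\<Union>j<k. {v j -` S \<inter> space M | S. S \<in> sets Nv}) \<union>
      (\<Union>j<k. {w j -` S \<inter> space M | S. S \<in> sets Nw}))"
  using Hist_generators[of k] sets.space_closed[of M] unfolding Hist_def history_def
  by (auto intro!: sets_measure_of space_measure_of)

lemma Hist_subalgebra: "subalgebra M (Hist k)"
  unfolding subalgebra_def space_Hist sets_Hist
  using Hist_generators[of k] sets.sigma_sets_subset by blast

lemma Hist_measurable: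
  assumes "j \<le> k"
  shows "x j \<in> borel_measurable (Hist k)" "s j \<in> borel_measurable (Hist k)"
proof -
  have x0: "x 0 \<in> borel_measurable (Hist k)"
  proof (rule measurableI)
    fix S :: "(real^'d) set" assume "S \<in> sets borel"
    then show "x 0 -` S \<inter> space (Hist k) \<in> sets (Hist k)"
      unfolding space_Hist sets_Hist by (intro sigma_sets.Basic) auto
  qed simp
  have v': "v j \<in> measurable (Hist k) Nv" if "j < k" for j
  proof (rule measurableI)
    fix S assume "S \<in> sets Nv"
    then show "v j -` S \<inter> space (Hist k) \<in> sets (Hist k)"
      unfolding space_Hist sets_Hist using that by (intro sigma_sets.Basic) auto
  qed (use v_meas[of j] in \<open>auto simp: space_Hist measurable_space\<close>)
  have w': "w j \<in> measurable (Hist k) Nw" if "j < k" for j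
  proof (rule measurableI)
    fix S assume "S \<in> sets Nw"
    then show "w j -` S \<inter> space (Hist k) \<in> sets (Hist k)"
      unfolding space_Hist sets_Hist using that by (intro sigma_sets.Basic) auto
  qed (use w_meas[of j] in \<open>auto simp: space_Hist measurable_space\<close>)
  show "x j \<in> borel_measurable (Hist k)" "s j \<in> borel_measurable (Hist k)"
    using iterates_measurable[OF space_Hist x0 v' w' assms] by auto
qed

lemma bn_powr: "\<mu> \<in> {0..3} \<Longrightarrow> integrable M (\<lambda>\<omega>. norm (bn k \<omega>) powr \<mu>)"
  using noise by (auto simp: noise_condition_def bn_def)

lemma bn_cube: "integrable M (\<lambda>\<omega>. norm (bn k \<omega>) ^ 3)"
  using bn_powr[of 3 k] by (simp add: powr_numeral)

lemma bn_L2: "square_integrable (bn k)"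
  using bn_powr[of 2 k] bn_meas[of k] by (simp add: powr_numeral square_integrable_def)

lemma bn_mean: "expectation (\<lambda>\<omega>. a \<bullet> bn k \<omega>) = 0"
proof -
  have "expectation (\<lambda>\<omega>. a \<bullet> bn k \<omega>) = a \<bullet> (\<integral>\<omega>. bn k \<omega> \<partial>M)"
    using square_integrable_integrable[OF bn_L2] by (simp add: inner_commute)
  also have "(\<integral>\<omega>. bn k \<omega> \<partial>M) = 0" using noise by (simp add: noise_condition_def bn_def)
  finally show ?thesis by simp
qed

lemma bn_cov: "expectation (\<lambda>\<omega>. (a \<bullet> bn k \<omega>) * (c \<bullet> bn k \<omega>)) = a \<bullet> (\<Sigma>\<^sub>b *v c)"
proof -
  have "(\<integral>\<omega>. outer (bn k \<omega>) (bn k \<omega>) \<partial>M) = \<Sigma>\<^sub>b" using noise by (simp add: noise_condition_def bn_def)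
  with integral_outer[OF bn_L2, of a k c] show ?thesis by simp
qed

lemma Sigma_pos: "pos_semidef \<Sigma>\<^sub>b"
  unfolding pos_semidef_def
proof (intro conjI allI)
  show "transpose \<Sigma>\<^sub>b = \<Sigma>\<^sub>b"
  proof (rule matrix_eq_inner)
    fix a c
    have "a \<bullet> (transpose \<Sigma>\<^sub>b *v c) = c \<bullet> (\<Sigma>\<^sub>b *v a)"
      by (metis dot_lmul_matrix inner_commute transpose_matrix_vector)
    then show "a \<bullet> (transpose \<Sigma>\<^sub>b *v c) = a \<bullet> (\<Sigma>\<^sub>b *v c)"
      using bn_cov[of a 0 c] bn_cov[of c 0 a] by (simp add: mult.commute)
  qed
  show "0 \<le> a \<bullet> (\<Sigma>\<^sub>b *v a)" for a
    unfolding bn_cov[of a 0 a, symmetric] by (intro Bochner_Integration.integral_nonneg) auto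
qed

text \<open>Integrates the conditional bound; the extended nonnegative conditional expectation
  delivers finiteness along with the estimate. Square integrability of \<open>e k\<close> is a
  premise because both facts are obtained in one induction over \<open>k\<close>. The absolute value
  covers a negative \<open>A\<^sub>1\<close>, which \<open>ennreal\<close> would truncate to
  0.\<close>

lemma An_L2_aux:
  assumes e2: "square_integrable (e k)"
  shows "square_integrable (An k) \<and>
    expectation (\<lambda>\<omega>. (norm (An k \<omega>))\<^sup>2) \<le> \<bar>A\<^sub>1\<bar> * expectation (\<lambda>\<omega>. (norm (e k \<omega>))\<^sup>2)"
proof -
  interpret H: finite_measure_subalgebra M "Hist k"
    by unfold_locales (rule Hist_subalgebra)
  note [measurable] = An_meas[of k]
  have "AE \<omega> in M. nn_cond_exp M (Hist k) (\<lambda>\<omega>. ennreal ((norm (An k \<omega>))\<^sup>2)) \<omega>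
          \<le> ennreal (A\<^sub>1 * (norm (e k \<omega>))\<^sup>2)"
    using noise unfolding noise_condition_def Hist_def An_def e_def by blast
  then have ae: "AE \<omega> in M. 1 * nn_cond_exp M (Hist k) (\<lambda>\<omega>. ennreal ((norm (An k \<omega>))\<^sup>2)) \<omega>
          \<le> ennreal (\<bar>A\<^sub>1\<bar> * (norm (e k \<omega>))\<^sup>2)"
    by (rule eventually_mono)
      (auto elim!: order_trans intro!: ennreal_leI mult_right_mono)
  have "(\<integral>\<^sup>+\<omega>. ennreal ((norm (An k \<omega>))\<^sup>2) \<partial>M)
      = (\<integral>\<^sup>+\<omega>. 1 * nn_cond_exp M (Hist k) (\<lambda>\<omega>. ennreal ((norm (An k \<omega>))\<^sup>2)) \<omega> \<partial>M)"
    by (subst H.nn_cond_exp_intg) auto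
  also have "\<dots> \<le> (\<integral>\<^sup>+\<omega>. ennreal (\<bar>A\<^sub>1\<bar> * (norm (e k \<omega>))\<^sup>2) \<partial>M)"
    by (rule nn_integral_mono_AE[OF ae])
  also have "\<dots> = ennreal (\<integral>\<omega>. \<bar>A\<^sub>1\<bar> * (norm (e k \<omega>))\<^sup>2 \<partial>M)"
    using e2 by (intro nn_integral_eq_integral) auto
  finally have le: "(\<integral>\<^sup>+\<omega>. ennreal ((norm (An k \<omega>))\<^sup>2) \<partial>M) \<le> ennreal (\<bar>A\<^sub>1\<bar> * expectation (\<lambda>\<omega>. (norm (e k \<omega>))\<^sup>2))"
    by simp
  have i: "integrable M (\<lambda>\<omega>. (norm (An k \<omega>))\<^sup>2)"
  proof (rule integrableI_nonneg)
    show "(\<integral>\<^sup>+\<omega>. ennreal ((norm (An k \<omega>))\<^sup>2) \<partial>M) < \<infinity>"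
      using le_less_trans[OF le ennreal_less_top] by simp
  qed auto
  have "ennreal (expectation (\<lambda>\<omega>. (norm (An k \<omega>))\<^sup>2)) \<le> ennreal (\<bar>A\<^sub>1\<bar> * expectation (\<lambda>\<omega>. (norm (e k \<omega>))\<^sup>2))"
    using le nn_integral_eq_integral[OF i] by simp
  then have "expectation (\<lambda>\<omega>. (norm (An k \<omega>))\<^sup>2) \<le> \<bar>A\<^sub>1\<bar> * expectation (\<lambda>\<omega>. (norm (e k \<omega>))\<^sup>2)"
    by (subst (asm) ennreal_le_iff) auto
  with i show ?thesis by (simp add: square_integrable_def)
qed

lemma e_L2: "square_integrable (e k)"
proof (induction k)
  case 0
  have "square_integrable (x 0)" using iter by (simp add: sa_iterates_def square_integrable_def)
  then show ?case unfolding e_def[abs_def] by (intro square_integrable_diff square_integrable_const)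
next
  case (Suc k)
  have "square_integrable (\<lambda>\<omega>. F (xstar + e k \<omega>))"
    using e_meas[of k]
    by (intro square_integrable_bound1[OF Suc _ norm_F] measurable_compose[OF _ F_meas]) measurable
  then have "square_integrable (\<lambda>\<omega>. e k \<omega> + h k *\<^sub>R (F (xstar + e k \<omega>) + (An k \<omega> + bn k \<omega>)))"
    using Suc An_L2_aux[OF Suc] bn_L2[of k]
    by (intro square_integrable_add square_integrable_scaleR) auto
  then show ?case
    by (rule square_integrable_bound1[OF _ e_meas, of _ _ 1]) (simp add: e_step)
qed

lemma An_L2: "square_integrable (An k)"
  and An_second_moment: "expectation (\<lambda>\<omega>. (norm (An k \<omega>))\<^sup>2) \<le> \<bar>A\<^sub>1\<bar> * expectation (\<lambda>\<omega>. (norm (e k \<omega>))\<^sup>2)"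
  using An_L2_aux[OF e_L2] by auto

lemma step_L2:
  assumes "square_integrable X"
  shows "square_integrable (\<lambda>\<omega>. step c (X \<omega>))"
  unfolding step_def
  using assms by (intro square_integrable_add square_integrable_scaleR square_integrable_bound1[OF assms _ norm_J] matrix_vector_measurable) auto

lemma s_L2: "square_integrable (s k)"
proof (induction k)
  case (Suc k)
  then show ?case unfolding s.simps[abs_def]
    by (intro square_integrable_add square_integrable_scaleR step_L2 bn_L2)
qed (simp add: square_integrable_def)

text \<open>The martingale property in integrated form: a factor known from the history can be
  pulled out of the conditional expectation, coordinate by coordinate.\<close>

lemma An_orthogonal:
  assumes Ym: "Y \<in> borel_measurable (Hist k)" and Y: "square_integrable Y"
  shows "expectation (\<lambda>\<omega>. Y \<omega> \<bullet> An k \<omega>) = 0"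
proof -
  interpret H: finite_measure_subalgebra M "Hist k"
    by unfold_locales (rule Hist_subalgebra)
  have comp: "square_integrable (\<lambda>\<omega>. X \<omega> $ i)" if "square_integrable X" for X :: "'m \<Rightarrow> real^'d" and i
    using square_integrable_inner_left[OF that, of "axis i 1"] by (simp add: inner_axis')
  have int: "integrable M (\<lambda>\<omega>. Y \<omega> $ i * An k \<omega> $ i)" for i
    by (intro square_integrable_mult comp Y An_L2)
  have "expectation (\<lambda>\<omega>. Y \<omega> $ i * An k \<omega> $ i) = 0" for i
  proof -
    have "(\<lambda>\<omega>. axis i 1 \<bullet> Y \<omega>) \<in> borel_measurable (Hist k)" using Ym by measurable
    then have Yi: "(\<lambda>\<omega>. Y \<omega> $ i) \<in> borel_measurable (Hist k)" by (simp add: inner_axis')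
    have Ai: "(\<lambda>\<omega>. An k \<omega> $ i) \<in> borel_measurable M" using comp[OF An_L2] by auto
    have "expectation (\<lambda>\<omega>. Y \<omega> $ i * An k \<omega> $ i)
        = expectation (\<lambda>\<omega>. Y \<omega> $ i * real_cond_exp M (Hist k) (\<lambda>\<omega>. An k \<omega> $ i) \<omega>)"
      using H.real_cond_exp_intg(2)[OF int Yi Ai] by simp
    also have "\<dots> = expectation (\<lambda>\<omega>. 0)"
    proof (rule integral_cong_AE)
      have "AE \<omega> in M. real_cond_exp M (Hist k) (\<lambda>\<omega>. An k \<omega> $ i) \<omega> = 0"
        using noise unfolding noise_condition_def Hist_def An_def by blast
      then show "AE \<omega> in M. Y \<omega> $ i * real_cond_exp M (Hist k) (\<lambda>\<omega>. An k \<omega> $ i) \<omega> = 0"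
        by (rule eventually_mono) simp
      show "(\<lambda>\<omega>. Y \<omega> $ i * real_cond_exp M (Hist k) (\<lambda>\<omega>. An k \<omega> $ i) \<omega>) \<in> borel_measurable M"
        using comp[OF Y] by (intro borel_measurable_times) auto
    qed simp
    finally show ?thesis by simp
  qed
  then show ?thesis unfolding inner_vec_def using int by simp
qed

end

section \<open>Second moments of the iterates\<close>

text \<open>The common engine for all moment bounds along moving directions. Since the hypothesis
  holds for every \<open>a\<close>, the induction may replace \<open>a\<close> by
  \<open>f k a\<close>; the best constant relative to \<open>Q\<close> then obeys a scalar
  recursion, to which \<open>recursion_decay\<close> applies.\<close>

lemma form_decay:
  fixes T :: "nat \<Rightarrow> 'a \<Rightarrow> real" and Q :: "'a \<Rightarrow> real"
  assumes T0: "\<And>a. T 0 a \<le> bd * Q a"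
    and rec: "\<And>k a. T (Suc k) a \<le> T k (f k a) + D * (real k + K) powr (- (1 + p)) * Q a"
    and con: "\<And>k a. Q (f k a) \<le> (1 - c / (real k + K)) * Q a"
    and Q: "\<And>a. Q a \<ge> 0" and bd: "bd \<ge> 0"
    and cp: "p \<ge> 0" "c > p" "K \<ge> c" "K > 0" and D: "D \<ge> 0"
  shows "\<exists>C\<ge>0. \<forall>k a. T k a \<le> C * (real k + K) powr (- p) * Q a"
proof -
  define m where "m = rec_nat bd (\<lambda>k y. (1 - c / (real k + K)) * y + D * (real k + K) powr (- (1 + p)))"
  have mS: "m (Suc k) = (1 - c / (real k + K)) * m k + D * (real k + K) powr (- (1 + p))" for k
    by (simp add: m_def)
  have cn: "1 - c / (real k + K) \<ge> 0" for k using cp by (simp add: divide_le_eq)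
  have mp: "m k \<ge> 0" for k
  proof (induction k)
    case (Suc k)
    then show ?case unfolding mS using cn D by (intro add_nonneg_nonneg mult_nonneg_nonneg) auto
  qed (simp add: m_def bd)
  have Tm: "T k a \<le> m k * Q a" for k a
  proof (induction k arbitrary: a)
    case (Suc k)
    have "T (Suc k) a \<le> m k * Q (f k a) + D * (real k + K) powr (- (1 + p)) * Q a"
      using rec[of k a] Suc[of "f k a"] by linarith
    also have "\<dots> \<le> m k * ((1 - c / (real k + K)) * Q a) + D * (real k + K) powr (- (1 + p)) * Q a"
      by (intro add_right_mono mult_left_mono con mp)
    also have "\<dots> = m (Suc k) * Q a" unfolding mS by (simp add: algebra_simps)
    finally show ?case .
  qed (simp add: m_def T0)
  obtain C where C: "C \<ge> 0" "\<And>k. m k \<le> C * (real k + K) powr (- p)"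
    using recursion_decay[of m c K D p] mS cp D by auto
  have "T k a \<le> C * (real k + K) powr (- p) * Q a" for k a
    using order_trans[OF Tm mult_right_mono[OF C(2) Q]] .
  with C show ?thesis by blast
qed

text \<open>The gradient need not be continuous, but each component is a pointwise limit of
  difference quotients of a continuous function.\<close>

lemma GDERIV_measurable:
  fixes \<phi> :: "'a::euclidean_space \<Rightarrow> real"
  assumes d: "\<And>x. GDERIV \<phi> x :> g x"
  shows "g \<in> borel_measurable borel"
proof -
  have fd: "(\<phi> has_derivative (\<lambda>y. y \<bullet> g x)) (at x)" for x using d[of x] by (simp add: gderiv_def)
  have [measurable]: "\<phi> \<in> borel_measurable borel"
    using has_derivative_continuous[OF fd]
    by (intro borel_measurable_continuous_onI continuous_at_imp_continuous_on) auto
  have "(\<lambda>x. g x \<bullet> i) \<in> borel_measurable borel" for i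
  proof (rule borel_measurable_LIMSEQ_real)
    fix x :: 'a
    have "((\<lambda>t. \<phi> (x + t *\<^sub>R i)) has_derivative (\<lambda>t. (t *\<^sub>R i) \<bullet> g x)) (at 0)"
      by (rule has_derivative_compose[of "\<lambda>t. x + t *\<^sub>R i" "\<lambda>t. t *\<^sub>R i" 0 UNIV \<phi>])
        (auto intro!: derivative_eq_intros fd)
    then have "((\<lambda>t. \<phi> (x + t *\<^sub>R i)) has_real_derivative (i \<bullet> g x)) (at 0)"
      by (simp add: has_field_derivative_def mult.commute[of _ "i \<bullet> g x"])
    then have "((\<lambda>t. (\<phi> (x + t *\<^sub>R i) - \<phi> x) / t) \<longlongrightarrow> i \<bullet> g x) (at 0)"
      by (simp add: has_field_derivative_iff)
    moreover have "filterlim (\<lambda>n. inverse (real (Suc n))) (at 0) sequentially"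
      unfolding filterlim_at using LIMSEQ_inverse_real_of_nat by auto
    ultimately have "(\<lambda>n. (\<phi> (x + inverse (real (Suc n)) *\<^sub>R i) - \<phi> x) / inverse (real (Suc n))) \<longlonglongrightarrow> i \<bullet> g x"
      by (rule filterlim_compose)
    then show "(\<lambda>n. (\<phi> (x + inverse (real (Suc n)) *\<^sub>R i) - \<phi> x) / inverse (real (Suc n))) \<longlonglongrightarrow> g x \<bullet> i"
      by (simp add: inner_commute)
  qed measurable
  then show ?thesis by (intro borel_measurable_euclidean_space[THEN iffD2]) blast
qed

section \<open>Lyapunov drift of the nonlinear part\<close>

context stable_operator
begin

lemma grad_meas: "grad \<in> borel_measurable borel"
  using A1 by (intro GDERIV_measurable) (auto simp: lyapunov_condition_def)

lemma Phi_meas: "\<Phi> \<in> borel_measurable borel"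
proof -
  have "isCont \<Phi> x" for x
  proof -
    have "GDERIV \<Phi> x :> grad x" using A1 unfolding lyapunov_condition_def by blast
    then show ?thesis unfolding gderiv_def by (rule has_derivative_continuous)
  qed
  then show ?thesis by (intro borel_measurable_continuous_onI continuous_at_imp_continuous_on) auto
qed

text \<open>Adding \<open>s\<close> to \<open>z\<close> perturbs the drift by \<Delta>, of norm at
  most \<open>B |s|\<close>. Young's inequality with a free \<epsilon> splits the cross term, so
  that its \<open>z\<close> part can be made as small a fraction of \<Phi> as needed. The noise
  \<open>a\<close> enters linearly only through \<open>grad z \<bullet> a\<close>, which will have
  mean 0.\<close>

lemma Phi_drift:
  assumes h: "h > 0" and \<epsilon>: "\<epsilon> > 0"
  defines "B \<equiv> L\<^sub>F + L\<^sub>J"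
  shows "\<Phi> (z + h *\<^sub>R (F (xstar + (z + s)) - J *v s + a))
    \<le> (1 - 2 * \<gamma> * h) * \<Phi> z + h * \<epsilon> * (norm z)\<^sup>2 + h * ((G * B)\<^sup>2 / (4 * \<epsilon>)) * (norm s)\<^sup>2 + h * (grad z \<bullet> a)
      + L / 2 * h\<^sup>2 * (3 * L\<^sub>F\<^sup>2 * (norm z)\<^sup>2 + 3 * B\<^sup>2 * (norm s)\<^sup>2 + 3 * (norm a)\<^sup>2)"
proof -
  let ?W = "F (xstar + (z + s)) - J *v s + a"
  define \<Delta> where "\<Delta> = F (xstar + (z + s)) - F (xstar + z) - J *v s"
  have B: "B > 0" using pos LJ_pos by (simp add: B_def)
  have nD: "norm \<Delta> \<le> B * norm s"
  proof -
    have "norm \<Delta> \<le> norm (F (xstar + (z + s)) - F (xstar + z)) + norm (J *v s)"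
      unfolding \<Delta>_def by (rule norm_triangle_ineq4)
    also have "\<dots> \<le> B * norm s"
      using F_lipschitz'[of "z + s" z] norm_J[of s] by (simp add: B_def algebra_simps)
    finally show ?thesis .
  qed
  have gW: "grad z \<bullet> ?W = grad z \<bullet> F (xstar + z) + grad z \<bullet> \<Delta> + grad z \<bullet> a"
    by (simp add: \<Delta>_def inner_add_right inner_diff_right)
  have "grad z \<bullet> \<Delta> \<le> (G * norm z) * (B * norm s)"
    using cauchy_schwarz_mult[OF norm_grad nD] by (meson abs_le_D1)
  also have "\<dots> \<le> \<epsilon> * (norm z)\<^sup>2 + (G * B)\<^sup>2 / (4 * \<epsilon>) * (norm s)\<^sup>2"
  proof -
    have "0 \<le> (2 * \<epsilon> * norm z - G * B * norm s)\<^sup>2 / (4 * \<epsilon>)" using \<epsilon> by simp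
    also have "\<dots> = \<epsilon> * (norm z)\<^sup>2 + (G * B)\<^sup>2 / (4 * \<epsilon>) * (norm s)\<^sup>2 - (G * norm z) * (B * norm s)"
      using \<epsilon> by (simp add: power2_eq_square field_simps)
    finally show ?thesis by simp
  qed
  finally have "grad z \<bullet> ?W \<le> - 2 * \<gamma> * \<Phi> z + (\<epsilon> * (norm z)\<^sup>2 + (G * B)\<^sup>2 / (4 * \<epsilon>) * (norm s)\<^sup>2) + grad z \<bullet> a"
    unfolding gW using grad_F[of z] by linarith
  then have 1: "h * (grad z \<bullet> ?W) \<le> h * (- 2 * \<gamma> * \<Phi> z + (\<epsilon> * (norm z)\<^sup>2 + (G * B)\<^sup>2 / (4 * \<epsilon>) * (norm s)\<^sup>2) + grad z \<bullet> a)"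
    using h by (intro mult_left_mono) auto
  have "norm ?W \<le> L\<^sub>F * norm z + B * norm s + norm a"
  proof -
    have "norm ?W \<le> norm (F (xstar + (z + s))) + norm (J *v s) + norm a"
      by (meson add_right_mono norm_triangle_ineq norm_triangle_ineq4 order_trans)
    moreover have "norm (F (xstar + (z + s))) \<le> L\<^sub>F * (norm z + norm s)"
      using norm_F[of "z + s"] mult_left_mono[OF norm_triangle_ineq[of z s], of L\<^sub>F] pos by linarith
    ultimately show ?thesis using norm_J[of s] by (simp add: B_def algebra_simps)
  qed
  then have "(norm ?W)\<^sup>2 \<le> (L\<^sub>F * norm z + B * norm s + norm a)\<^sup>2" by (intro power_mono) auto
  also have "\<dots> \<le> 3 * (L\<^sub>F * norm z)\<^sup>2 + 3 * (B * norm s)\<^sup>2 + 3 * (norm a)\<^sup>2"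
    using sum_squares_bound[of "L\<^sub>F * norm z" "B * norm s"] sum_squares_bound[of "L\<^sub>F * norm z" "norm a"]
      sum_squares_bound[of "B * norm s" "norm a"]
    by (simp add: power2_eq_square[of "_ + _ + _"] power2_eq_square algebra_simps)
  finally have 2: "L / 2 * h\<^sup>2 * (norm ?W)\<^sup>2 \<le> L / 2 * h\<^sup>2 * (3 * L\<^sub>F\<^sup>2 * (norm z)\<^sup>2 + 3 * B\<^sup>2 * (norm s)\<^sup>2 + 3 * (norm a)\<^sup>2)"
    using L_pos by (intro mult_left_mono) (auto simp: power_mult_distrib)
  have "\<Phi> (z + h *\<^sub>R ?W) \<le> \<Phi> z + h * (grad z \<bullet> ?W) + L / 2 * h\<^sup>2 * (norm ?W)\<^sup>2"
    using Phi_step[of z "h *\<^sub>R ?W"] by (simp add: power_mult_distrib)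
  also have "\<dots> \<le> \<Phi> z + h * (- 2 * \<gamma> * \<Phi> z + (\<epsilon> * (norm z)\<^sup>2 + (G * B)\<^sup>2 / (4 * \<epsilon>) * (norm s)\<^sup>2) + grad z \<bullet> a)
      + L / 2 * h\<^sup>2 * (3 * L\<^sub>F\<^sup>2 * (norm z)\<^sup>2 + 3 * B\<^sup>2 * (norm s)\<^sup>2 + 3 * (norm a)\<^sup>2)"
    using 1 2 by linarith
  finally show ?thesis by (simp add: algebra_simps)
qed

end

context sa_process
begin

text \<open>For \<open>j < k\<close> this is \<open>h j\<close> times the vector obtained from
  \<open>a\<close> by applying the adjoint steps \<open>k - 1\<close> down to \<open>j + 1\<close>,
  the latest being applied before the earlier ones. It is the weight of the noise
  \<open>bn j\<close> in \<open>a \<bullet> s k\<close>.\<close>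

primrec coef where
  "coef 0 j a = (0 :: real^'d)"
| "coef (Suc k) j a = (if j = k then h k *\<^sub>R a else coef k j (stepT (h k) a))"

lemma s_inner: "a \<bullet> s k \<omega> = (\<Sum>j<k. coef k j a \<bullet> bn j \<omega>)"
proof (induction k arbitrary: a)
  case (Suc k)
  have "a \<bullet> s (Suc k) \<omega> = stepT (h k) a \<bullet> s k \<omega> + (h k *\<^sub>R a) \<bullet> bn k \<omega>"
    by (simp add: inner_add_right step_adjoint)
  then show ?case using Suc by simp
qed simp

lemma bn_indep: "indep_vars (\<lambda>_. borel) (\<lambda>j \<omega>. c j \<bullet> bn j \<omega>) I"
proof -
  have "indep_vars (\<lambda>_. borel) (\<lambda>j \<omega>. c j \<bullet> b (w j \<omega>)) UNIV"
    by (rule indep_vars_compose2[OF w_indep]) (use b_meas in measurable)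
  then show ?thesis unfolding bn_def by (rule indep_vars_subset) simp
qed

definition T where "T k a = expectation (\<lambda>\<omega>. (a \<bullet> s k \<omega>)\<^sup>2)"

lemma T_sum: "T k a = (\<Sum>j<k. coef k j a \<bullet> (\<Sigma>\<^sub>b *v coef k j a))"
proof -
  have l2: "square_integrable (\<lambda>\<omega>. c \<bullet> bn j \<omega>)" for c j by (rule square_integrable_inner_left[OF bn_L2])
  have "T k a = (\<Sum>j<k. expectation (\<lambda>\<omega>. (coef k j a \<bullet> bn j \<omega>)\<^sup>2))"
    unfolding T_def s_inner using l2 square_integrable_integrable[OF l2] bn_mean
    by (intro conjunct2[OF indep_vars_second_moment_sum] bn_indep) (auto simp: square_integrable_real)
  then show ?thesis using bn_cov by (simp add: power2_eq_square)
qed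

lemma T_Suc: "T (Suc k) a = T k (stepT (h k) a) + (h k)\<^sup>2 * (a \<bullet> (\<Sigma>\<^sub>b *v a))"
  unfolding T_sum by (simp add: matrix_vector_mult_scaleR power2_eq_square)

lemma Sigma_bound: "\<exists>C\<ge>0. \<forall>a. a \<bullet> (\<Sigma>\<^sub>b *v a) \<le> C * q a"
proof -
  obtain C where C: "C > 0" "\<And>a. norm (\<Sigma>\<^sub>b *v a) \<le> norm a * C"
    using bounded_linear.pos_bounded[OF matrix_vector_mul_bounded_linear[of \<Sigma>\<^sub>b]] by blast
  have "a \<bullet> (\<Sigma>\<^sub>b *v a) \<le> C / c\<^sub>q * q a" for a
  proof -
    have "a \<bullet> (\<Sigma>\<^sub>b *v a) \<le> norm a * (norm a * C)"
      using cauchy_schwarz_mult[OF order_refl C(2)] by (meson abs_le_D1)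
    also have "\<dots> = C * (norm a)\<^sup>2" by (simp add: power2_eq_square)
    also have "\<dots> \<le> C * (q a / c\<^sub>q)" using C by (intro mult_left_mono norm_le_q) auto
    finally show ?thesis by simp
  qed
  then show ?thesis using C cq_pos by (intro exI[of _ "C / c\<^sub>q"]) auto
qed

lemma powr_n: "(real k + K) powr (- 1) = 1 / (real k + K)" "(real k + K) powr (- (1 + 1)) = 1 / (real k + K)\<^sup>2"
  "(real k + K) powr (- 2) = 1 / (real k + K)\<^sup>2" "(real k + K) powr (- (1 + 2)) = 1 / (real k + K) ^ 3"
  using n_ge[of k] by (simp_all add: powr_minus_divide powr_numeral)

lemma q_step: "q (stepT (h k) a) \<le> (1 - 7 / (real k + K)) * q a"
  using q_contract[OF h_pos h_small, of k a] alpha_pos by (simp add: h_def)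

lemma T_bound: "\<exists>C\<ge>0. \<forall>k a. T k a \<le> C * (1 / (real k + K)) * q a"
proof -
  obtain C where C: "C \<ge> 0" "\<And>a. a \<bullet> (\<Sigma>\<^sub>b *v a) \<le> C * q a" using Sigma_bound by blast
  have "\<exists>C\<ge>0. \<forall>k a. T k a \<le> C * (real k + K) powr (- 1) * q a"
  proof (rule form_decay[where bd = 0 and c = 7 and f = "\<lambda>k. stepT (h k)" and D = "\<alpha>\<^sup>2 * C"])
    fix k a
    have "(h k)\<^sup>2 * (a \<bullet> (\<Sigma>\<^sub>b *v a)) \<le> (h k)\<^sup>2 * (C * q a)" by (intro mult_left_mono C) auto
    then show "T (Suc k) a \<le> T k (stepT (h k) a) + \<alpha>\<^sup>2 * C * (real k + K) powr (- (1 + 1)) * q a"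
      unfolding T_Suc powr_n h_def by (simp add: power_divide)
  qed (use q_step q_nonneg K_ge(1) C in \<open>auto simp: T_def\<close>)
  then show ?thesis unfolding powr_n .
qed

text \<open>One bound for all \<open>j\<close>: the newest coefficient has size of order
  \<open>1 / n\<close>, and older ones shrink in \<open>q\<close> at rate \<open>7 / n\<close>,
  faster than \<open>1 / n^2\<close> decays. The largest coefficient is what the third-moment sum in
  Stein's bound is measured by.\<close>

lemma coef_bound:
  assumes "j < k"
  shows "q (coef k j a) \<le> 4 * \<alpha>\<^sup>2 / (real k + K)\<^sup>2 * q a"
  using assms
proof (induction k arbitrary: a)
  case (Suc k)
  define n where "n = real k + K"
  have n: "n \<ge> 7" "n > 0" using n_ge by (auto simp: n_def)
  have Sn: "real (Suc k) + K = n + 1" by (simp add: n_def)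
  show ?case
  proof (cases "j = k")
    case True
    \<comment> \<open>Source of the factor 4: the newest coefficient is computed with step
      \<open>\<alpha> / n\<close>, while the bound at time \<open>Suc k\<close> is in terms of
      \<open>n + 1\<close>.\<close>
    have "(n + 1)\<^sup>2 \<le> (2 * n)\<^sup>2" using n by (intro power_mono) auto
    then have "\<alpha>\<^sup>2 / n\<^sup>2 \<le> 4 * \<alpha>\<^sup>2 / (n + 1)\<^sup>2"
      using n mult_left_mono[of "(n + 1)\<^sup>2" "(2 * n)\<^sup>2" "\<alpha>\<^sup>2"] by (simp add: field_simps)
    then have "\<alpha>\<^sup>2 / n\<^sup>2 * q a \<le> 4 * \<alpha>\<^sup>2 / (n + 1)\<^sup>2 * q a" by (intro mult_right_mono q_nonneg)
    then show ?thesis using True unfolding Sn by (simp add: q_scaleR h_def power_divide n_def)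
  next
    case False
    then have jk: "j < k" using Suc by simp
    have "q (coef (Suc k) j a) = q (coef k j (stepT (h k) a))" using False by simp
    also have "\<dots> \<le> 4 * \<alpha>\<^sup>2 / n\<^sup>2 * q (stepT (h k) a)" using Suc.IH[OF jk] by (simp add: n_def)
    also have "\<dots> \<le> 4 * \<alpha>\<^sup>2 / n\<^sup>2 * ((1 - 7 / n) * q a)"
      using q_step[of k a] by (intro mult_left_mono) (auto simp: n_def)
    also have "\<dots> = 4 * \<alpha>\<^sup>2 * q a * ((n - 7) / n ^ 3)" using n by (simp add: field_simps power2_eq_square power3_eq_cube)
    also have "\<dots> \<le> 4 * \<alpha>\<^sup>2 * q a * (1 / (n + 1)\<^sup>2)"
    proof (intro mult_left_mono)
      have "(n - 7) * (n + 1)\<^sup>2 \<le> n ^ 3" using n by (simp add: power2_eq_square power3_eq_cube algebra_simps)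
      then show "(n - 7) / n ^ 3 \<le> 1 / (n + 1)\<^sup>2" using n by (simp add: field_simps)
    qed (use q_nonneg in auto)
    finally show ?thesis unfolding Sn by simp
  qed
qed simp

definition z where "z k \<omega> = e k \<omega> - s k \<omega>"

lemma z_L2: "square_integrable (z k)"
  unfolding z_def by (intro square_integrable_diff e_L2 s_L2)

lemma z_step:
  assumes "\<omega> \<in> space M"
  shows "z (Suc k) \<omega> = z k \<omega> + h k *\<^sub>R (F (xstar + (z k \<omega> + s k \<omega>)) - J *v s k \<omega> + An k \<omega>)"
  using e_step[OF assms, of k] by (simp add: z_def step_def algebra_simps)

lemma e_Hist: "j \<le> k \<Longrightarrow> e j \<in> borel_measurable (Hist k)"
  unfolding e_def[abs_def] using Hist_measurable(1)[of j k] by measurable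

lemma z_Hist: "z k \<in> borel_measurable (Hist k)"
  unfolding z_def[abs_def] using e_Hist[of k k] Hist_measurable(2)[of k k] by measurable

lemma s_second_moment: "\<exists>C\<ge>0. \<forall>k. expectation (\<lambda>\<omega>. (norm (s k \<omega>))\<^sup>2) \<le> C * (1 / (real k + K))"
proof -
  obtain C where C: "C \<ge> 0" "\<And>k a. T k a \<le> C * (1 / (real k + K)) * q a" using T_bound by blast
  let ?C = "C * (\<Sum>i\<in>UNIV. q (axis i 1))"
  have "expectation (\<lambda>\<omega>. (norm (s k \<omega>))\<^sup>2) \<le> ?C * (1 / (real k + K))" for k
  proof -
    have i: "integrable M (\<lambda>\<omega>. (axis i 1 \<bullet> s k \<omega>)\<^sup>2)" for i
      using square_integrable_inner_left[OF s_L2, of "axis i 1" k] by (simp add: square_integrable_real)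
    have "(norm y)\<^sup>2 = (\<Sum>i\<in>UNIV. (axis i 1 \<bullet> y)\<^sup>2)" for y :: "real^'d"
      unfolding power2_norm_eq_inner inner_vec_def[of y y] by (simp add: inner_axis' power2_eq_square)
    then have "expectation (\<lambda>\<omega>. (norm (s k \<omega>))\<^sup>2) = (\<Sum>i\<in>UNIV. T k (axis i 1))"
      unfolding T_def using i by simp
    also have "\<dots> \<le> (\<Sum>i\<in>UNIV. C * (1 / (real k + K)) * q (axis i 1))" by (intro sum_mono C)
    finally show ?thesis by (simp add: sum_distrib_left mult_ac)
  qed
  moreover have "?C \<ge> 0" using C q_nonneg by (intro mult_nonneg_nonneg sum_nonneg) auto
  ultimately show ?thesis by blast
qed

lemma Phi_integrable: "integrable M (\<lambda>\<omega>. \<Phi> (z k \<omega>))"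
proof (rule Bochner_Integration.integrable_bound)
  show "integrable M (\<lambda>\<omega>. (norm (z k \<omega>))\<^sup>2 / l)"
    by (intro integrable_divide square_integrableD z_L2)
  show "(\<lambda>\<omega>. \<Phi> (z k \<omega>)) \<in> borel_measurable M"
    using measurable_compose[OF _ Phi_meas] z_L2 by auto
  show "AE \<omega> in M. norm (\<Phi> (z k \<omega>)) \<le> norm ((norm (z k \<omega>))\<^sup>2 / l)"
    using Phi_upper Phi_nonneg pos by (auto simp: field_simps)
qed

text \<open>Bookkeeping of rates: the drift \<open>2 \<gamma> \<alpha>\<close> exceeds
  \<open>4 / 3\<close>, the Young term and the second-order term cost \<open>1 / 12\<close> each,
  and the remaining \<open>7 / 6\<close> still exceeds the exponent 1. The recursion of
  \<open>z\<close> contains no \<open>b\<close>, so the only first-order noise term is that of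
  \<open>An\<close>.\<close>

lemma Phi_bound: "\<exists>C\<ge>0. \<forall>k. expectation (\<lambda>\<omega>. \<Phi> (z k \<omega>)) \<le> C * (1 / (real k + K))"
proof -
  obtain C where C: "C \<ge> 0" "\<And>k. expectation (\<lambda>\<omega>. (norm (s k \<omega>))\<^sup>2) \<le> C * (1 / (real k + K))"
    using s_second_moment by blast
  define B where "B = L\<^sub>F + L\<^sub>J"
  \<comment> \<open>Chosen so that \<open>h k * \<epsilon> * u = 1 / (12 n)\<close>; the factor
    \<open>u\<close> arises on bounding the squared norm by \<Phi>.\<close>
  define \<epsilon> where "\<epsilon> = 1 / (12 * u * \<alpha>)"
  have ep: "\<epsilon> > 0" using pos alpha_pos by (simp add: \<epsilon>_def)
  define c1 where "c1 = (G * B)\<^sup>2 / (4 * \<epsilon>)"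
  have c1: "c1 \<ge> 0" using ep by (simp add: c1_def)
  define c2 where "c2 = L / 2 * (3 * L\<^sub>F\<^sup>2 + 6 * \<bar>A\<^sub>1\<bar>)"
  define c3 where "c3 = L / 2 * (3 * B\<^sup>2 + 6 * \<bar>A\<^sub>1\<bar>)"
  have c23: "c2 \<ge> 0" "c3 \<ge> 0" using L_pos by (auto simp: c2_def c3_def)
  define D where "D = C * (\<alpha> * c1 + \<alpha>\<^sup>2 * c3)"
  have D: "D \<ge> 0" unfolding D_def using C c1 c23 alpha_pos by simp
  have "expectation (\<lambda>\<omega>. \<Phi> (z (Suc k) \<omega>))
      \<le> (1 - 7 / 6 / (real k + K)) * expectation (\<lambda>\<omega>. \<Phi> (z k \<omega>)) + D * (real k + K) powr (- (1 + 1))" for k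
  proof -
    define n where "n = real k + K"
    have n: "n \<ge> 7" "n > 0" using n_ge by (auto simp: n_def)
    have hn: "h k = \<alpha> / n" by (simp add: h_def n_def)
    let ?Z = "\<lambda>\<omega>. (norm (z k \<omega>))\<^sup>2" and ?S = "\<lambda>\<omega>. (norm (s k \<omega>))\<^sup>2" and ?A = "\<lambda>\<omega>. (norm (An k \<omega>))\<^sup>2"
    let ?g = "\<lambda>\<omega>. grad (z k \<omega>) \<bullet> An k \<omega>"
    have iZ: "integrable M ?Z" and iS: "integrable M ?S" and iA: "integrable M ?A"
      using z_L2 s_L2 An_L2 by auto
    have gm: "(\<lambda>\<omega>. grad (z k \<omega>)) \<in> borel_measurable (Hist k)"
      by (rule measurable_compose[OF z_Hist grad_meas])
    have gL2: "square_integrable (\<lambda>\<omega>. grad (z k \<omega>))"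
      by (rule square_integrable_bound1[OF z_L2 _ norm_grad]) (use measurable_compose[OF _ grad_meas] z_L2 in auto)
    have ig: "integrable M ?g" by (intro square_integrable_inner gL2 An_L2)
    \<comment> \<open>Both \<open>e k\<close> and \<open>s k\<close> are known at time
      \<open>k\<close>, hence so is the gradient at \<open>z k\<close>.\<close>
    have g0: "expectation ?g = 0" by (rule An_orthogonal[OF gm gL2])
    have eA: "expectation ?A \<le> \<bar>A\<^sub>1\<bar> * (2 * expectation ?Z + 2 * expectation ?S)"
    proof -
      have "expectation (\<lambda>\<omega>. (norm (e k \<omega>))\<^sup>2) \<le> expectation (\<lambda>\<omega>. 2 * ?Z \<omega> + 2 * ?S \<omega>)"
      proof (intro integral_mono)
        fix \<omega>
        have "(norm (e k \<omega>))\<^sup>2 \<le> (norm (z k \<omega>) + norm (s k \<omega>))\<^sup>2"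
          using norm_triangle_ineq[of "z k \<omega>" "s k \<omega>"] by (intro power_mono) (auto simp: z_def)
        also have "\<dots> \<le> 2 * ?Z \<omega> + 2 * ?S \<omega>"
          using sum_squares_bound[of "norm (z k \<omega>)" "norm (s k \<omega>)"] by (simp add: power2_sum)
        finally show "(norm (e k \<omega>))\<^sup>2 \<le> 2 * ?Z \<omega> + 2 * ?S \<omega>" .
      qed (use iZ iS e_L2 in auto)
      then have "\<bar>A\<^sub>1\<bar> * expectation (\<lambda>\<omega>. (norm (e k \<omega>))\<^sup>2) \<le> \<bar>A\<^sub>1\<bar> * (2 * expectation ?Z + 2 * expectation ?S)"
        using iZ iS by (intro mult_left_mono) auto
      with An_second_moment[of k] show ?thesis by linarith
    qed
    have "expectation (\<lambda>\<omega>. \<Phi> (z (Suc k) \<omega>)) \<le> expectation (\<lambda>\<omega>. (1 - 2 * \<gamma> * h k) * \<Phi> (z k \<omega>)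
        + h k * \<epsilon> * ?Z \<omega> + h k * c1 * ?S \<omega> + h k * ?g \<omega>
        + L / 2 * (h k)\<^sup>2 * (3 * L\<^sub>F\<^sup>2 * ?Z \<omega> + 3 * B\<^sup>2 * ?S \<omega> + 3 * ?A \<omega>))"
    proof (intro integral_mono)
      fix \<omega> assume om: "\<omega> \<in> space M"
      show "\<Phi> (z (Suc k) \<omega>) \<le> (1 - 2 * \<gamma> * h k) * \<Phi> (z k \<omega>)
        + h k * \<epsilon> * ?Z \<omega> + h k * c1 * ?S \<omega> + h k * ?g \<omega>
        + L / 2 * (h k)\<^sup>2 * (3 * L\<^sub>F\<^sup>2 * ?Z \<omega> + 3 * B\<^sup>2 * ?S \<omega> + 3 * ?A \<omega>)"
        unfolding z_step[OF om] c1_def B_def by (rule Phi_drift[OF h_pos ep])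
    qed (intro Phi_integrable, intro Bochner_Integration.integrable_add integrable_mult_right Phi_integrable iZ iS iA ig)
    also have "\<dots> = (1 - 2 * \<gamma> * h k) * expectation (\<lambda>\<omega>. \<Phi> (z k \<omega>))
        + h k * \<epsilon> * expectation ?Z + h k * c1 * expectation ?S
        + L / 2 * (h k)\<^sup>2 * (3 * L\<^sub>F\<^sup>2 * expectation ?Z + 3 * B\<^sup>2 * expectation ?S + 3 * expectation ?A)"
      using Phi_integrable iZ iS iA ig by (simp add: g0)
    also have "\<dots> \<le> (1 - 2 * \<gamma> * h k) * expectation (\<lambda>\<omega>. \<Phi> (z k \<omega>))
        + h k * \<epsilon> * expectation ?Z + h k * c1 * expectation ?S
        + L / 2 * (h k)\<^sup>2 * (3 * L\<^sub>F\<^sup>2 * expectation ?Z + 3 * B\<^sup>2 * expectation ?S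
           + 3 * (\<bar>A\<^sub>1\<bar> * (2 * expectation ?Z + 2 * expectation ?S)))"
      using eA L_pos by (intro add_left_mono mult_left_mono) auto
    also have "\<dots> = (1 - 2 * \<gamma> * h k) * expectation (\<lambda>\<omega>. \<Phi> (z k \<omega>))
        + (h k * \<epsilon> + c2 * (h k)\<^sup>2) * expectation ?Z + (h k * c1 + c3 * (h k)\<^sup>2) * expectation ?S"
      by (simp add: c2_def c3_def algebra_simps)
    also have "\<dots> \<le> (1 - 2 * \<gamma> * h k) * expectation (\<lambda>\<omega>. \<Phi> (z k \<omega>))
        + (h k * \<epsilon> + c2 * (h k)\<^sup>2) * (u * expectation (\<lambda>\<omega>. \<Phi> (z k \<omega>))) + (h k * c1 + c3 * (h k)\<^sup>2) * (C * (1 / n))"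
    proof -
      have "expectation ?Z \<le> expectation (\<lambda>\<omega>. u * \<Phi> (z k \<omega>))"
        by (intro integral_mono iZ integrable_mult_right Phi_integrable Phi_lower)
      then have "expectation ?Z \<le> u * expectation (\<lambda>\<omega>. \<Phi> (z k \<omega>))" by simp
      then have "(h k * \<epsilon> + c2 * (h k)\<^sup>2) * expectation ?Z
          \<le> (h k * \<epsilon> + c2 * (h k)\<^sup>2) * (u * expectation (\<lambda>\<omega>. \<Phi> (z k \<omega>)))"
        using h_pos[of k] ep c23 by (intro mult_left_mono) auto
      moreover have "expectation ?S \<le> C * (1 / n)" using C(2)[of k] by (simp add: n_def)
      then have "(h k * c1 + c3 * (h k)\<^sup>2) * expectation ?S \<le> (h k * c1 + c3 * (h k)\<^sup>2) * (C * (1 / n))"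
        using h_pos[of k] c1 c23 by (intro mult_left_mono) auto
      ultimately show ?thesis by linarith
    qed
    also have "\<dots> = (1 - 2 * \<gamma> * h k + h k * \<epsilon> * u + c2 * u * (h k)\<^sup>2) * expectation (\<lambda>\<omega>. \<Phi> (z k \<omega>))
        + (h k * c1 + c3 * (h k)\<^sup>2) * (C * (1 / n))" by (simp add: algebra_simps)
    also have "\<dots> \<le> (1 - 7 / 6 / n) * expectation (\<lambda>\<omega>. \<Phi> (z k \<omega>)) + D * (1 / n\<^sup>2)"
    proof (intro add_mono mult_right_mono)
      have "h k * \<epsilon> * u = 1 / (12 * n)" using pos alpha_pos n by (simp add: hn \<epsilon>_def)
      moreover have "2 * \<gamma> * h k \<ge> 4 / 3 / n"
      proof -
        have "4 / 3 \<le> 2 * (\<gamma> * \<alpha>)" using gamma by linarith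
        then have "4 / 3 / n \<le> (2 * (\<gamma> * \<alpha>)) / n" by (rule divide_right_mono) (use n in simp)
        then show ?thesis by (simp add: hn)
      qed
      moreover have "c2 * u * (h k)\<^sup>2 \<le> 1 / (12 * n)"
      proof -
        have "12 * (c2 * u * \<alpha>\<^sup>2) \<le> n" 
        proof -
          have "12 * (c2 * u * \<alpha>\<^sup>2) \<le> K" using K_ge(3) unfolding c2_def by (simp only: mult_ac)
          then show ?thesis by (simp add: n_def add_increasing)
        qed
        then have "12 * (c2 * u * \<alpha>\<^sup>2) * (1 / n\<^sup>2) \<le> n * (1 / n\<^sup>2)" by (intro mult_right_mono) auto
        then show ?thesis using n by (simp add: hn power_divide power2_eq_square)
      qed
      ultimately show "1 - 2 * \<gamma> * h k + h k * \<epsilon> * u + c2 * u * (h k)\<^sup>2 \<le> 1 - 7 / 6 / n" by simp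
      show "expectation (\<lambda>\<omega>. \<Phi> (z k \<omega>)) \<ge> 0" by (intro Bochner_Integration.integral_nonneg Phi_nonneg)
      have "h k * c1 + c3 * (h k)\<^sup>2 \<le> (\<alpha> * c1 + \<alpha>\<^sup>2 * c3) * (1 / n)"
      proof -
        have "c3 * (h k)\<^sup>2 = \<alpha>\<^sup>2 * c3 * (1 / n) * (1 / n)" by (simp add: hn power2_eq_square)
        also have "\<dots> \<le> \<alpha>\<^sup>2 * c3 * (1 / n) * 1" using n c23 by (intro mult_left_mono) auto
        finally show ?thesis by (simp add: hn algebra_simps)
      qed
      then have "(h k * c1 + c3 * (h k)\<^sup>2) * (C * (1 / n)) \<le> (\<alpha> * c1 + \<alpha>\<^sup>2 * c3) * (1 / n) * (C * (1 / n))"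
        using C n by (intro mult_right_mono) auto
      then show "(h k * c1 + c3 * (h k)\<^sup>2) * (C * (1 / n)) \<le> D * (1 / n\<^sup>2)"
        by (simp add: D_def power2_eq_square mult_ac)
    qed
    finally show ?thesis unfolding powr_n by (simp add: n_def)
  qed
  from recursion_decay[OF this] D K_ge(1) show ?thesis unfolding powr_n by simp
qed

lemma e_second_moment: "\<exists>C\<ge>0. \<forall>k. expectation (\<lambda>\<omega>. (norm (e k \<omega>))\<^sup>2) \<le> C * (1 / (real k + K))"
proof -
  obtain C where C: "C \<ge> 0" "\<And>k. expectation (\<lambda>\<omega>. (norm (s k \<omega>))\<^sup>2) \<le> C * (1 / (real k + K))"
    using s_second_moment by blast
  obtain C' where C': "C' \<ge> 0" "\<And>k. expectation (\<lambda>\<omega>. \<Phi> (z k \<omega>)) \<le> C' * (1 / (real k + K))"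
    using Phi_bound by blast
  have "expectation (\<lambda>\<omega>. (norm (e k \<omega>))\<^sup>2) \<le> (2 * u * C' + 2 * C) * (1 / (real k + K))" for k
  proof -
    have "expectation (\<lambda>\<omega>. (norm (e k \<omega>))\<^sup>2) \<le> expectation (\<lambda>\<omega>. 2 * (u * \<Phi> (z k \<omega>)) + 2 * (norm (s k \<omega>))\<^sup>2)"
    proof (intro integral_mono)
      fix \<omega>
      have "(norm (e k \<omega>))\<^sup>2 \<le> (norm (z k \<omega>) + norm (s k \<omega>))\<^sup>2"
        using norm_triangle_ineq[of "z k \<omega>" "s k \<omega>"] by (intro power_mono) (auto simp: z_def)
      also have "\<dots> \<le> 2 * (norm (z k \<omega>))\<^sup>2 + 2 * (norm (s k \<omega>))\<^sup>2"
        using sum_squares_bound[of "norm (z k \<omega>)" "norm (s k \<omega>)"] by (simp add: power2_sum)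
      finally show "(norm (e k \<omega>))\<^sup>2 \<le> 2 * (u * \<Phi> (z k \<omega>)) + 2 * (norm (s k \<omega>))\<^sup>2"
        using Phi_lower[of "z k \<omega>"] by linarith
    qed (intro square_integrableD e_L2, intro Bochner_Integration.integrable_add integrable_mult_right
        square_integrableD s_L2 Phi_integrable)
    also have "\<dots> = 2 * u * expectation (\<lambda>\<omega>. \<Phi> (z k \<omega>)) + 2 * expectation (\<lambda>\<omega>. (norm (s k \<omega>))\<^sup>2)"
      using s_L2[of k] Phi_integrable[of k] by (simp add: square_integrable_def)
    also have "\<dots> \<le> 2 * u * (C' * (1 / (real k + K))) + 2 * (C * (1 / (real k + K)))"
      using pos by (intro add_mono mult_left_mono C C') auto
    finally show ?thesis by (simp add: algebra_simps)
  qed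
  moreover have "2 * u * C' + 2 * C \<ge> 0" using pos C C' by simp
  ultimately show ?thesis by blast
qed

end

section \<open>Linearisation error and covariance\<close>

text \<open>With \<open>y = sqrt n * t\<close> this is \<open>y^p \<le> 1 + y^2\<close>. Taking
  \<open>p = 1 + \<delta>\<close>, a second moment of order \<open>1 / n\<close> controls the moment
  of order \<open>1 + \<delta>\<close> at the scale \<open>n^(-(1+\<delta>)/2)\<close>.\<close>

lemma powr_le_quadratic:
  fixes n t p :: real
  assumes n: "n > 0" and t: "t \<ge> 0" and p: "0 \<le> p" "p \<le> 2"
  shows "t powr p \<le> n powr (- (p / 2)) * (1 + n * t\<^sup>2)"
proof -
  define y where "y = sqrt n * t"
  have y: "y \<ge> 0" using n t by (simp add: y_def)
  have "y powr p \<le> 1 + y\<^sup>2"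
  proof (cases "y \<le> 1")
    case True
    then have "y powr p \<le> 1" using y p by (intro powr_le1) auto
    then show ?thesis by (simp add: add_increasing2)
  next
    case False
    then have "y powr p \<le> y powr 2" using p by (intro powr_mono) auto
    then show ?thesis using y by (simp add: powr_numeral)
  qed
  moreover have "y powr p = n powr (p / 2) * t powr p"
    using n t by (simp add: y_def powr_mult powr_half_sqrt[symmetric] powr_powr)
  moreover have "y\<^sup>2 = n * t\<^sup>2" using n by (simp add: y_def power_mult_distrib)
  ultimately have "n powr (- (p / 2)) * (n powr (p / 2) * t powr p) \<le> n powr (- (p / 2)) * (1 + n * t\<^sup>2)"
    by (intro mult_left_mono) auto
  moreover have "n powr (- (p / 2)) * (n powr (p / 2) * t powr p) = t powr p"
    using n by (simp add: powr_minus)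
  ultimately show ?thesis by simp
qed

context sa_process
begin

lemma norm_Rem_le: "norm (Rem y) \<le> (L\<^sub>F + L\<^sub>J) * norm y"
proof -
  have "norm (Rem y) \<le> norm (F (xstar + y)) + norm (J *v y)"
    unfolding Rem_def by (rule norm_triangle_ineq4)
  then show ?thesis using norm_F[of y] norm_J[of y] by (simp add: algebra_simps)
qed

lemma Rem_meas: "Rem \<in> borel_measurable borel"
  unfolding Rem_def[abs_def]
  by (intro borel_measurable_diff measurable_compose[OF _ F_meas] matrix_vector_measurable) measurable

lemma Rem_L2: "square_integrable (\<lambda>\<omega>. Rem (e k \<omega>))"
  by (rule square_integrable_bound1[OF e_L2 measurable_compose[OF e_meas Rem_meas] norm_Rem_le])

lemma Rem_moment:
  "\<exists>C\<ge>0. \<forall>k. expectation (\<lambda>\<omega>. norm (Rem (e k \<omega>))) \<le> C * (real k + K) powr (- ((1 + \<delta>) / 2))"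
proof -
  obtain C where C: "C > 0" "\<And>y. norm (Rem y) \<le> C * norm y powr (1 + \<delta>)"
    using norm_Rem by blast
  obtain C' where C': "C' \<ge> 0" "\<And>k. expectation (\<lambda>\<omega>. (norm (e k \<omega>))\<^sup>2) \<le> C' * (1 / (real k + K))"
    using e_second_moment by blast
  have "expectation (\<lambda>\<omega>. norm (Rem (e k \<omega>))) \<le> C * (1 + C') * (real k + K) powr (- ((1 + \<delta>) / 2))" for k
  proof -
    define n where "n = real k + K"
    have n: "n > 0" using n_ge by (simp add: n_def)
    let ?p = "n powr (- ((1 + \<delta>) / 2))"
    have "expectation (\<lambda>\<omega>. norm (Rem (e k \<omega>))) \<le> expectation (\<lambda>\<omega>. C * ?p * (1 + n * (norm (e k \<omega>))\<^sup>2))"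
    proof (intro integral_mono)
      fix \<omega>
      have "norm (Rem (e k \<omega>)) \<le> C * norm (e k \<omega>) powr (1 + \<delta>)" by (rule C)
      also have "\<dots> \<le> C * (?p * (1 + n * (norm (e k \<omega>))\<^sup>2))"
        using n pos C by (intro mult_left_mono powr_le_quadratic) auto
      finally show "norm (Rem (e k \<omega>)) \<le> C * ?p * (1 + n * (norm (e k \<omega>))\<^sup>2)" by simp
    qed (use square_integrable_integrable[OF Rem_L2] square_integrableD(2)[OF e_L2] in auto)
    also have "\<dots> = C * ?p * (1 + n * expectation (\<lambda>\<omega>. (norm (e k \<omega>))\<^sup>2))"
      using square_integrableD(2)[OF e_L2, of k] by (simp add: prob_space)
    also have "\<dots> \<le> C * ?p * (1 + n * (C' * (1 / n)))"
      using C n C'(2)[of k] by (intro mult_left_mono add_left_mono) (auto simp: n_def)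
    finally show ?thesis using n by (simp add: n_def mult_ac)
  qed
  moreover have "C * (1 + C') \<ge> 0" using C C' by simp
  ultimately show ?thesis by blast
qed

text \<open>The part \<open>zR\<close> does not involve the current martingale noise, so \<open>zA\<close> is measurable with respect to
  the history; its own recursion is \<open>zA_Suc\<close> below.\<close>

primrec zR where
  "zR 0 \<omega> = e 0 \<omega>"
| "zR (Suc k) \<omega> = step (h k) (zR k \<omega>) + h k *\<^sub>R Rem (e k \<omega>)"

definition zA where "zA k \<omega> = z k \<omega> - zR k \<omega>"

lemma zR_L2: "square_integrable (zR k)"
proof (induction k)
  case 0
  show ?case unfolding zR.simps[abs_def] using e_L2[of 0] by simp
next
  case (Suc k)
  then show ?case unfolding zR.simps[abs_def]
    by (intro square_integrable_add square_integrable_scaleR step_L2 Rem_L2)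
qed

lemma zA_L2: "square_integrable (zA k)"
  unfolding zA_def[abs_def] by (intro square_integrable_diff z_L2 zR_L2)

lemma zA_0: "zA 0 \<omega> = 0" by (simp add: zA_def z_def)

lemma zA_Suc:
  assumes "\<omega> \<in> space M"
  shows "zA (Suc k) \<omega> = step (h k) (zA k \<omega>) + h k *\<^sub>R An k \<omega>"
proof -
  have e: "z k \<omega> + s k \<omega> = e k \<omega>" by (simp add: z_def)
  have "F (xstar + e k \<omega>) = Rem (e k \<omega>) + J *v z k \<omega> + J *v s k \<omega>"
    by (simp add: Rem_def z_def matrix_vector_mult_diff_distrib)
  then show ?thesis unfolding zA_def z_step[OF assms] e zR.simps step_def
    by (simp add: matrix_vector_mult_diff_distrib algebra_simps)
qed

lemma zA_Hist: "zA k \<in> borel_measurable (Hist k)"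
proof -
  have "zR j \<in> borel_measurable (Hist k)" if "j \<le> k" for j
    using that
  proof (induction j)
    case 0
    show ?case unfolding zR.simps[abs_def] using e_Hist[of 0 k] by simp
  next
    case (Suc j)
    then have [measurable]: "zR j \<in> borel_measurable (Hist k)" by simp
    have [measurable]: "(\<lambda>\<omega>. Rem (e j \<omega>)) \<in> borel_measurable (Hist k)"
      using Suc by (intro measurable_compose[OF e_Hist Rem_meas]) auto
    show ?case unfolding zR.simps[abs_def] step_def by measurable
  qed
  then show ?thesis unfolding zA_def[abs_def] by (intro borel_measurable_diff z_Hist) auto
qed

text \<open>First moments are homogeneous of degree one in \<open>a\<close>, so their yardstick is
  the root of \<open>q\<close>, at half the rate. The rate \<open>7 / 2\<close> still exceeds the
  exponent \<open>(1 + \<delta>) / 2 \<le> 1\<close>.\<close>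

lemma sqrt_q_step: "sqrt (q (stepT (h k) a)) \<le> (1 - 7 / 2 / (real k + K)) * sqrt (q a)"
proof (rule real_le_lsqrt)
  define n where "n = real k + K"
  have n: "n \<ge> 7" using n_ge by (simp add: n_def)
  show "0 \<le> (1 - 7 / 2 / (real k + K)) * sqrt (q a)"
    using n q_nonneg[of a] by (intro mult_nonneg_nonneg) (auto simp: n_def field_simps)
  have "1 - 7 / n \<le> (1 - 7 / 2 / n)\<^sup>2" using n by (simp add: power2_eq_square field_simps)
  then have "(1 - 7 / n) * q a \<le> (1 - 7 / 2 / n)\<^sup>2 * q a" by (rule mult_right_mono) (rule q_nonneg)
  then show "q (stepT (h k) a) \<le> ((1 - 7 / 2 / (real k + K)) * sqrt (q a))\<^sup>2"
    using q_step[of k a] q_nonneg[of a] by (simp add: power_mult_distrib n_def)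
qed

lemma norm_le_sqrt_q: "norm a \<le> sqrt (q a) / sqrt c\<^sub>q"
  using real_sqrt_le_mono[OF norm_le_q[of a]] by (simp add: real_sqrt_divide)

text \<open>An L1 estimate, because the second moment of \<open>e\<close> controls the remainder,
  which is of order \<open>1 + \<delta>\<close>, at this scale only in mean. The triangle inequality
  suffices: the forcing \<open>h k * Rem\<close> is of order
  \<open>n^(-1-(1+\<delta>)/2)\<close>.\<close>

lemma zR_bound: "\<exists>C\<ge>0. \<forall>k a. expectation (\<lambda>\<omega>. \<bar>a \<bullet> zR k \<omega>\<bar>) \<le> C * (real k + K) powr (- ((1 + \<delta>) / 2)) * sqrt (q a)"
proof -
  obtain C where C: "C \<ge> 0"
    "\<And>k. expectation (\<lambda>\<omega>. norm (Rem (e k \<omega>))) \<le> C * (real k + K) powr (- ((1 + \<delta>) / 2))"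
    using Rem_moment by blast
  define m where "m = expectation (\<lambda>\<omega>. norm (e 0 \<omega>))"
  have m: "m \<ge> 0" unfolding m_def by (intro Bochner_Integration.integral_nonneg) auto
  have ab: "expectation (\<lambda>\<omega>. \<bar>a \<bullet> X \<omega>\<bar>) \<le> sqrt (q a) / sqrt c\<^sub>q * expectation (\<lambda>\<omega>. norm (X \<omega>))"
    if X: "square_integrable X" for X :: "'m \<Rightarrow> real^'d" and a
  proof -
    have "expectation (\<lambda>\<omega>. \<bar>a \<bullet> X \<omega>\<bar>) \<le> expectation (\<lambda>\<omega>. norm a * norm (X \<omega>))"
      using square_integrable_integrable[OF X] square_integrable_integrable[OF square_integrable_inner_left[OF X]]
      by (intro integral_mono) (auto simp: Cauchy_Schwarz_ineq2)
    also have "\<dots> = norm a * expectation (\<lambda>\<omega>. norm (X \<omega>))" by simp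
    also have "\<dots> \<le> sqrt (q a) / sqrt c\<^sub>q * expectation (\<lambda>\<omega>. norm (X \<omega>))"
      by (intro mult_right_mono norm_le_sqrt_q Bochner_Integration.integral_nonneg) auto
    finally show ?thesis .
  qed
  show ?thesis
  proof (rule form_decay[where bd = "m / sqrt c\<^sub>q" and c = "7 / 2" and f = "\<lambda>k. stepT (h k)" and D = "\<alpha> * C / sqrt c\<^sub>q"])
    fix a show "expectation (\<lambda>\<omega>. \<bar>a \<bullet> zR 0 \<omega>\<bar>) \<le> m / sqrt c\<^sub>q * sqrt (q a)"
      using ab[OF e_L2, of a 0] by (simp add: m_def mult_ac)
  next
    fix k a
    have iR: "integrable M (\<lambda>\<omega>. c \<bullet> zR k \<omega>)" and iM: "integrable M (\<lambda>\<omega>. c \<bullet> Rem (e k \<omega>))" for c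
      by (intro square_integrable_integrable square_integrable_inner_left zR_L2 Rem_L2)+
    have eq: "a \<bullet> zR (Suc k) \<omega> = stepT (h k) a \<bullet> zR k \<omega> + h k * (a \<bullet> Rem (e k \<omega>))" for \<omega>
      by (simp add: inner_add_right step_adjoint)
    have "expectation (\<lambda>\<omega>. \<bar>a \<bullet> zR (Suc k) \<omega>\<bar>)
        \<le> expectation (\<lambda>\<omega>. \<bar>stepT (h k) a \<bullet> zR k \<omega>\<bar> + h k * \<bar>a \<bullet> Rem (e k \<omega>)\<bar>)"
    proof (intro integral_mono)
      fix \<omega>
      show "\<bar>a \<bullet> zR (Suc k) \<omega>\<bar> \<le> \<bar>stepT (h k) a \<bullet> zR k \<omega>\<bar> + h k * \<bar>a \<bullet> Rem (e k \<omega>)\<bar>"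
        unfolding eq using abs_triangle_ineq[of "stepT (h k) a \<bullet> zR k \<omega>" "h k * (a \<bullet> Rem (e k \<omega>))"] h_pos[of k]
        by (simp add: abs_mult)
    next
      show "integrable M (\<lambda>\<omega>. \<bar>a \<bullet> zR (Suc k) \<omega>\<bar>)"
        by (intro integrable_abs square_integrable_integrable square_integrable_inner_left zR_L2)
    qed (intro Bochner_Integration.integrable_add integrable_abs integrable_mult_right iR iM)
    also have "\<dots> = expectation (\<lambda>\<omega>. \<bar>stepT (h k) a \<bullet> zR k \<omega>\<bar>) + h k * expectation (\<lambda>\<omega>. \<bar>a \<bullet> Rem (e k \<omega>)\<bar>)"
      using iR iM by simp
    also have "h k * expectation (\<lambda>\<omega>. \<bar>a \<bullet> Rem (e k \<omega>)\<bar>)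
        \<le> h k * (sqrt (q a) / sqrt c\<^sub>q * (C * (real k + K) powr (- ((1 + \<delta>) / 2))))"
      using h_pos[of k] cq_pos q_nonneg[of a]
      by (intro mult_left_mono order_trans[OF ab[OF Rem_L2]] C) auto
    also have "\<dots> = \<alpha> * C / sqrt c\<^sub>q * (real k + K) powr (- (1 + (1 + \<delta>) / 2)) * sqrt (q a)"
      unfolding powr_minus_Suc[OF n_ge(2)] h_def by (simp add: mult_ac)
    finally show "expectation (\<lambda>\<omega>. \<bar>a \<bullet> zR (Suc k) \<omega>\<bar>) \<le> expectation (\<lambda>\<omega>. \<bar>stepT (h k) a \<bullet> zR k \<omega>\<bar>)
        + \<alpha> * C / sqrt c\<^sub>q * (real k + K) powr (- (1 + (1 + \<delta>) / 2)) * sqrt (q a)" by simp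
  qed (use sqrt_q_step q_nonneg m cq_pos pos K_ge(1) C alpha_pos in auto)
qed

text \<open>Here L2 pays off, since orthogonality removes the cross terms. The noise is
  multiplicative, so its second moment is already of order \<open>1 / n\<close>; times the squared
  step this gives a forcing of order \<open>n^(-3)\<close>, one power better than for
  \<open>s\<close>.\<close>

lemma zA_bound: "\<exists>C\<ge>0. \<forall>k a. expectation (\<lambda>\<omega>. (a \<bullet> zA k \<omega>)\<^sup>2) \<le> C * (real k + K) powr (- 2) * q a"
proof -
  obtain C where C: "C \<ge> 0" "\<And>k. expectation (\<lambda>\<omega>. (norm (e k \<omega>))\<^sup>2) \<le> C * (1 / (real k + K))"
    using e_second_moment by blast
  show ?thesis
  proof (rule form_decay[where bd = 0 and c = 7 and f = "\<lambda>k. stepT (h k)" and D = "\<alpha>\<^sup>2 * (\<bar>A\<^sub>1\<bar> * C) / c\<^sub>q"])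
    fix k a
    let ?X = "\<lambda>\<omega>. stepT (h k) a \<bullet> zA k \<omega>" and ?Y = "\<lambda>\<omega>. a \<bullet> An k \<omega>"
    have X: "square_integrable ?X" and Y: "square_integrable ?Y"
      by (intro square_integrable_inner_left zA_L2 An_L2)+
    have cross: "expectation (\<lambda>\<omega>. ?X \<omega> * ?Y \<omega>) = 0"
    proof -
      have "square_integrable (\<lambda>\<omega>. ?X \<omega> *\<^sub>R a)"
        by (rule square_integrable_bound1[OF X, of _ "norm a"]) (use square_integrableD(1)[OF X] in auto)
      moreover have "(\<lambda>\<omega>. ?X \<omega> *\<^sub>R a) \<in> borel_measurable (Hist k)" using zA_Hist[of k] by measurable
      ultimately have "expectation (\<lambda>\<omega>. (?X \<omega> *\<^sub>R a) \<bullet> An k \<omega>) = 0" by (intro An_orthogonal)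
      then show ?thesis by simp
    qed
    have "expectation (\<lambda>\<omega>. (a \<bullet> zA (Suc k) \<omega>)\<^sup>2)
        = expectation (\<lambda>\<omega>. (?X \<omega>)\<^sup>2 + 2 * h k * (?X \<omega> * ?Y \<omega>) + (h k)\<^sup>2 * (?Y \<omega>)\<^sup>2)"
    proof (intro Bochner_Integration.integral_cong refl)
      fix \<omega> assume "\<omega> \<in> space M"
      then have "a \<bullet> zA (Suc k) \<omega> = ?X \<omega> + h k * ?Y \<omega>"
        by (simp add: zA_Suc inner_add_right step_adjoint)
      then show "(a \<bullet> zA (Suc k) \<omega>)\<^sup>2 = (?X \<omega>)\<^sup>2 + 2 * h k * (?X \<omega> * ?Y \<omega>) + (h k)\<^sup>2 * (?Y \<omega>)\<^sup>2"
        by (simp add: power2_eq_square algebra_simps)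
    qed
    also have "\<dots> = expectation (\<lambda>\<omega>. (?X \<omega>)\<^sup>2) + (h k)\<^sup>2 * expectation (\<lambda>\<omega>. (?Y \<omega>)\<^sup>2)"
      using X Y square_integrable_mult[OF X Y] by (simp add: cross square_integrable_real)
    also have "(h k)\<^sup>2 * expectation (\<lambda>\<omega>. (?Y \<omega>)\<^sup>2) \<le> (h k)\<^sup>2 * (q a / c\<^sub>q * (\<bar>A\<^sub>1\<bar> * (C * (1 / (real k + K)))))"
    proof (intro mult_left_mono)
      have "expectation (\<lambda>\<omega>. (?Y \<omega>)\<^sup>2) \<le> expectation (\<lambda>\<omega>. (norm a)\<^sup>2 * (norm (An k \<omega>))\<^sup>2)"
      proof (intro integral_mono)
        fix \<omega>
        have "\<bar>?Y \<omega>\<bar>\<^sup>2 \<le> (norm a * norm (An k \<omega>))\<^sup>2" by (intro power_mono Cauchy_Schwarz_ineq2) auto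
        then show "(?Y \<omega>)\<^sup>2 \<le> (norm a)\<^sup>2 * (norm (An k \<omega>))\<^sup>2" by (simp add: power_mult_distrib)
      qed (use Y An_L2 in \<open>auto simp: square_integrable_real\<close>)
      also have "\<dots> = (norm a)\<^sup>2 * expectation (\<lambda>\<omega>. (norm (An k \<omega>))\<^sup>2)" by simp
      also have "\<dots> \<le> q a / c\<^sub>q * (\<bar>A\<^sub>1\<bar> * expectation (\<lambda>\<omega>. (norm (e k \<omega>))\<^sup>2))"
        using q_nonneg[of a] cq_pos
        by (intro mult_mono norm_le_q An_second_moment Bochner_Integration.integral_nonneg) auto
      also have "\<dots> \<le> q a / c\<^sub>q * (\<bar>A\<^sub>1\<bar> * (C * (1 / (real k + K))))"
        using q_nonneg[of a] cq_pos by (intro mult_left_mono C) auto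
      finally show "expectation (\<lambda>\<omega>. (?Y \<omega>)\<^sup>2) \<le> q a / c\<^sub>q * (\<bar>A\<^sub>1\<bar> * (C * (1 / (real k + K))))" .
    qed simp
    also have "\<dots> = \<alpha>\<^sup>2 * (\<bar>A\<^sub>1\<bar> * C) / c\<^sub>q * (real k + K) powr (- (1 + 2)) * q a"
      unfolding powr_n h_def by (simp add: power_divide power2_eq_square power3_eq_cube mult_ac)
    finally show "expectation (\<lambda>\<omega>. (a \<bullet> zA (Suc k) \<omega>)\<^sup>2) \<le> expectation (\<lambda>\<omega>. (?X \<omega>)\<^sup>2)
        + \<alpha>\<^sup>2 * (\<bar>A\<^sub>1\<bar> * C) / c\<^sub>q * (real k + K) powr (- (1 + 2)) * q a" by simp
  qed (use q_step q_nonneg K_ge(1) C cq_pos in \<open>auto simp: zA_0\<close>)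
qed

lemma error_bound:
  "\<exists>C\<ge>0. \<forall>k a. norm a = 1 \<longrightarrow> expectation (\<lambda>\<omega>. \<bar>a \<bullet> z k \<omega>\<bar>) \<le> C * (real k + K) powr (- ((1 + \<delta>) / 2))"
proof -
  obtain C where C: "C \<ge> 0"
    "\<And>k a. expectation (\<lambda>\<omega>. \<bar>a \<bullet> zR k \<omega>\<bar>) \<le> C * (real k + K) powr (- ((1 + \<delta>) / 2)) * sqrt (q a)"
    using zR_bound by blast
  obtain C' where C': "C' \<ge> 0"
    "\<And>k a. expectation (\<lambda>\<omega>. (a \<bullet> zA k \<omega>)\<^sup>2) \<le> C' * (real k + K) powr (- 2) * q a"
    using zA_bound by blast
  let ?\<Lambda> = "sqrt (lambda_max V)"
  have "expectation (\<lambda>\<omega>. \<bar>a \<bullet> z k \<omega>\<bar>) \<le> (C + sqrt C') * ?\<Lambda> * (real k + K) powr (- ((1 + \<delta>) / 2))"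
    if a: "norm a = 1" for k a
  proof -
    define n where "n = real k + K"
    have n: "n \<ge> 7" using n_ge by (simp add: n_def)
    have sq: "sqrt (q a) \<le> ?\<Lambda>" using q_upper[of a] a by (intro real_sqrt_le_mono) simp
    have iR: "integrable M (\<lambda>\<omega>. a \<bullet> zR k \<omega>)" and iA: "integrable M (\<lambda>\<omega>. a \<bullet> zA k \<omega>)"
      by (intro square_integrable_integrable square_integrable_inner_left zR_L2 zA_L2)+
    have "expectation (\<lambda>\<omega>. \<bar>a \<bullet> z k \<omega>\<bar>) \<le> expectation (\<lambda>\<omega>. \<bar>a \<bullet> zR k \<omega>\<bar> + \<bar>a \<bullet> zA k \<omega>\<bar>)"
    proof (intro integral_mono)
      fix \<omega>
      have "a \<bullet> z k \<omega> = a \<bullet> zR k \<omega> + a \<bullet> zA k \<omega>" by (simp add: zA_def inner_diff_right)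
      then show "\<bar>a \<bullet> z k \<omega>\<bar> \<le> \<bar>a \<bullet> zR k \<omega>\<bar> + \<bar>a \<bullet> zA k \<omega>\<bar>" by simp
    next
      show "integrable M (\<lambda>\<omega>. \<bar>a \<bullet> z k \<omega>\<bar>)"
        by (intro integrable_abs square_integrable_integrable square_integrable_inner_left z_L2)
    qed (use iR iA in auto)
    also have "\<dots> = expectation (\<lambda>\<omega>. \<bar>a \<bullet> zR k \<omega>\<bar>) + expectation (\<lambda>\<omega>. \<bar>a \<bullet> zA k \<omega>\<bar>)"
      using iR iA by simp
    also have "expectation (\<lambda>\<omega>. \<bar>a \<bullet> zA k \<omega>\<bar>) \<le> sqrt (C' * n powr (- 2) * q a)"
      using C'(2)[of a k] by (intro order_trans[OF expectation_abs_le_sqrt[OF square_integrable_inner_left[OF zA_L2]]] real_sqrt_le_mono)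
        (simp add: n_def)
    also have "\<dots> = sqrt C' * n powr (- 1) * sqrt (q a)"
      using n unfolding n_def powr_n by (simp add: real_sqrt_mult real_sqrt_divide)
    \<comment> \<open>Uses \<open>\<delta> \<le> 1\<close>: the martingale part, of order
      \<open>1 / n\<close>, is no larger than the remainder part.\<close>
    also have "\<dots> \<le> sqrt C' * n powr (- ((1 + \<delta>) / 2)) * ?\<Lambda>"
      using n pos C'(1) sq q_nonneg[of a] by (intro mult_mono mult_left_mono powr_mono) auto
    also have "expectation (\<lambda>\<omega>. \<bar>a \<bullet> zR k \<omega>\<bar>) \<le> C * n powr (- ((1 + \<delta>) / 2)) * sqrt (q a)"
      using C(2)[of a k] by (simp add: n_def)
    also have "\<dots> \<le> C * n powr (- ((1 + \<delta>) / 2)) * ?\<Lambda>" using C sq by (intro mult_left_mono) auto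
    finally show ?thesis by (simp add: n_def algebra_simps)
  qed
  moreover have "(C + sqrt C') * ?\<Lambda> \<ge> 0" using C C' lambda_pos by simp
  ultimately show ?thesis by blast
qed

text \<open>The adjoint of the covariance step \<open>I + h k\<close> times the shifted Jacobian, as
  \<open>h k / (2 \<alpha>) = 1 / (2 n)\<close>.\<close>

definition stepS where "stepS k a = (1 + 1 / (2 * (real k + K))) *\<^sub>R a + h k *\<^sub>R (a v* J)"

lemma stepS_eq: "stepS k a = stepT (h k) a + (1 / (2 * (real k + K))) *\<^sub>R a"
  by (simp add: stepS_def stepT_def algebra_simps)

text \<open>Factoring out \<open>c = 1 + 1 / (2 n)\<close> leaves an unshifted step of length
  \<open>\<alpha> / (n + 1/2)\<close>. Its contraction, against the growth \<open>c^2\<close> of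
  about \<open>1 + 1 / n\<close>, leaves the rate \<open>6 / n\<close>.\<close>

lemma q_stepS: "q (stepS k a) \<le> (1 - 6 / (real k + K)) * q a"
proof -
  define n where "n = real k + K"
  have n: "n \<ge> 7" "n > 0" using n_ge by (auto simp: n_def)
  define c where "c = 1 + 1 / (2 * n)"
  have c: "c > 1" using n by (simp add: c_def)
  have "h k = \<alpha> / n" by (simp add: h_def n_def)
  then have hc: "h k / c = \<alpha> / (n + 1 / 2)" using n by (simp add: c_def field_simps)
  have "h k / c \<le> h k" using c h_pos[of k] by (simp add: divide_le_eq)
  then have hs: "0 < h k / c" "h k / c \<le> 1 / (\<alpha> * L\<^sub>J\<^sup>2)" using h_pos[of k] h_small[of k] c by auto
  have "stepS k a = c *\<^sub>R stepT (h k / c) a"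
  proof -
    have "stepS k a = c *\<^sub>R a + h k *\<^sub>R (a v* J)" by (simp add: stepS_def c_def n_def)
    then show ?thesis using c by (simp add: stepT_def scaleR_add_right)
  qed
  then have "q (stepS k a) = c\<^sup>2 * q (stepT (h k / c) a)" by (simp add: q_scaleR)
  also have "\<dots> \<le> c\<^sup>2 * ((1 - 7 * (h k / c) / \<alpha>) * q a)" by (intro mult_left_mono q_contract hs) auto
  also have "\<dots> = (c\<^sup>2 * (1 - 7 / (n + 1 / 2))) * q a" unfolding hc using alpha_pos by simp
  also have "\<dots> \<le> (1 - 6 / n) * q a"
  proof (intro mult_right_mono q_nonneg)
    have "c\<^sup>2 * (1 - 7 / (n + 1 / 2)) = (n + 1 / 2) * (n - 13 / 2) / n\<^sup>2"
    proof -
      define m where "m = n + 1 / 2"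
      have m: "m > 0" using n by (simp add: m_def)
      have "c = m / n" using n by (simp add: c_def m_def field_simps)
      moreover have "1 - 7 / m = (n - 13 / 2) / m" using m by (simp add: m_def field_simps)
      ultimately show ?thesis unfolding m_def[symmetric] using m n by (simp add: power2_eq_square)
    qed
    also have "\<dots> \<le> (n\<^sup>2 - 6 * n) / n\<^sup>2" by (intro divide_right_mono) (auto simp: power2_eq_square algebra_simps)
    also have "\<dots> = 1 - 6 / n" using n by (simp add: power2_eq_square field_simps)
    finally show "c\<^sup>2 * (1 - 7 / (n + 1 / 2)) \<le> 1 - 6 / n" .
  qed
  finally show ?thesis by (simp add: n_def)
qed

abbreviation "Cov S\<^sub>0 \<equiv> covariance (step_size \<alpha> K) (shifted_jacobian \<alpha> J) \<Sigma>\<^sub>b S\<^sub>0"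

lemma Cov_Suc: "a \<bullet> (Cov S\<^sub>0 (Suc k) *v c) = stepS k a \<bullet> (Cov S\<^sub>0 k *v stepS k c) + h k * (a \<bullet> (\<Sigma>\<^sub>b *v c))"
proof -
  have T: "a v* (mat 1 + h k *\<^sub>R shifted_jacobian \<alpha> J) = stepS k a" for a
    using alpha_pos by (simp add: shifted_jacobian_def stepS_def vector_matrix_mult_add_rdistrib vector_scaleR_matrix_ac
        h_def scaleR_add_left scaleR_add_right)
  have "a \<bullet> ((B ** X ** transpose B) *v c) = (a v* B) \<bullet> (X *v (c v* B))" for B X :: "real^'d^'d"
    by (simp add: matrix_vector_mul_assoc[symmetric] dot_lmul_matrix)
  from this[of "mat 1 + h k *\<^sub>R shifted_jacobian \<alpha> J" "Cov S\<^sub>0 k"] show ?thesis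
    by (simp add: h_eq T matrix_vector_mult_add_rdistrib inner_add_right scaleR_matrix_vector_assoc[symmetric])
qed

lemma Cov_pos_semidef:
  assumes "pos_semidef S\<^sub>0"
  shows "pos_semidef (Cov S\<^sub>0 k)"
proof -
  have sym: "a \<bullet> (B *v c) = c \<bullet> (B *v a)" if "pos_semidef B" for a c and B :: "real^'d^'d"
    using that symmetric_inner[of B c a] by (simp add: pos_semidef_def inner_commute)
  have "(\<forall>a c. a \<bullet> (Cov S\<^sub>0 k *v c) = c \<bullet> (Cov S\<^sub>0 k *v a)) \<and> (\<forall>a. 0 \<le> a \<bullet> (Cov S\<^sub>0 k *v a))"
  proof (induction k)
    case 0
    then show ?case using sym[OF assms] assms by (auto simp: pos_semidef_def)
  next
    case (Suc k)
    have "0 \<le> a \<bullet> (\<Sigma>\<^sub>b *v a)" for a using Sigma_pos by (simp add: pos_semidef_def)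
    moreover have "a \<bullet> (\<Sigma>\<^sub>b *v c) = c \<bullet> (\<Sigma>\<^sub>b *v a)" for a c by (rule sym[OF Sigma_pos])
    moreover have "a \<bullet> (Cov S\<^sub>0 k *v c) = c \<bullet> (Cov S\<^sub>0 k *v a)" for a c using Suc by blast
    ultimately show ?case unfolding Cov_Suc using Suc h_pos[of k] by simp
  qed
  then have "\<forall>a c. a \<bullet> (Cov S\<^sub>0 k *v c) = c \<bullet> (Cov S\<^sub>0 k *v a)" "\<forall>a. 0 \<le> a \<bullet> (Cov S\<^sub>0 k *v a)" by auto
  moreover have "transpose (Cov S\<^sub>0 k) = Cov S\<^sub>0 k"
  proof (rule matrix_eq_inner)
    fix a c
    have "a \<bullet> (transpose (Cov S\<^sub>0 k) *v c) = c \<bullet> (Cov S\<^sub>0 k *v a)"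
      by (metis dot_lmul_matrix inner_commute transpose_matrix_vector)
    then show "a \<bullet> (transpose (Cov S\<^sub>0 k) *v c) = a \<bullet> (Cov S\<^sub>0 k *v c)" using calculation by simp
  qed
  ultimately show ?thesis by (simp add: pos_semidef_def)
qed

lemma q_JT: "q (a v* J) \<le> lambda_max V * L\<^sub>J\<^sup>2 / c\<^sub>q * q a"
proof -
  have "q (a v* J) \<le> lambda_max V * (norm (a v* J))\<^sup>2" by (rule q_upper)
  also have "\<dots> \<le> lambda_max V * (L\<^sub>J * norm a)\<^sup>2"
    using lambda_pos norm_JT by (intro mult_left_mono power_mono) auto
  also have "\<dots> = lambda_max V * L\<^sub>J\<^sup>2 * (norm a)\<^sup>2" by (simp add: power_mult_distrib)
  also have "\<dots> \<le> lambda_max V * L\<^sub>J\<^sup>2 * (q a / c\<^sub>q)" using lambda_pos by (intro mult_left_mono norm_le_q) auto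
  finally show ?thesis by simp
qed

lemma T_nonneg: "T k a \<ge> 0"
  unfolding T_def by (intro Bochner_Integration.integral_nonneg) auto

text \<open>The shift by \<open>1 / (2 \<alpha>)\<close> imitates the rescaling of the variance from
  \<open>h k\<close> to \<open>h (Suc k)\<close>, whose factor is \<open>1 + 1 / n\<close>. Writing
  the projection along \<open>stepS k a\<close> as \<open>X + Y / (2 n)\<close> with
  \<open>Y = X - h W\<close>, the terms without \<open>h\<close> agree up to
  \<open>Y^2 / (4 n^2)\<close>, and the mixed term \<open>X W\<close> carries the small factor
  \<open>h / n\<close>.\<close>

lemma T_stepS: "\<bar>T k (stepS k a) - (1 + 1 / (real k + K)) * T k (stepT (h k) a)\<bar>
    \<le> h k / (2 * (real k + K)) * (T k (stepT (h k) a) + T k (a v* J)) + 1 / (4 * (real k + K)\<^sup>2) * T k a"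
proof -
  define n where "n = real k + K"
  have n: "n > 0" using n_ge by (simp add: n_def)
  let ?X = "\<lambda>\<omega>. stepT (h k) a \<bullet> s k \<omega>" and ?Y = "\<lambda>\<omega>. a \<bullet> s k \<omega>" and ?W = "\<lambda>\<omega>. (a v* J) \<bullet> s k \<omega>"
  have l2: "square_integrable (\<lambda>\<omega>. c \<bullet> s k \<omega>)" for c by (rule square_integrable_inner_left[OF s_L2])
  have i2: "integrable M (\<lambda>\<omega>. (c \<bullet> s k \<omega>)\<^sup>2)" for c using l2 by (simp add: square_integrable_real)
  have T_diff: "T k (stepS k a) - (1 + 1 / n) * T k (stepT (h k) a)
      = expectation (\<lambda>\<omega>. (stepS k a \<bullet> s k \<omega>)\<^sup>2 - (1 + 1 / n) * (?X \<omega>)\<^sup>2)"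
    unfolding T_def using i2 by simp
  have "\<bar>expectation (\<lambda>\<omega>. (stepS k a \<bullet> s k \<omega>)\<^sup>2 - (1 + 1 / n) * (?X \<omega>)\<^sup>2)\<bar>
      \<le> expectation (\<lambda>\<omega>. h k / (2 * n) * ((?X \<omega>)\<^sup>2 + (?W \<omega>)\<^sup>2) + 1 / (4 * n\<^sup>2) * (?Y \<omega>)\<^sup>2)"
  proof (rule order_trans[OF integral_abs_bound], rule integral_mono)
    fix \<omega>
    have X: "?X \<omega> = ?Y \<omega> + h k * ?W \<omega>" by (simp add: stepT_def inner_add_left)
    have S: "stepS k a \<bullet> s k \<omega> = ?X \<omega> + 1 / (2 * n) * ?Y \<omega>"
      by (simp add: stepS_eq inner_add_left n_def)
    have eq: "(stepS k a \<bullet> s k \<omega>)\<^sup>2 - (1 + 1 / n) * (?X \<omega>)\<^sup>2 = - (h k / n * (?X \<omega> * ?W \<omega>)) + 1 / (4 * n\<^sup>2) * (?Y \<omega>)\<^sup>2"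
    proof -
      have Y: "?Y \<omega> = ?X \<omega> - h k * ?W \<omega>" using X by simp
      have "(?X \<omega> + 1 / (2 * n) * ?Y \<omega>)\<^sup>2 = (?X \<omega>)\<^sup>2 + 1 / n * (?X \<omega> * ?Y \<omega>) + 1 / (4 * n\<^sup>2) * (?Y \<omega>)\<^sup>2"
        by (simp add: power2_eq_square algebra_simps)
      moreover have "1 / n * (?X \<omega> * ?Y \<omega>) = 1 / n * (?X \<omega>)\<^sup>2 - h k / n * (?X \<omega> * ?W \<omega>)"
        by (subst Y) (simp add: power2_eq_square algebra_simps)
      ultimately show ?thesis unfolding S by (simp add: algebra_simps)
    qed
    have "\<bar>?X \<omega> * ?W \<omega>\<bar> \<le> ((?X \<omega>)\<^sup>2 + (?W \<omega>)\<^sup>2) / 2"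
      using sum_squares_bound[of "\<bar>?X \<omega>\<bar>" "\<bar>?W \<omega>\<bar>"] by (simp add: abs_mult)
    then have "h k / n * \<bar>?X \<omega> * ?W \<omega>\<bar> \<le> h k / n * (((?X \<omega>)\<^sup>2 + (?W \<omega>)\<^sup>2) / 2)"
      using h_pos[of k] n by (intro mult_left_mono) auto
    then have "\<bar>h k / n * (?X \<omega> * ?W \<omega>)\<bar> \<le> h k / (2 * n) * ((?X \<omega>)\<^sup>2 + (?W \<omega>)\<^sup>2)"
      using h_pos[of k] n by (simp add: abs_mult)
    moreover have "0 \<le> 1 / (4 * n\<^sup>2) * (?Y \<omega>)\<^sup>2" by simp
    ultimately show "\<bar>(stepS k a \<bullet> s k \<omega>)\<^sup>2 - (1 + 1 / n) * (?X \<omega>)\<^sup>2\<bar>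
        \<le> h k / (2 * n) * ((?X \<omega>)\<^sup>2 + (?W \<omega>)\<^sup>2) + 1 / (4 * n\<^sup>2) * (?Y \<omega>)\<^sup>2"
      unfolding eq by linarith
  next
    show "integrable M (\<lambda>\<omega>. \<bar>(stepS k a \<bullet> s k \<omega>)\<^sup>2 - (1 + 1 / n) * (?X \<omega>)\<^sup>2\<bar>)"
      by (rule integrable_abs, rule Bochner_Integration.integrable_diff[OF i2 integrable_mult_right[OF i2]])
    show "integrable M (\<lambda>\<omega>. h k / (2 * n) * ((?X \<omega>)\<^sup>2 + (?W \<omega>)\<^sup>2) + 1 / (4 * n\<^sup>2) * (?Y \<omega>)\<^sup>2)"
      by (rule Bochner_Integration.integrable_add[OF integrable_mult_right[OF Bochner_Integration.integrable_add[OF i2 i2]] integrable_mult_right[OF i2]])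
  qed
  also have "\<dots> = h k / (2 * n) * (T k (stepT (h k) a) + T k (a v* J)) + 1 / (4 * n\<^sup>2) * T k a"
    unfolding T_def using i2 by simp
  finally show ?thesis unfolding T_diff[symmetric] by (simp add: n_def)
qed

text \<open>The scaled variance \<open>T k a / h k\<close> satisfies the recursion of
  \<open>Cov\<close> up to errors of order \<open>n^(-2)\<close>: those of \<open>T_stepS\<close>,
  and \<open>h k / n\<close> times the noise variance, because
  \<open>(h k)^2 / h (Suc k) = h k (1 + 1 / n)\<close>. The rate 6 both sums these errors to
  \<open>1 / n\<close> and forgets the initial mismatch between \<open>S\<^sub>0\<close> and the
  zero start of \<open>s\<close>.\<close>

lemma Cov_bound:
  "\<exists>C\<ge>0. \<forall>k a. \<bar>a \<bullet> (Cov S\<^sub>0 k *v a) - T k a / h k\<bar> \<le> C * (1 / (real k + K)) * q a"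
proof -
  obtain C where C: "C \<ge> 0" "\<And>k a. T k a \<le> C * (1 / (real k + K)) * q a" using T_bound by blast
  obtain C\<^sub>S where CS: "C\<^sub>S \<ge> 0" "\<And>a. a \<bullet> (\<Sigma>\<^sub>b *v a) \<le> C\<^sub>S * q a" using Sigma_bound by blast
  have S0: "\<exists>B\<ge>0. \<forall>a. \<bar>a \<bullet> (S\<^sub>0 *v a)\<bar> \<le> B * q a"
  proof -
    obtain B where B: "B > 0" "\<And>a. norm (S\<^sub>0 *v a) \<le> norm a * B"
      using bounded_linear.pos_bounded[OF matrix_vector_mul_bounded_linear[of S\<^sub>0]] by blast
    have "\<bar>a \<bullet> (S\<^sub>0 *v a)\<bar> \<le> B / c\<^sub>q * q a" for a
    proof -
      have "\<bar>a \<bullet> (S\<^sub>0 *v a)\<bar> \<le> norm a * (norm a * B)" by (rule cauchy_schwarz_mult[OF order_refl B(2)])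
      also have "\<dots> = B * (norm a)\<^sup>2" by (simp add: power2_eq_square)
      also have "\<dots> \<le> B * (q a / c\<^sub>q)" using B by (intro mult_left_mono norm_le_q) auto
      finally show ?thesis by simp
    qed
    then show ?thesis using B cq_pos by (intro exI[of _ "B / c\<^sub>q"]) auto
  qed
  then obtain B where B: "B \<ge> 0" "\<And>a. \<bar>a \<bullet> (S\<^sub>0 *v a)\<bar> \<le> B * q a" by blast
  define cJ where "cJ = lambda_max V * L\<^sub>J\<^sup>2 / c\<^sub>q"
  have cJ: "cJ \<ge> 0" using lambda_pos cq_pos by (simp add: cJ_def)
  define D where "D = C / 2 * (1 + cJ) + C / (4 * \<alpha>) + \<alpha> * C\<^sub>S"
  have D: "D \<ge> 0" unfolding D_def using C CS cJ alpha_pos by simp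
  have "\<exists>C\<ge>0. \<forall>k a. \<bar>a \<bullet> (Cov S\<^sub>0 k *v a) - T k a / h k\<bar> \<le> C * (real k + K) powr (- 1) * q a"
  proof (rule form_decay[where bd = B and c = 6 and f = stepS and D = D])
    fix a show "\<bar>a \<bullet> (Cov S\<^sub>0 0 *v a) - T 0 a / h 0\<bar> \<le> B * q a" using B by (simp add: T_def)
  next
    fix k a
    define n where "n = real k + K"
    have n: "n \<ge> 7" "n > 0" using n_ge by (auto simp: n_def)
    have hn: "h k = \<alpha> / n" by (simp add: h_def n_def)
    have hS: "h (Suc k) = \<alpha> / (n + 1)" by (simp add: h_def n_def add_ac)
    let ?D = "\<lambda>k a. a \<bullet> (Cov S\<^sub>0 k *v a) - T k a / h k"
    let ?t = "\<lambda>a. T k a / h k" and ?\<sigma> = "a \<bullet> (\<Sigma>\<^sub>b *v a)"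
    have \<sigma>: "0 \<le> ?\<sigma>" using Sigma_pos by (simp add: pos_semidef_def)
    have "T (Suc k) a / h (Suc k) = (1 + 1 / n) * ?t (stepT (h k) a) + (1 + 1 / n) * (h k * ?\<sigma>)"
      unfolding T_Suc hS hn using n alpha_pos by (simp add: field_simps power2_eq_square)
    then have "?D (Suc k) a = ?D k (stepS k a) + (?t (stepS k a) - (1 + 1 / n) * ?t (stepT (h k) a)) - h k * ?\<sigma> / n"
      unfolding Cov_Suc by (simp add: algebra_simps)
    moreover have "\<bar>?t (stepS k a) - (1 + 1 / n) * ?t (stepT (h k) a)\<bar> \<le> (C / 2 * (1 + cJ) + C / (4 * \<alpha>)) * (1 / n\<^sup>2) * q a"
    proof -
      have "?t (stepS k a) - (1 + 1 / n) * ?t (stepT (h k) a) = (T k (stepS k a) - (1 + 1 / n) * T k (stepT (h k) a)) / h k"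
        by (simp add: diff_divide_distrib)
      then have "\<bar>?t (stepS k a) - (1 + 1 / n) * ?t (stepT (h k) a)\<bar> = \<bar>T k (stepS k a) - (1 + 1 / n) * T k (stepT (h k) a)\<bar> / h k"
        using h_pos[of k] by simp
      also have "\<dots> \<le> (h k / (2 * n) * (T k (stepT (h k) a) + T k (a v* J)) + 1 / (4 * n\<^sup>2) * T k a) / h k"
        using T_stepS[of k a] h_pos[of k] by (intro divide_right_mono) (auto simp: n_def)
      also have "\<dots> = 1 / (2 * n) * (T k (stepT (h k) a) + T k (a v* J)) + 1 / (4 * n * \<alpha>) * T k a"
        using n alpha_pos unfolding hn by (simp add: field_simps power2_eq_square)
      also have "\<dots> \<le> 1 / (2 * n) * (C * (1 / n) * q a + C * (1 / n) * (cJ * q a)) + 1 / (4 * n * \<alpha>) * (C * (1 / n) * q a)"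
      proof (intro add_mono mult_left_mono)
        have "q (stepT (h k) a) \<le> 1 * q a"
          by (rule order_trans[OF q_step]) (intro mult_right_mono q_nonneg, use n_ge(2)[of k] in simp)
        then show "T k (stepT (h k) a) \<le> C * (1 / n) * q a"
          using C n by (intro order_trans[OF C(2)]) (auto simp: n_def intro!: mult_left_mono divide_right_mono)
        show "T k (a v* J) \<le> C * (1 / n) * (cJ * q a)"
        proof -
          have "C * (1 / n) * q (a v* J) \<le> C * (1 / n) * (cJ * q a)"
            using C n q_JT[of a] by (intro mult_left_mono) (auto simp: cJ_def)
          then show ?thesis using C(2)[of k "a v* J"] by (simp add: n_def)
        qed
        show "T k a \<le> C * (1 / n) * q a" using C(2)[of k a] by (simp add: n_def)
      qed (use n alpha_pos in auto)
      also have "\<dots> = (C / 2 * (1 + cJ) + C / (4 * \<alpha>)) * (1 / n\<^sup>2) * q a"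
        using n alpha_pos by (simp add: power2_eq_square field_simps)
      finally show ?thesis .
    qed
    moreover have "\<bar>h k * ?\<sigma> / n\<bar> \<le> \<alpha> * C\<^sub>S * (1 / n\<^sup>2) * q a"
    proof -
      have "\<alpha> / n\<^sup>2 * ?\<sigma> \<le> \<alpha> / n\<^sup>2 * (C\<^sub>S * q a)" using alpha_pos CS by (intro mult_left_mono) auto
      then show ?thesis using \<sigma> n alpha_pos by (simp add: hn power2_eq_square abs_mult)
    qed
    moreover have "D * (1 / n\<^sup>2) * q a = (C / 2 * (1 + cJ) + C / (4 * \<alpha>)) * (1 / n\<^sup>2) * q a + \<alpha> * C\<^sub>S * (1 / n\<^sup>2) * q a"
      by (simp add: D_def algebra_simps)
    ultimately have "\<bar>?D (Suc k) a\<bar> \<le> \<bar>?D k (stepS k a)\<bar> + D * (1 / n\<^sup>2) * q a" by linarith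
    then show "\<bar>?D (Suc k) a\<bar> \<le> \<bar>?D k (stepS k a)\<bar> + D * (real k + K) powr (- (1 + 1)) * q a"
      unfolding powr_n by (simp add: n_def)
  qed (use q_stepS q_nonneg K_ge(1) B D in auto)
  then show ?thesis unfolding powr_n .
qed

end

section \<open>From smooth test functions to tail probabilities\<close>

lemma prob_space_std_normal: "prob_space std_normal_distribution"
  by (rule prob_space_normal_density) simp

lemma std_normal_integral:
  fixes f :: "real \<Rightarrow> real"
  assumes "f \<in> borel_measurable borel"
  shows "(\<integral>z. f z \<partial>std_normal_distribution) = (\<integral>t. std_normal_density t * f t \<partial>lborel)"
  using assms by (subst integral_density) auto

lemma std_normal_second_moment:
  "integrable std_normal_distribution (\<lambda>z. z\<^sup>2)" "(\<integral>z. z\<^sup>2 \<partial>std_normal_distribution) = 1"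
  using std_normal_distribution_even_moments[of 1] by (auto simp: fact_numeral)

lemma std_normal_first_moment:
  "integrable std_normal_distribution (\<lambda>z. \<bar>z\<bar>)" "(\<integral>z. \<bar>z\<bar> \<partial>std_normal_distribution) \<le> 1"
proof -
  interpret N: prob_space std_normal_distribution by (rule prob_space_std_normal)
  have sq: "N.square_integrable (\<lambda>z. z)"
    using std_normal_second_moment(1) by (simp add: N.square_integrable_real)
  show "integrable std_normal_distribution (\<lambda>z. \<bar>z\<bar>)"
    by (intro integrable_abs N.square_integrable_integrable[OF sq])
  show "(\<integral>z. \<bar>z\<bar> \<partial>std_normal_distribution) \<le> 1"
    using N.expectation_abs_le_sqrt[OF sq] std_normal_second_moment(2) by simp
qed

lemma std_normal_density_le_inverse_square:
  assumes "x \<noteq> 0"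
  shows "std_normal_density x \<le> 1 / x\<^sup>2"
proof -
  have x2: "x\<^sup>2 > 0" using assms by simp
  have "x\<^sup>2 / 2 \<le> exp (x\<^sup>2 / 2)" using exp_ge_add_one_self[of "x\<^sup>2 / 2"] by linarith
  then have "exp (- x\<^sup>2 / 2) \<le> 2 / x\<^sup>2" using x2 by (simp add: exp_minus field_simps)
  moreover have "sqrt (2\<^sup>2) \<le> sqrt (2 * pi)" using pi_gt3 by (intro real_sqrt_le_mono) simp
  then have "1 / sqrt (2 * pi) \<le> 1 / 2" by (intro divide_left_mono) auto
  ultimately have "std_normal_density x \<le> 1 / 2 * (2 / x\<^sup>2)"
    unfolding std_normal_density_def by (intro mult_mono) auto
  then show ?thesis by simp
qed

text \<open>An interval at \<open>t\<close> of relative width \<rho> has mass of order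
  \<open>\<rho> / t\<close>. With \<open>t = a / \<sigma>\<close> this is the origin of the factor
  \<open>1 / a\<close> in the smoothing bias.\<close>

lemma std_normal_interval:
  assumes st: "0 < s" "s \<le> t"
  shows "measure std_normal_distribution {s<..t} \<le> (t - s) / s\<^sup>2"
proof -
  have "emeasure std_normal_distribution {s<..t} = (\<integral>\<^sup>+x. ennreal (std_normal_density x) * indicator {s<..t} x \<partial>lborel)"
    by (subst emeasure_density) auto
  also have "\<dots> \<le> (\<integral>\<^sup>+x. ennreal (1 / s\<^sup>2) * indicator {s<..t} x \<partial>lborel)"
  proof (intro nn_integral_mono)
    fix x
    have "std_normal_density x \<le> 1 / s\<^sup>2" if "s < x"
    proof -
      have "std_normal_density x \<le> 1 / x\<^sup>2" using that st by (intro std_normal_density_le_inverse_square) auto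
      also have "\<dots> \<le> 1 / s\<^sup>2" using that st by (intro divide_left_mono power_mono) auto
      finally show ?thesis .
    qed
    then show "ennreal (std_normal_density x) * indicator {s<..t} x \<le> ennreal (1 / s\<^sup>2) * indicator {s<..t} x"
      by (auto split: split_indicator intro: ennreal_leI)
  qed
  also have "\<dots> = ennreal (1 / s\<^sup>2) * ennreal (t - s)"
    using st by (subst nn_integral_cmult_indicator) auto
  also have "\<dots> = ennreal ((t - s) / s\<^sup>2)" using st by (simp add: ennreal_mult[symmetric])
  finally show ?thesis
    unfolding measure_def using st by (intro enn2real_leI) auto
qed

lemma gauss_ccdf_ereal: "gauss_ccdf (ereal t) = measure std_normal_distribution {t<..}"
  unfolding gauss_ccdf_def by (rule arg_cong[where f = "measure _"]) auto

section \<open>Lipschitz surrogates of the indicator and the comparison of tails\<close>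

definition ramp :: "real \<Rightarrow> real \<Rightarrow> real \<Rightarrow> real" where
  "ramp c w y = min 1 (max 0 ((y - c) / w))"

lemma ramp_01: "0 \<le> ramp c w y" "ramp c w y \<le> 1"
  by (auto simp: ramp_def)

lemma ramp_eq_0: "w > 0 \<Longrightarrow> y \<le> c \<Longrightarrow> ramp c w y = 0"
  by (simp add: ramp_def divide_nonpos_pos max_absorb1)

lemma ramp_eq_1: "w > 0 \<Longrightarrow> y \<ge> c + w \<Longrightarrow> ramp c w y = 1"
  by (simp add: ramp_def min_absorb1 le_max_iff_disj)

lemma ramp_measurable[measurable]: "ramp c w \<in> borel_measurable borel"
  unfolding ramp_def[abs_def] by measurable

lemma ramp_lipschitz:
  assumes "w > 0"
  shows "\<bar>ramp c w x - ramp c w y\<bar> \<le> 1 / w * \<bar>x - y\<bar>"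
proof -
  have "\<bar>ramp c w x - ramp c w y\<bar> \<le> \<bar>(x - c) / w - (y - c) / w\<bar>"
    unfolding ramp_def by (auto simp: min_def max_def abs_if)
  also have "(x - c) / w - (y - c) / w = (x - y) / w" by (simp add: diff_divide_distrib)
  finally show ?thesis using assms by simp
qed

context prob_space
begin

lemma integrable_ramp:
  assumes [measurable]: "X \<in> borel_measurable M"
  shows "integrable M (\<lambda>\<omega>. ramp c w (X \<omega>))"
  by (rule integrable_const_bound[of _ 1]) (auto simp: ramp_01)

lemma ramp_diff:
  assumes w: "w > 0" and [measurable]: "X \<in> borel_measurable M" "Y \<in> borel_measurable M"
    and i: "integrable M (\<lambda>\<omega>. Y \<omega> - X \<omega>)"
  shows "\<bar>expectation (\<lambda>\<omega>. ramp c w (Y \<omega>)) - expectation (\<lambda>\<omega>. ramp c w (X \<omega>))\<bar>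
    \<le> 1 / w * expectation (\<lambda>\<omega>. \<bar>Y \<omega> - X \<omega>\<bar>)"
proof -
  have "\<bar>expectation (\<lambda>\<omega>. ramp c w (Y \<omega>)) - expectation (\<lambda>\<omega>. ramp c w (X \<omega>))\<bar>
      = \<bar>expectation (\<lambda>\<omega>. ramp c w (Y \<omega>) - ramp c w (X \<omega>))\<bar>"
    by (simp add: integrable_ramp)
  also have "\<dots> \<le> expectation (\<lambda>\<omega>. 1 / w * \<bar>Y \<omega> - X \<omega>\<bar>)"
  proof (rule order_trans[OF integral_abs_bound], rule integral_mono)
    show "integrable M (\<lambda>\<omega>. \<bar>ramp c w (Y \<omega>) - ramp c w (X \<omega>)\<bar>)"
      by (intro integrable_abs Bochner_Integration.integrable_diff integrable_ramp) measurable
    show "integrable M (\<lambda>\<omega>. 1 / w * \<bar>Y \<omega> - X \<omega>\<bar>)"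
      by (intro integrable_mult_right integrable_abs i)
  qed (rule ramp_lipschitz[OF w])
  finally show ?thesis by simp
qed

text \<open>\<open>d\<close> is kept apart from \<open>c\<close> so that the ramps starting at
  \<open>a\<close> and at \<open>(1 - \<rho>) a\<close> share the bound with
  \<open>d = a / 2\<close>.\<close>

lemma ramp_chebyshev:
  assumes w: "w > 0" and c: "0 < d" "d \<le> c" and X: "square_integrable X"
  shows "expectation (\<lambda>\<omega>. ramp c w (X \<omega>)) \<le> expectation (\<lambda>\<omega>. (X \<omega>)\<^sup>2) / d\<^sup>2"
proof -
  have "expectation (\<lambda>\<omega>. ramp c w (X \<omega>)) \<le> expectation (\<lambda>\<omega>. (X \<omega>)\<^sup>2 / d\<^sup>2)"
  proof (intro integral_mono)
    fix \<omega>
    show "ramp c w (X \<omega>) \<le> (X \<omega>)\<^sup>2 / d\<^sup>2"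
    proof (cases "X \<omega> \<le> c")
      case False
      then have "d\<^sup>2 \<le> (X \<omega>)\<^sup>2" using c by (intro power_mono) auto
      then have "1 \<le> (X \<omega>)\<^sup>2 / d\<^sup>2" using c by simp
      then show ?thesis using ramp_01(2)[of c w "X \<omega>"] by linarith
    qed (simp add: ramp_eq_0 w)
  qed (use X in \<open>auto intro!: integrable_ramp simp: square_integrable_real\<close>)
  then show ?thesis by simp
qed

text \<open>The error term \<open>A / \<tau>\<close> of the normal approximation blows up for small \<open>\<tau>\<close>; there Chebyshev's
  inequality takes over, and the geometric mean of the two bounds is harmless.\<close>

lemma tail_comparison:
  fixes X Y :: "'a \<Rightarrow> real"
  assumes X: "square_integrable X" and Y: "Y \<in> borel_measurable M"
    and i: "integrable M (\<lambda>\<omega>. Y \<omega> - X \<omega>)" and eps: "expectation (\<lambda>\<omega>. \<bar>Y \<omega> - X \<omega>\<bar>) \<le> \<epsilon>"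
    and var: "expectation (\<lambda>\<omega>. (X \<omega>)\<^sup>2) = \<tau>\<^sup>2" and pos: "\<tau> \<ge> 0" "\<sigma> \<ge> 0" "a > 0" "A \<ge> 0"
    and \<rho>: "0 < \<rho>" "\<rho> \<le> 1 / 2"
    and clt: "\<And>g B. \<tau> > 0 \<Longrightarrow> (\<And>y. 0 \<le> g y) \<Longrightarrow> (\<And>y. g y \<le> 1) \<Longrightarrow>
      (\<And>y y'. \<bar>g y - g y'\<bar> \<le> B * \<bar>y - y'\<bar>) \<Longrightarrow>
      \<bar>expectation (\<lambda>\<omega>. g (X \<omega>)) - (\<integral>z. g (\<tau> * z) \<partial>std_normal_distribution)\<bar> \<le> A * (1 / \<tau> + B)"
  shows "\<bar>prob {\<omega> \<in> space M. Y \<omega> > a} - gauss_ccdf (ereal a / ereal \<sigma>)\<bar>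
    \<le> (\<epsilon> / \<rho> + A / \<rho> + 2 * sqrt (A * \<tau>) + \<bar>\<tau> - \<sigma>\<bar> / \<rho> + 4 * \<rho> * \<sigma>) / a"
proof -
  interpret N: prob_space std_normal_distribution by (rule prob_space_std_normal)
  note [measurable] = square_integrableD(1)[OF X] Y
  define w where "w = \<rho> * a"
  have w: "w > 0" using \<rho> pos by (simp add: w_def)
  define E where "E = (\<epsilon> / \<rho> + A / \<rho> + 2 * sqrt (A * \<tau>) + \<bar>\<tau> - \<sigma>\<bar> / \<rho>) / a"
  have NL2: "N.square_integrable (\<lambda>z. c * z)" for c :: real
    using std_normal_second_moment(1) by (simp add: N.square_integrable_real power_mult_distrib)
  \<comment> \<open>Three replacements: \<open>Y\<close> by \<open>X\<close>, \<open>X\<close> by a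
    Gaussian with standard deviation \<tau>, and \<tau> by \<sigma>. The condition on
    \<open>c\<close> covers both ramps used below, since \<open>\<rho> \<le> 1 / 2\<close>.\<close>
  have core: "\<bar>expectation (\<lambda>\<omega>. ramp c w (Y \<omega>)) - (\<integral>z. ramp c w (\<sigma> * z) \<partial>std_normal_distribution)\<bar> \<le> E"
    if c: "a / 2 \<le> c" for c
  proof -
    have 1: "\<bar>expectation (\<lambda>\<omega>. ramp c w (Y \<omega>)) - expectation (\<lambda>\<omega>. ramp c w (X \<omega>))\<bar> \<le> 1 / w * \<epsilon>"
      using w by (intro order_trans[OF ramp_diff[OF w _ Y i]] mult_left_mono eps) auto
    let ?d = "\<bar>expectation (\<lambda>\<omega>. ramp c w (X \<omega>)) - (\<integral>z. ramp c w (\<tau> * z) \<partial>std_normal_distribution)\<bar>"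
    have cheb: "?d \<le> 4 * \<tau>\<^sup>2 / a\<^sup>2"
    proof -
      have "expectation (\<lambda>\<omega>. ramp c w (X \<omega>)) \<le> \<tau>\<^sup>2 / (a / 2)\<^sup>2"
        unfolding var[symmetric] using pos by (intro ramp_chebyshev w c X) auto
      moreover have "(\<integral>z. ramp c w (\<tau> * z) \<partial>std_normal_distribution) \<le> (\<integral>z. (\<tau> * z)\<^sup>2 \<partial>std_normal_distribution) / (a / 2)\<^sup>2"
        using pos by (intro N.ramp_chebyshev w c NL2) auto
      moreover have "(\<integral>z. (\<tau> * z)\<^sup>2 \<partial>std_normal_distribution) = \<tau>\<^sup>2"
        using std_normal_second_moment by (simp add: power_mult_distrib)
      moreover have "0 \<le> expectation (\<lambda>\<omega>. ramp c w (X \<omega>))" "0 \<le> (\<integral>z. ramp c w (\<tau> * z) \<partial>std_normal_distribution)"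
        by (intro Bochner_Integration.integral_nonneg ramp_01)+
      moreover have "\<tau>\<^sup>2 / (a / 2)\<^sup>2 = 4 * \<tau>\<^sup>2 / a\<^sup>2" by (simp add: power_divide)
      ultimately show ?thesis by (simp add: abs_le_iff)
    qed
    have 2: "?d \<le> A / w + 2 * sqrt (A * \<tau>) / a"
    proof (cases "\<tau> = 0")
      case True
      then have "?d \<le> 0" using cheb by simp
      moreover have "0 \<le> A / w + 2 * sqrt (A * \<tau>) / a"
        using w pos by (intro add_nonneg_nonneg divide_nonneg_nonneg mult_nonneg_nonneg) auto
      ultimately show ?thesis by linarith
    next
      case False
      then have tp: "\<tau> > 0" using pos by simp
      have "?d \<le> A * (1 / \<tau> + 1 / w)" by (intro clt tp ramp_01 ramp_lipschitz w)
      then have d1: "?d - A / w \<le> A / \<tau>" by (simp add: algebra_simps)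
      show ?thesis
      proof (cases "?d \<le> A / w")
        case True
        then show ?thesis using pos by (simp add: add_increasing2)
      next
        case False
        then have p: "0 \<le> ?d - A / w" by simp
        have "0 \<le> A / w" using w pos by simp
        then have d2: "?d - A / w \<le> 4 * \<tau>\<^sup>2 / a\<^sup>2" using cheb by linarith
        \<comment> \<open>One factor is bounded by the normal approximation and the other by
          Chebyshev. In the product the negative power of \<tau> disappears.\<close>
        have "(?d - A / w)\<^sup>2 \<le> (A / \<tau>) * (4 * \<tau>\<^sup>2 / a\<^sup>2)"
          unfolding power2_eq_square[of "?d - A / w"] using p pos by (intro mult_mono d1 d2) auto
        also have "\<dots> = (2 * sqrt (A * \<tau>) / a)\<^sup>2"
          using tp pos by (simp add: power_divide power_mult_distrib power2_eq_square[of \<tau>])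
        finally have "?d - A / w \<le> 2 * sqrt (A * \<tau>) / a"
          using pos by (intro power2_le_imp_le[of "?d - A / w"]) auto
        then show ?thesis by simp
      qed
    qed
    have 3: "\<bar>(\<integral>z. ramp c w (\<tau> * z) \<partial>std_normal_distribution) - (\<integral>z. ramp c w (\<sigma> * z) \<partial>std_normal_distribution)\<bar>
        \<le> 1 / w * \<bar>\<tau> - \<sigma>\<bar>"
    proof -
      have int: "integrable std_normal_distribution (\<lambda>z. \<tau> * z - \<sigma> * z)"
        using N.square_integrable_integrable[OF NL2] by (intro Bochner_Integration.integrable_diff)
      have "(\<integral>z. \<bar>\<tau> * z - \<sigma> * z\<bar> \<partial>std_normal_distribution) = \<bar>\<tau> - \<sigma>\<bar> * (\<integral>z. \<bar>z\<bar> \<partial>std_normal_distribution)"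
        by (simp add: left_diff_distrib[symmetric] abs_mult)
      also have "\<dots> \<le> \<bar>\<tau> - \<sigma>\<bar> * 1" using std_normal_first_moment(2) by (intro mult_left_mono) auto
      finally show ?thesis using w
        by (intro order_trans[OF N.ramp_diff[OF w _ _ int]] mult_left_mono) auto
    qed
    have "1 / w * \<epsilon> + (A / w + 2 * sqrt (A * \<tau>) / a) + 1 / w * \<bar>\<tau> - \<sigma>\<bar> = E"
      using pos \<rho> by (simp add: E_def w_def add_divide_distrib)
    then show ?thesis using 1 2 3 by linarith
  qed
  \<comment> \<open>The smoothing bias. Of width \<open>\<rho> a\<close>, the ramp from
    \<open>a\<close> is full beyond \<open>(1 + \<rho>) a\<close>, and the one from
    \<open>(1 - \<rho>) a\<close> vanishes below its start; each differs from the tail by at most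
    the mass of one interval of relative width \<rho>.\<close>
  have gauss: "gauss_ccdf (ereal a / ereal \<sigma>) \<le> (\<integral>z. ramp a w (\<sigma> * z) \<partial>std_normal_distribution) + 4 * \<rho> * \<sigma> / a
      \<and> (\<integral>z. ramp ((1 - \<rho>) * a) w (\<sigma> * z) \<partial>std_normal_distribution) \<le> gauss_ccdf (ereal a / ereal \<sigma>) + 4 * \<rho> * \<sigma> / a"
  proof (cases "\<sigma> = 0")
    case True
    have "0 \<le> (1 - \<rho>) * a" using \<rho> pos by simp
    then have r: "ramp a w 0 = 0" "ramp ((1 - \<rho>) * a) w 0 = 0" using pos w by (auto intro!: ramp_eq_0)
    have "gauss_ccdf (ereal a / ereal \<sigma>) = 0" using pos True by (simp add: gauss_ccdf_def)
    then show ?thesis using True r by simp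
  next
    case False
    then have sp: "\<sigma> > 0" using pos by simp
    define t where "t = a / \<sigma>"
    have t: "t > 0" using pos sp by (simp add: t_def)
    have ccdf: "gauss_ccdf (ereal a / ereal \<sigma>) = measure std_normal_distribution {t<..}"
      using sp by (simp add: gauss_ccdf_ereal[symmetric] t_def)
    have split: "measure std_normal_distribution {p<..} = measure std_normal_distribution {p<..p'} + measure std_normal_distribution {p'<..}"
      if "p \<le> p'" for p p' :: real
    proof -
      have "{p<..} = {p<..p'} \<union> {p'<..}" using that by auto
      then have "measure std_normal_distribution {p<..} = measure std_normal_distribution ({p<..p'} \<union> {p'<..})"
        by (rule arg_cong)
      also have "\<dots> = measure std_normal_distribution {p<..p'} + measure std_normal_distribution {p'<..}"
        by (rule N.finite_measure_Union) auto
      finally show ?thesis .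
    qed
    have "measure std_normal_distribution {t<..(1 + \<rho>) * t} \<le> ((1 + \<rho>) * t - t) / t\<^sup>2"
      using t \<rho> by (intro std_normal_interval) (auto simp: algebra_simps)
    also have "\<dots> = \<rho> / t" using t by (simp add: power2_eq_square field_simps)
    also have "\<dots> \<le> 4 * \<rho> / t" using t \<rho> by (intro divide_right_mono) auto
    finally have lo: "measure std_normal_distribution {t<..} \<le> 4 * \<rho> / t + measure std_normal_distribution {(1 + \<rho>) * t<..}"
      using split[of t "(1 + \<rho>) * t"] t \<rho> by (simp add: algebra_simps)
    have "measure std_normal_distribution {(1 - \<rho>) * t<..t} \<le> (t - (1 - \<rho>) * t) / ((1 - \<rho>) * t)\<^sup>2"
      using t \<rho> by (intro std_normal_interval) (auto simp: algebra_simps)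
    \<comment> \<open>As \<open>\<rho> \<le> 1 / 2\<close>, the lower endpoint stays above
      \<open>t / 2\<close>; this side is the source of the factor 4.\<close>
    also have "\<dots> \<le> (\<rho> * t) / (t / 2)\<^sup>2"
    proof (intro frac_le power_mono)
      show "t / 2 \<le> (1 - \<rho>) * t" using mult_right_mono[of "1 / 2" "1 - \<rho>" t] t \<rho> by simp
    qed (use t \<rho> in \<open>auto simp: algebra_simps\<close>)
    also have "\<dots> = 4 * \<rho> / t" using t by (simp add: power2_eq_square)
    finally have up: "measure std_normal_distribution {(1 - \<rho>) * t<..} \<le> 4 * \<rho> / t + measure std_normal_distribution {t<..}"
      using split[of "(1 - \<rho>) * t" t] t \<rho> by (simp add: algebra_simps)
    have "measure std_normal_distribution {(1 + \<rho>) * t<..} = (\<integral>z. indicator {(1 + \<rho>) * t<..} z \<partial>std_normal_distribution)"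
      by simp
    also have "\<dots> \<le> (\<integral>z. ramp a w (\<sigma> * z) \<partial>std_normal_distribution)"
    proof (intro integral_mono N.integrable_ramp)
      fix z
      have "ramp a w (\<sigma> * z) = 1" if "z > (1 + \<rho>) * t"
      proof (rule ramp_eq_1[OF w])
        have "\<sigma> * ((1 + \<rho>) * t) \<le> \<sigma> * z" using that sp by (intro mult_left_mono) auto
        moreover have "\<sigma> * ((1 + \<rho>) * t) = a + w" using sp by (simp add: t_def w_def field_simps)
        ultimately show "a + w \<le> \<sigma> * z" by simp
      qed
      then show "indicator {(1 + \<rho>) * t<..} z \<le> ramp a w (\<sigma> * z)"
        by (auto simp: ramp_01 split: split_indicator)
    qed (auto intro!: integrable_real_indicator simp: N.emeasure_eq_measure)
    finally have lo': "measure std_normal_distribution {(1 + \<rho>) * t<..} \<le> (\<integral>z. ramp a w (\<sigma> * z) \<partial>std_normal_distribution)" .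
    have "(\<integral>z. ramp ((1 - \<rho>) * a) w (\<sigma> * z) \<partial>std_normal_distribution) \<le> (\<integral>z. indicator {(1 - \<rho>) * t<..} z \<partial>std_normal_distribution)"
    proof (intro integral_mono N.integrable_ramp)
      fix z
      have "ramp ((1 - \<rho>) * a) w (\<sigma> * z) = 0" if "\<not> z > (1 - \<rho>) * t"
      proof (rule ramp_eq_0[OF w])
        have "\<sigma> * z \<le> \<sigma> * ((1 - \<rho>) * t)" using that sp by (intro mult_left_mono) auto
        then show "\<sigma> * z \<le> (1 - \<rho>) * a" using sp by (simp add: t_def)
      qed
      then show "ramp ((1 - \<rho>) * a) w (\<sigma> * z) \<le> indicator {(1 - \<rho>) * t<..} z"
        by (auto simp: ramp_01 split: split_indicator)
    qed (auto intro!: integrable_real_indicator simp: N.emeasure_eq_measure)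
    also have "\<dots> = measure std_normal_distribution {(1 - \<rho>) * t<..}" by simp
    finally have up': "(\<integral>z. ramp ((1 - \<rho>) * a) w (\<sigma> * z) \<partial>std_normal_distribution) \<le> measure std_normal_distribution {(1 - \<rho>) * t<..}" .
    have "4 * \<rho> / t = 4 * \<rho> * \<sigma> / a" by (simp add: t_def)
    then show ?thesis unfolding ccdf using lo up lo' up' by linarith
  qed
  have P: "prob {\<omega> \<in> space M. Y \<omega> > a} = expectation (\<lambda>\<omega>. indicator {\<omega> \<in> space M. Y \<omega> > a} \<omega>)"
    by simp
  have indY: "integrable M (indicat_real {\<omega> \<in> space M. Y \<omega> > a})"
    using Y by (intro integrable_real_indicator) (auto simp: emeasure_eq_measure)
  have Pu: "prob {\<omega> \<in> space M. Y \<omega> > a} \<le> expectation (\<lambda>\<omega>. ramp ((1 - \<rho>) * a) w (Y \<omega>))"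
    unfolding P
  proof (intro integral_mono integrable_ramp Y)
    fix \<omega>
    have "ramp ((1 - \<rho>) * a) w (Y \<omega>) = 1" if "Y \<omega> > a"
      using that by (intro ramp_eq_1[OF w]) (simp add: w_def algebra_simps)
    then show "indicator {\<omega> \<in> space M. Y \<omega> > a} \<omega> \<le> ramp ((1 - \<rho>) * a) w (Y \<omega>)"
      by (auto simp: ramp_01 split: split_indicator)
  qed (rule indY)
  have Pl: "expectation (\<lambda>\<omega>. ramp a w (Y \<omega>)) \<le> prob {\<omega> \<in> space M. Y \<omega> > a}"
    unfolding P
  proof (intro integral_mono integrable_ramp Y)
    fix \<omega> assume "\<omega> \<in> space M"
    then show "ramp a w (Y \<omega>) \<le> indicator {\<omega> \<in> space M. Y \<omega> > a} \<omega>"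
      using ramp_eq_0[OF w, of "Y \<omega>" a] by (auto simp: ramp_01 split: split_indicator)
  qed (rule indY)
  have c: "a / 2 \<le> a" "a / 2 \<le> (1 - \<rho>) * a" using pos \<rho> mult_right_mono[of "1 / 2" "1 - \<rho>" a] by auto
  have "\<bar>prob {\<omega> \<in> space M. Y \<omega> > a} - gauss_ccdf (ereal a / ereal \<sigma>)\<bar> \<le> E + 4 * \<rho> * \<sigma> / a"
    using Pu Pl core[OF c(1)] core[OF c(2)] gauss by (simp add: abs_le_iff)
  also have "\<dots> = (\<epsilon> / \<rho> + A / \<rho> + 2 * sqrt (A * \<tau>) + \<bar>\<tau> - \<sigma>\<bar> / \<rho> + 4 * \<rho> * \<sigma>) / a"
    by (simp add: E_def add_divide_distrib)
  finally show ?thesis .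
qed

end

section \<open>Normal approximation of the linear part\<close>

context sa_process
begin

text \<open>The covariance may be singular, but the noise vanishes almost surely in its kernel. This makes the
  normal approximation uniform over all directions.\<close>

lemma bn_degenerate: "\<exists>\<kappa>\<ge>0. \<forall>j c. AE \<omega> in M. (c \<bullet> bn j \<omega>)\<^sup>2 \<le> \<kappa> * (c \<bullet> (\<Sigma>\<^sub>b *v c)) * (norm (bn j \<omega>))\<^sup>2"
proof -
  have sym: "transpose \<Sigma>\<^sub>b = \<Sigma>\<^sub>b" and psd: "\<And>c. 0 \<le> c \<bullet> (\<Sigma>\<^sub>b *v c)"
    using Sigma_pos by (auto simp: pos_semidef_def)
  obtain E where E: "finite E" "pairwise orthogonal E" "\<forall>e\<in>E. norm e = 1" "span E = UNIV"
    and eig: "\<forall>e\<in>E. \<Sigma>\<^sub>b *v e = (e \<bullet> (\<Sigma>\<^sub>b *v e)) *\<^sub>R e"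
    using symmetric_eigenbasis[OF sym] by blast
  define ev where "ev e = e \<bullet> (\<Sigma>\<^sub>b *v e)" for e
  have ln: "ev e \<ge> 0" for e unfolding ev_def by (rule psd)
  define P where "P = {e \<in> E. ev e > 0}"
  have P: "finite P" "P \<subseteq> E" using E by (auto simp: P_def)
  \<comment> \<open>The trace of the pseudo-inverse of \<open>\<Sigma>\<^sub>b\<close>: each squared
    coordinate of \<open>c\<close> along \<open>P\<close> is at most the form at \<open>c\<close>
    divided by the eigenvalue.\<close>
  define \<kappa> where "\<kappa> = (\<Sum>e\<in>P. 1 / ev e)"
  have \<kappa>: "\<kappa> \<ge> 0" unfolding \<kappa>_def by (intro sum_nonneg) (simp add: ln)
  \<comment> \<open>In an eigendirection with eigenvalue 0 the noise has second moment 0, so it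
    vanishes almost surely there.\<close>
  have zero: "AE \<omega> in M. \<forall>e\<in>E - P. bn j \<omega> \<bullet> e = 0" for j
  proof (intro AE_finite_allI)
    fix e assume "e \<in> E - P"
    then have "ev e = 0" using ln[of e] by (auto simp: P_def)
    then have "expectation (\<lambda>\<omega>. (e \<bullet> bn j \<omega>)\<^sup>2) = 0"
      using bn_cov[of e j e] by (simp add: ev_def power2_eq_square)
    moreover have "integrable M (\<lambda>\<omega>. (e \<bullet> bn j \<omega>)\<^sup>2)"
      using square_integrable_inner_left[OF bn_L2] by (simp add: square_integrable_real)
    ultimately have "AE \<omega> in M. (e \<bullet> bn j \<omega>)\<^sup>2 = 0"
      using integral_nonneg_eq_0_iff_AE[of M "\<lambda>\<omega>. (e \<bullet> bn j \<omega>)\<^sup>2"] by simp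
    then show "AE \<omega> in M. bn j \<omega> \<bullet> e = 0" by (simp add: inner_commute)
  qed (use E in auto)
  have "AE \<omega> in M. (c \<bullet> bn j \<omega>)\<^sup>2 \<le> \<kappa> * (c \<bullet> (\<Sigma>\<^sub>b *v c)) * (norm (bn j \<omega>))\<^sup>2" for j c
    using zero[of j]
  proof (rule eventually_mono)
    fix \<omega> assume z: "\<forall>e\<in>E - P. bn j \<omega> \<bullet> e = 0"
    let ?b = "bn j \<omega>"
    have "c \<bullet> ?b = (\<Sum>e\<in>E. (c \<bullet> e) * (?b \<bullet> e))" by (rule orthonormal_basis_inner[OF E])
    also have "\<dots> = (\<Sum>e\<in>P. (c \<bullet> e) * (?b \<bullet> e))"
      using z by (intro sum.mono_neutral_right E P) auto
    finally have "(c \<bullet> ?b)\<^sup>2 = (\<Sum>e\<in>P. (c \<bullet> e) * (?b \<bullet> e))\<^sup>2" by simp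
    also have "\<dots> \<le> (\<Sum>e\<in>P. (c \<bullet> e)\<^sup>2) * (\<Sum>e\<in>P. (?b \<bullet> e)\<^sup>2)" by (rule Cauchy_Schwarz_ineq_sum)
    also have "\<dots> \<le> (\<kappa> * (c \<bullet> (\<Sigma>\<^sub>b *v c))) * (norm ?b)\<^sup>2"
    proof (intro mult_mono)
      have "(\<Sum>e\<in>P. (c \<bullet> e)\<^sup>2) = (\<Sum>e\<in>P. 1 / ev e * (ev e * (c \<bullet> e)\<^sup>2))"
        by (intro sum.cong) (auto simp: P_def)
      also have "\<dots> \<le> (\<Sum>e\<in>P. 1 / ev e * (c \<bullet> (\<Sigma>\<^sub>b *v c)))"
      proof (intro sum_mono mult_left_mono)
        fix e assume "e \<in> P"
        have "c \<bullet> (\<Sigma>\<^sub>b *v c) = (\<Sum>e\<in>E. ev e * (c \<bullet> e)\<^sup>2)"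
          using eigenbasis_quadratic[OF sym E eig, of c c] by (simp add: ev_def power2_eq_square)
        then show "ev e * (c \<bullet> e)\<^sup>2 \<le> c \<bullet> (\<Sigma>\<^sub>b *v c)"
          using member_le_sum[of e E "\<lambda>e. ev e * (c \<bullet> e)\<^sup>2"] \<open>e \<in> P\<close> P E ln by auto
      qed (simp add: ln)
      also have "\<dots> = \<kappa> * (c \<bullet> (\<Sigma>\<^sub>b *v c))" by (simp add: \<kappa>_def sum_distrib_right)
      finally show "(\<Sum>e\<in>P. (c \<bullet> e)\<^sup>2) \<le> \<kappa> * (c \<bullet> (\<Sigma>\<^sub>b *v c))" .
      have "(\<Sum>e\<in>P. (?b \<bullet> e)\<^sup>2) \<le> (\<Sum>e\<in>E. (?b \<bullet> e)\<^sup>2)" by (intro sum_mono2 E P) auto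
      also have "\<dots> = (norm ?b)\<^sup>2"
        unfolding power2_norm_eq_inner orthonormal_basis_inner[OF E, of ?b ?b] by (simp add: power2_eq_square)
      finally show "(\<Sum>e\<in>P. (?b \<bullet> e)\<^sup>2) \<le> (norm ?b)\<^sup>2" .
    qed (use \<kappa> psd in \<open>auto intro!: sum_nonneg\<close>)
    finally show "(c \<bullet> ?b)\<^sup>2 \<le> \<kappa> * (c \<bullet> (\<Sigma>\<^sub>b *v c)) * (norm ?b)\<^sup>2" .
  qed
  with \<kappa> show ?thesis by blast
qed

lemma inner_bn_cube_integrable: "integrable M (\<lambda>\<omega>. \<bar>c \<bullet> bn j \<omega>\<bar> ^ 3)"
proof (rule Bochner_Integration.integrable_bound)
  note [measurable] = bn_meas[of j]
  show "integrable M (\<lambda>\<omega>. norm c ^ 3 * norm (bn j \<omega>) ^ 3)" using bn_cube by simp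
  show "(\<lambda>\<omega>. \<bar>c \<bullet> bn j \<omega>\<bar> ^ 3) \<in> borel_measurable M" by measurable
  show "AE \<omega> in M. norm (\<bar>c \<bullet> bn j \<omega>\<bar> ^ 3) \<le> norm (norm c ^ 3 * norm (bn j \<omega>) ^ 3)"
    by (intro AE_I2) (simp add: power_mult_distrib[symmetric] power_mono Cauchy_Schwarz_ineq2)
qed

text \<open>The bound is linear in the variance along \<open>c\<close> rather than cubic in the
  norm. Summed over coefficients, it is at most the largest norm times the total variance, so the
  number of summands does not enter, even for singular \<open>\<Sigma>\<^sub>b\<close>.\<close>

lemma bn_third_moment:
  "\<exists>C\<ge>0. \<forall>j c. expectation (\<lambda>\<omega>. \<bar>c \<bullet> bn j \<omega>\<bar> ^ 3) \<le> C * norm c * (c \<bullet> (\<Sigma>\<^sub>b *v c))"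
proof -
  obtain \<kappa> where \<kappa>: "\<kappa> \<ge> 0"
    "\<And>j c. AE \<omega> in M. (c \<bullet> bn j \<omega>)\<^sup>2 \<le> \<kappa> * (c \<bullet> (\<Sigma>\<^sub>b *v c)) * (norm (bn j \<omega>))\<^sup>2"
    using bn_degenerate by blast
  define \<beta> where "\<beta> = expectation (\<lambda>\<omega>. norm (bn 0 \<omega>) ^ 3)"
  have \<beta>: "\<beta> \<ge> 0" unfolding \<beta>_def by (intro Bochner_Integration.integral_nonneg) auto
  have same: "expectation (\<lambda>\<omega>. norm (bn j \<omega>) ^ 3) = \<beta>" for j
  proof -
    have m: "(\<lambda>y. norm (b y) ^ 3) \<in> borel_measurable Nw" using b_meas by measurable
    have "expectation (\<lambda>\<omega>. norm (bn j \<omega>) ^ 3) = (\<integral>y. norm (b y) ^ 3 \<partial>distr M Nw (w j))" for j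
      unfolding bn_def by (rule integral_distr[symmetric, OF w_meas m])
    then show ?thesis unfolding \<beta>_def using w_distr[of j] by simp
  qed
  have "expectation (\<lambda>\<omega>. \<bar>c \<bullet> bn j \<omega>\<bar> ^ 3) \<le> (\<kappa> * \<beta>) * norm c * (c \<bullet> (\<Sigma>\<^sub>b *v c))" for j c
  proof -
    let ?v = "c \<bullet> (\<Sigma>\<^sub>b *v c)"
    have "expectation (\<lambda>\<omega>. \<bar>c \<bullet> bn j \<omega>\<bar> ^ 3) \<le> expectation (\<lambda>\<omega>. \<kappa> * norm c * ?v * norm (bn j \<omega>) ^ 3)"
    proof (rule integral_mono_AE)
      show "integrable M (\<lambda>\<omega>. \<bar>c \<bullet> bn j \<omega>\<bar> ^ 3)" by (rule inner_bn_cube_integrable)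
      show "integrable M (\<lambda>\<omega>. \<kappa> * norm c * ?v * norm (bn j \<omega>) ^ 3)" using bn_cube by simp
      show "AE \<omega> in M. \<bar>c \<bullet> bn j \<omega>\<bar> ^ 3 \<le> \<kappa> * norm c * ?v * norm (bn j \<omega>) ^ 3"
        using \<kappa>(2)[of c j]
      proof (rule eventually_mono)
        fix \<omega> assume a: "(c \<bullet> bn j \<omega>)\<^sup>2 \<le> \<kappa> * ?v * (norm (bn j \<omega>))\<^sup>2"
        have "\<bar>c \<bullet> bn j \<omega>\<bar> ^ 3 = \<bar>c \<bullet> bn j \<omega>\<bar> * (c \<bullet> bn j \<omega>)\<^sup>2"
          by (simp add: power2_eq_square power3_eq_cube abs_mult_self_eq mult.assoc)
        also have "\<dots> \<le> (norm c * norm (bn j \<omega>)) * (\<kappa> * ?v * (norm (bn j \<omega>))\<^sup>2)"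
          by (intro mult_mono Cauchy_Schwarz_ineq2 a) auto
        also have "\<dots> = \<kappa> * norm c * ?v * norm (bn j \<omega>) ^ 3" by (simp add: power2_eq_square power3_eq_cube)
        finally show "\<bar>c \<bullet> bn j \<omega>\<bar> ^ 3 \<le> \<kappa> * norm c * ?v * norm (bn j \<omega>) ^ 3" .
      qed
    qed
    also have "\<dots> = (\<kappa> * \<beta>) * norm c * ?v" by (simp add: same)
    finally show ?thesis .
  qed
  with \<kappa> \<beta> show ?thesis by (intro exI[of _ "\<kappa> * \<beta>"]) auto
qed

text \<open>Dividing the coefficients by \<open>sqrt (h k) * \<tau>\<close> normalises the total
  variance to 1 and makes the largest one of order \<open>n^(-1/2) / \<tau>\<close>, which then
  bounds the third-moment sum. The test function becomes \<open>g (\<tau> y)\<close> with Lipschitz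
  constant \<open>B \<tau>\<close>, so Stein's factor \<open>8 + B \<tau>\<close> divided by \<tau>
  gives \<open>1 / \<tau> + B\<close> up to constants.\<close>

lemma normal_approximation:
  "\<exists>C\<ge>0. \<forall>k a \<tau> g B. norm a = 1 \<longrightarrow> \<tau> > 0 \<longrightarrow> T k a / h k = \<tau>\<^sup>2 \<longrightarrow> (\<forall>y. 0 \<le> g y) \<longrightarrow> (\<forall>y. g y \<le> 1) \<longrightarrow>
     (\<forall>y y'. \<bar>g y - g y'\<bar> \<le> B * \<bar>y - y'\<bar>) \<longrightarrow>
     \<bar>expectation (\<lambda>\<omega>. g ((a \<bullet> s k \<omega>) / sqrt (h k))) - (\<integral>z. g (\<tau> * z) \<partial>std_normal_distribution)\<bar>
       \<le> C * (real k + K) powr (- (1 / 2)) * (1 / \<tau> + B)"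
proof -
  obtain C where C: "C \<ge> 0" "\<And>j c. expectation (\<lambda>\<omega>. \<bar>c \<bullet> bn j \<omega>\<bar> ^ 3) \<le> C * norm c * (c \<bullet> (\<Sigma>\<^sub>b *v c))"
    using bn_third_moment by blast
  \<comment> \<open>Product of the coefficient size
    \<open>(2 \<alpha> / n) sqrt (lambda_max V / c\<^sub>q)\<close> and the normalisation
    \<open>sqrt n / (sqrt \<alpha> * \<tau>)\<close>, with \<open>n^(-1/2) / \<tau>\<close> taken
    out.\<close>
  define \<mu> where "\<mu> = 2 * sqrt \<alpha> * sqrt (lambda_max V) / sqrt c\<^sub>q"
  have \<mu>: "\<mu> \<ge> 0" using alpha_pos lambda_pos cq_pos by (simp add: \<mu>_def)
  have "\<bar>expectation (\<lambda>\<omega>. g ((a \<bullet> s k \<omega>) / sqrt (h k))) - (\<integral>z. g (\<tau> * z) \<partial>std_normal_distribution)\<bar>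
       \<le> 16 * (C * \<mu>) * (real k + K) powr (- (1 / 2)) * (1 / \<tau> + B)"
    if a: "norm a = 1" and \<tau>: "\<tau> > 0" and Tk: "T k a / h k = \<tau>\<^sup>2" and g: "\<forall>y. 0 \<le> g y" "\<forall>y. g y \<le> 1"
      and lip: "\<forall>y y'. \<bar>g y - g y'\<bar> \<le> B * \<bar>y - y'\<bar>" for k a \<tau> g B
  proof -
    define n where "n = real k + K"
    have n: "n > 0" using n_ge by (simp add: n_def)
    have B: "B \<ge> 0" using lip[rule_format, of 1 0] by simp
    define \<theta> where "\<theta> = 1 / (sqrt (h k) * \<tau>)"
    have \<theta>: "\<theta> > 0" using h_pos[of k] \<tau> by (simp add: \<theta>_def)
    define c where "c j = \<theta> *\<^sub>R coef k j a" for j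
    have sumX: "(a \<bullet> s k \<omega>) / sqrt (h k) = \<tau> * (\<Sum>j<k. c j \<bullet> bn j \<omega>)" for \<omega>
      using \<tau> by (simp add: s_inner c_def \<theta>_def sum_distrib_left sum_divide_distrib)
    have cov: "expectation (\<lambda>\<omega>. (c j \<bullet> bn j \<omega>)\<^sup>2) = c j \<bullet> (\<Sigma>\<^sub>b *v c j)" for j
      using bn_cov[of "c j" j "c j"] by (simp add: power2_eq_square)
    have "(\<Sum>j<k. c j \<bullet> (\<Sigma>\<^sub>b *v c j)) = \<theta>\<^sup>2 * T k a"
      by (simp add: c_def T_sum matrix_vector_mult_scaleR sum_distrib_left power2_eq_square mult.assoc)
    also have "\<dots> = 1" using \<tau> h_pos[of k] Tk by (simp add: \<theta>_def power_divide power_mult_distrib field_simps)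
    finally have one: "(\<Sum>j<k. c j \<bullet> (\<Sigma>\<^sub>b *v c j)) = 1" .
    have nc: "norm (c j) \<le> \<mu> * n powr (- (1 / 2)) / \<tau>" if "j < k" for j
    proof -
      have "(norm (coef k j a))\<^sup>2 \<le> q (coef k j a) / c\<^sub>q" by (rule norm_le_q)
      also have "\<dots> \<le> 4 * \<alpha>\<^sup>2 / n\<^sup>2 * q a / c\<^sub>q"
        using coef_bound[OF that, of a] cq_pos by (intro divide_right_mono) (auto simp: n_def)
      also have "\<dots> \<le> 4 * \<alpha>\<^sup>2 / n\<^sup>2 * lambda_max V / c\<^sub>q"
        using q_upper[of a] a cq_pos by (intro divide_right_mono mult_left_mono) auto
      finally have "norm (coef k j a) \<le> sqrt (4 * \<alpha>\<^sup>2 / n\<^sup>2 * lambda_max V / c\<^sub>q)" by (rule real_le_rsqrt)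
      also have "\<dots> = 2 * \<alpha> / n * sqrt (lambda_max V) / sqrt c\<^sub>q"
        using alpha_pos n by (simp add: real_sqrt_mult real_sqrt_divide)
      finally have "\<theta> * norm (coef k j a) \<le> \<theta> * (2 * \<alpha> / n * sqrt (lambda_max V) / sqrt c\<^sub>q)"
        by (rule mult_left_mono) (use \<theta> in simp)
      then have "norm (c j) \<le> \<theta> * (2 * \<alpha> / n * sqrt (lambda_max V) / sqrt c\<^sub>q)"
        using \<theta> by (simp add: c_def)
      also have "\<theta> = sqrt n / (sqrt \<alpha> * \<tau>)"
        by (simp add: \<theta>_def h_def n_def real_sqrt_divide)
      also have "sqrt n / (sqrt \<alpha> * \<tau>) * (2 * \<alpha> / n * sqrt (lambda_max V) / sqrt c\<^sub>q) = \<mu> * (1 / sqrt n) / \<tau>"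
      proof -
        define p m where "p = sqrt \<alpha>" and "m = sqrt n"
        have "p > 0" "m > 0" "\<alpha> = p * p" "n = m * m" using alpha_pos n by (auto simp: p_def m_def)
        then show ?thesis
          using \<tau> cq_pos unfolding \<mu>_def p_def[symmetric] m_def[symmetric] by (simp add: field_simps)
      qed
      also have "1 / sqrt n = n powr (- (1 / 2))" using n by (simp add: powr_minus_divide powr_half_sqrt)
      finally show ?thesis .
    qed
    have third: "(\<Sum>j<k. expectation (\<lambda>\<omega>. \<bar>c j \<bullet> bn j \<omega>\<bar> ^ 3)) \<le> C * \<mu> * n powr (- (1 / 2)) / \<tau>"
    proof -
      have "(\<Sum>j<k. expectation (\<lambda>\<omega>. \<bar>c j \<bullet> bn j \<omega>\<bar> ^ 3))
          \<le> (\<Sum>j<k. C * (\<mu> * n powr (- (1 / 2)) / \<tau>) * (c j \<bullet> (\<Sigma>\<^sub>b *v c j)))"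
      proof (intro sum_mono)
        fix j assume "j \<in> {..<k}"
        then have "C * norm (c j) * (c j \<bullet> (\<Sigma>\<^sub>b *v c j)) \<le> C * (\<mu> * n powr (- (1 / 2)) / \<tau>) * (c j \<bullet> (\<Sigma>\<^sub>b *v c j))"
          using C(1) Sigma_pos by (intro mult_right_mono mult_left_mono nc) (auto simp: pos_semidef_def)
        then show "expectation (\<lambda>\<omega>. \<bar>c j \<bullet> bn j \<omega>\<bar> ^ 3) \<le> C * (\<mu> * n powr (- (1 / 2)) / \<tau>) * (c j \<bullet> (\<Sigma>\<^sub>b *v c j))"
          using C(2)[of "c j" j] by linarith
      qed
      also have "\<dots> = C * (\<mu> * n powr (- (1 / 2)) / \<tau>)" unfolding sum_distrib_left[symmetric] one by simp
      finally show ?thesis by simp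
    qed
    have gm: "(\<lambda>z. g (\<tau> * z)) \<in> borel_measurable borel"
    proof -
      have "B-lipschitz_on UNIV g" using lip B by (intro lipschitz_onI) (auto simp: dist_real_def)
      then have "continuous_on UNIV g" by (rule lipschitz_on_continuous_on)
      then have "g \<in> borel_measurable borel" by (rule borel_measurable_continuous_onI)
      then show ?thesis by measurable
    qed
    have "\<bar>expectation (\<lambda>\<omega>. g (\<tau> * (\<Sum>j<k. c j \<bullet> bn j \<omega>))) - (\<integral>t. std_normal_density t * g (\<tau> * t) \<partial>lborel)\<bar>
        \<le> 2 * (8 + B * \<tau>) * (\<Sum>j<k. expectation (\<lambda>\<omega>. \<bar>c j \<bullet> bn j \<omega>\<bar> ^ 3))"
    proof (rule stein_bound[where h = "\<lambda>y. g (\<tau> * y)" and \<xi> = "\<lambda>j \<omega>. c j \<bullet> bn j \<omega>"])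
      fix y y' :: real
      have "\<bar>g (\<tau> * y) - g (\<tau> * y')\<bar> \<le> B * \<bar>\<tau> * y - \<tau> * y'\<bar>" using lip by blast
      also have "\<dots> = B * \<tau> * \<bar>y - y'\<bar>" using \<tau> by (simp add: right_diff_distrib[symmetric] abs_mult)
      finally show "\<bar>g (\<tau> * y) - g (\<tau> * y')\<bar> \<le> B * \<tau> * \<bar>y - y'\<bar>" .
    qed (use bn_indep inner_bn_cube_integrable bn_mean cov one g in auto)
    also have "\<dots> \<le> 2 * (8 + B * \<tau>) * (C * \<mu> * n powr (- (1 / 2)) / \<tau>)"
      using B \<tau> by (intro mult_left_mono third) auto
    also have "\<dots> \<le> 16 * (C * \<mu>) * n powr (- (1 / 2)) * (1 / \<tau> + B)"
    proof -
      have "2 * (8 + B * \<tau>) * (C * \<mu> * n powr (- (1 / 2)) / \<tau>) = C * \<mu> * n powr (- (1 / 2)) * (16 / \<tau> + 2 * B)"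
        using \<tau> by (simp add: field_simps)
      also have "\<dots> \<le> C * \<mu> * n powr (- (1 / 2)) * (16 / \<tau> + 16 * B)"
        using B C \<mu> by (intro mult_left_mono) auto
      finally show ?thesis by (simp add: algebra_simps)
    qed
    finally show ?thesis unfolding sumX std_normal_integral[OF gm] by (simp add: n_def)
  qed
  moreover have "16 * (C * \<mu>) \<ge> 0" using C \<mu> by simp
  ultimately show ?thesis by blast
qed

end

section \<open>The tail bound\<close>

text \<open>Compares standard deviations without a lower bound on either. A variance gap of order
  \<open>1 / n\<close> becomes \<open>n^(-1/2)\<close>, which is still at most
  \<open>n^(-\<delta>/2)\<close>.\<close>

lemma abs_diff_le_sqrt:
  fixes x y :: real
  assumes "x \<ge> 0" "y \<ge> 0"
  shows "\<bar>x - y\<bar> \<le> sqrt \<bar>x\<^sup>2 - y\<^sup>2\<bar>"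
proof (rule real_le_rsqrt)
  have "\<bar>x - y\<bar>\<^sup>2 \<le> \<bar>x - y\<bar> * (x + y)"
    unfolding power2_eq_square using assms by (intro mult_left_mono) auto
  also have "\<dots> = \<bar>x\<^sup>2 - y\<^sup>2\<bar>" using assms by (simp add: power2_eq_square square_diff_square_factored abs_mult)
  finally show "\<bar>x - y\<bar>\<^sup>2 \<le> \<bar>x\<^sup>2 - y\<^sup>2\<bar>" .
qed

context sa_process
begin

lemma T_upper: "\<exists>C\<ge>0. \<forall>k a. norm a = 1 \<longrightarrow> T k a / h k \<le> C"
proof -
  obtain C where C: "C \<ge> 0" "\<And>k a. T k a \<le> C * (1 / (real k + K)) * q a" using T_bound by blast
  have "T k a / h k \<le> C * lambda_max V / \<alpha>" if "norm a = 1" for k a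
  proof -
    define n where "n = real k + K"
    have n: "n > 0" using n_ge by (simp add: n_def)
    have "T k a \<le> C * (1 / n) * lambda_max V"
      using C n q_upper[of a] that by (intro order_trans[OF C(2)]) (auto simp: n_def intro!: mult_left_mono divide_right_mono)
    then have "T k a / (\<alpha> / n) \<le> C * (1 / n) * lambda_max V / (\<alpha> / n)"
      using n alpha_pos by (intro divide_right_mono) auto
    also have "\<dots> = C * lambda_max V / \<alpha>" using n by simp
    finally show ?thesis by (simp add: h_def n_def)
  qed
  moreover have "C * lambda_max V / \<alpha> \<ge> 0" using C lambda_pos alpha_pos by simp
  ultimately show ?thesis by blast
qed

text \<open>With \<open>p = n^(-\<delta>/4)\<close> and ramps of relative width
  \<open>p / 2\<close>, the linearisation error, the normal approximation error and the gap of
  standard deviations are of order \<open>p^2\<close> and get divided by \<open>p / 2\<close>; the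
  geometric-mean term and the smoothing bias are of order \<open>p\<close> directly.\<close>

theorem projection_tail_bound:
  assumes S0: "pos_semidef S\<^sub>0"
  shows "\<exists>C. \<forall>k. \<forall>t > 0. \<forall>a. norm a = 1 \<longrightarrow>
    \<bar>prob {\<omega> \<in> space M. (e k \<omega> /\<^sub>R sqrt (h k)) \<bullet> a > t}
       - gauss_ccdf (ereal t / ereal (norm (a v* mat_sqrt (Cov S\<^sub>0 k))))\<bar>
    \<le> C * (1 / (real k + K) powr (\<delta> / 4)) * (1 / t)"
proof -
  obtain C1 where C1: "C1 \<ge> 0"
    "\<And>k a. norm a = 1 \<Longrightarrow> expectation (\<lambda>\<omega>. \<bar>a \<bullet> z k \<omega>\<bar>) \<le> C1 * (real k + K) powr (- ((1 + \<delta>) / 2))"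
    using error_bound by blast
  obtain C2 where C2: "C2 \<ge> 0"
    "\<forall>k a \<tau> g B. norm a = 1 \<longrightarrow> \<tau> > 0 \<longrightarrow> T k a / h k = \<tau>\<^sup>2 \<longrightarrow> (\<forall>y. 0 \<le> g y) \<longrightarrow> (\<forall>y. g y \<le> 1) \<longrightarrow>
     (\<forall>y y'. \<bar>g y - g y'\<bar> \<le> B * \<bar>y - y'\<bar>) \<longrightarrow>
     \<bar>expectation (\<lambda>\<omega>. g ((a \<bullet> s k \<omega>) / sqrt (h k))) - (\<integral>z. g (\<tau> * z) \<partial>std_normal_distribution)\<bar>
       \<le> C2 * (real k + K) powr (- (1 / 2)) * (1 / \<tau> + B)"
    using normal_approximation by blast
  obtain C3 where C3: "C3 \<ge> 0"
    "\<And>k a. \<bar>a \<bullet> (Cov S\<^sub>0 k *v a) - T k a / h k\<bar> \<le> C3 * (1 / (real k + K)) * q a"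
    using Cov_bound by blast
  obtain C4 where C4: "C4 \<ge> 0" "\<And>k a. norm a = 1 \<Longrightarrow> T k a / h k \<le> C4"
    using T_upper by blast
  define \<Lambda> where "\<Lambda> = lambda_max V"
  have \<Lambda>: "\<Lambda> > 0" using lambda_pos by (simp add: \<Lambda>_def)
  define C5 where "C5 = sqrt (C4 + C3 * \<Lambda>)"
  \<comment> \<open>One summand for each of the five error terms of \<open>tail_comparison\<close>;
    \<open>C5\<close> and \<open>sqrt C4\<close> bound \<sigma> and \<tau> uniformly in
    \<open>k\<close> and the direction.\<close>
  define C where "C = 2 * (C1 / sqrt \<alpha>) + 2 * C2 + 2 * sqrt (C2 * sqrt C4) + 2 * sqrt (C3 * \<Lambda>) + 2 * C5"
  have "\<bar>prob {\<omega> \<in> space M. (e k \<omega> /\<^sub>R sqrt (h k)) \<bullet> a > t}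
       - gauss_ccdf (ereal t / ereal (norm (a v* mat_sqrt (Cov S\<^sub>0 k))))\<bar>
    \<le> C * (1 / (real k + K) powr (\<delta> / 4)) * (1 / t)" if t: "t > 0" and a: "norm a = 1" for k t a
  proof -
    define n where "n = real k + K"
    have n: "n \<ge> 7" "n > 0" using n_ge by (auto simp: n_def)
    define p where "p = n powr (- (\<delta> / 4))"
    have p: "p > 0" using n by (simp add: p_def)
    have p1: "p \<le> 1" unfolding p_def using n pos by (subst powr_minus_divide) (auto simp: divide_le_eq ge_one_powr_ge_zero)
    have pp: "p * p = n powr (- (\<delta> / 2))" unfolding p_def powr_add[symmetric] by simp
    have half: "n powr (- (1 / 2)) \<le> p * p" unfolding pp using n pos by (intro powr_mono) auto
    define X where "X \<omega> = (a \<bullet> s k \<omega>) / sqrt (h k)" for \<omega>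
    define Y where "Y \<omega> = (e k \<omega> /\<^sub>R sqrt (h k)) \<bullet> a" for \<omega>
    define \<tau> where "\<tau> = sqrt (T k a / h k)"
    define \<sigma> where "\<sigma> = norm (a v* mat_sqrt (Cov S\<^sub>0 k))"
    have hp: "h k > 0" by (rule h_pos)
    have \<tau>2: "\<tau>\<^sup>2 = T k a / h k" unfolding \<tau>_def using T_nonneg[of k a] hp by simp
    have \<tau>0: "\<tau> \<ge> 0" unfolding \<tau>_def using T_nonneg[of k a] hp by simp
    have \<sigma>2: "\<sigma>\<^sup>2 = a \<bullet> (Cov S\<^sub>0 k *v a)" unfolding \<sigma>_def by (rule norm_mat_sqrt[OF Cov_pos_semidef[OF S0]])
    have \<sigma>0: "\<sigma> \<ge> 0" by (simp add: \<sigma>_def)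
    have \<tau>C: "\<tau> \<le> sqrt C4" unfolding \<tau>_def using C4(2)[OF a] by (intro real_sqrt_le_mono)
    have dist2: "\<bar>\<sigma>\<^sup>2 - \<tau>\<^sup>2\<bar> \<le> C3 * \<Lambda> * (1 / n)"
    proof -
      have "\<bar>\<sigma>\<^sup>2 - \<tau>\<^sup>2\<bar> \<le> C3 * (1 / n) * q a" unfolding \<sigma>2 \<tau>2 using C3(2)[of a k] by (simp add: n_def)
      also have "\<dots> \<le> C3 * (1 / n) * \<Lambda>" using q_upper[of a] a C3 n by (intro mult_left_mono) (auto simp: \<Lambda>_def)
      finally show ?thesis by (simp add: mult_ac)
    qed
    have dist: "\<bar>\<tau> - \<sigma>\<bar> \<le> sqrt (C3 * \<Lambda>) * (p * p)"
    proof -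
      have "\<bar>\<tau> - \<sigma>\<bar> \<le> sqrt \<bar>\<tau>\<^sup>2 - \<sigma>\<^sup>2\<bar>" by (rule abs_diff_le_sqrt[OF \<tau>0 \<sigma>0])
      also have "\<dots> \<le> sqrt (C3 * \<Lambda> * (1 / n))" using dist2 by (intro real_sqrt_le_mono) (simp add: abs_minus_commute)
      also have "\<dots> = sqrt (C3 * \<Lambda>) * n powr (- (1 / 2))"
        using n by (simp add: real_sqrt_mult real_sqrt_divide powr_minus_divide powr_half_sqrt)
      also have "\<dots> \<le> sqrt (C3 * \<Lambda>) * (p * p)" using half C3 \<Lambda> by (intro mult_left_mono) auto
      finally show ?thesis .
    qed
    have \<sigma>C: "\<sigma> \<le> C5" unfolding C5_def
    proof (rule real_le_rsqrt)
      have "C3 * \<Lambda> * (1 / n) \<le> C3 * \<Lambda> * 1" using C3 \<Lambda> n by (intro mult_left_mono) auto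
      then show "\<sigma>\<^sup>2 \<le> C4 + C3 * \<Lambda>" using dist2 C4(2)[OF a, of k] \<tau>2 by linarith
    qed
    have XL2: "square_integrable X"
    proof -
      have "square_integrable (\<lambda>\<omega>. (1 / sqrt (h k)) *\<^sub>R (a \<bullet> s k \<omega>))"
        by (intro square_integrable_scaleR square_integrable_inner_left s_L2)
      then show ?thesis by (simp add: X_def[abs_def])
    qed
    have Ym: "Y \<in> borel_measurable M" unfolding Y_def[abs_def] using e_meas[of k] by measurable
    have YX: "Y \<omega> - X \<omega> = (1 / sqrt (h k)) * (a \<bullet> z k \<omega>)" for \<omega>
      by (simp add: X_def Y_def z_def inner_diff_right inner_commute field_simps diff_divide_distrib)
    have iz: "integrable M (\<lambda>\<omega>. a \<bullet> z k \<omega>)"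
      by (intro square_integrable_integrable square_integrable_inner_left z_L2)
    have eps: "expectation (\<lambda>\<omega>. \<bar>Y \<omega> - X \<omega>\<bar>) \<le> C1 / sqrt \<alpha> * (p * p)"
    proof -
      have "expectation (\<lambda>\<omega>. \<bar>Y \<omega> - X \<omega>\<bar>) = 1 / sqrt (h k) * expectation (\<lambda>\<omega>. \<bar>a \<bullet> z k \<omega>\<bar>)"
        unfolding YX using hp by (simp add: abs_mult)
      also have "\<dots> \<le> 1 / sqrt (h k) * (C1 * n powr (- ((1 + \<delta>) / 2)))"
        using C1(2)[OF a, of k] hp by (intro mult_left_mono) (auto simp: n_def)
      also have "1 / sqrt (h k) = n powr (1 / 2) / sqrt \<alpha>"
        using n alpha_pos by (simp add: h_def n_def[symmetric] real_sqrt_divide powr_half_sqrt)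
      also have "n powr (1 / 2) / sqrt \<alpha> * (C1 * n powr (- ((1 + \<delta>) / 2))) = C1 / sqrt \<alpha> * (n powr (1 / 2) * n powr (- ((1 + \<delta>) / 2)))"
        by simp
      also have "n powr (1 / 2) * n powr (- ((1 + \<delta>) / 2)) = p * p"
        unfolding pp powr_add[symmetric] by (simp add: add_divide_distrib)
      finally show ?thesis .
    qed
    have var: "expectation (\<lambda>\<omega>. (X \<omega>)\<^sup>2) = \<tau>\<^sup>2"
      unfolding \<tau>2 X_def T_def using hp by (simp add: power_divide)
    have "\<bar>prob {\<omega> \<in> space M. Y \<omega> > t} - gauss_ccdf (ereal t / ereal \<sigma>)\<bar>
      \<le> (C1 / sqrt \<alpha> * (p * p) / (p / 2) + C2 * (p * p) / (p / 2) + 2 * sqrt (C2 * (p * p) * \<tau>)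
          + \<bar>\<tau> - \<sigma>\<bar> / (p / 2) + 4 * (p / 2) * \<sigma>) / t"
    proof (rule tail_comparison[OF XL2 Ym _ eps var \<tau>0 \<sigma>0 t])
      show "integrable M (\<lambda>\<omega>. Y \<omega> - X \<omega>)" unfolding YX using iz by simp
      fix g :: "real \<Rightarrow> real" and B :: real
      assume "\<tau> > 0" "\<And>y. 0 \<le> g y" "\<And>y. g y \<le> 1" and lip: "\<And>y y'. \<bar>g y - g y'\<bar> \<le> B * \<bar>y - y'\<bar>"
      then have "\<bar>expectation (\<lambda>\<omega>. g (X \<omega>)) - (\<integral>z. g (\<tau> * z) \<partial>std_normal_distribution)\<bar>
          \<le> C2 * n powr (- (1 / 2)) * (1 / \<tau> + B)"
        unfolding X_def n_def using C2(2) a \<tau>2 by auto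
      also have "\<dots> \<le> C2 * (p * p) * (1 / \<tau> + B)"
        using half C2 \<tau>0 lip[of 1 0] by (intro mult_right_mono mult_left_mono) auto
      finally show "\<bar>expectation (\<lambda>\<omega>. g (X \<omega>)) - (\<integral>z. g (\<tau> * z) \<partial>std_normal_distribution)\<bar> \<le> C2 * (p * p) * (1 / \<tau> + B)" .
    qed (use C2 p p1 in auto)
    also have "\<dots> \<le> (C * p) / t"
    proof (intro divide_right_mono)
      have "C1 / sqrt \<alpha> * (p * p) / (p / 2) = 2 * (C1 / sqrt \<alpha>) * p" "C2 * (p * p) / (p / 2) = 2 * C2 * p"
        using p by (simp_all add: field_simps)
      moreover have "\<bar>\<tau> - \<sigma>\<bar> / (p / 2) \<le> sqrt (C3 * \<Lambda>) * (p * p) / (p / 2)"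
        using dist p by (intro divide_right_mono) auto
      moreover have "sqrt (C3 * \<Lambda>) * (p * p) / (p / 2) = 2 * sqrt (C3 * \<Lambda>) * p" using p by (simp add: field_simps)
      moreover have "4 * (p / 2) * \<sigma> \<le> 2 * C5 * p" using \<sigma>C p by simp
      moreover have "sqrt (C2 * (p * p) * \<tau>) \<le> sqrt (C2 * sqrt C4) * p"
      proof -
        have "sqrt (C2 * (p * p) * \<tau>) \<le> sqrt (C2 * (p * p) * sqrt C4)"
          using C2 \<tau>C p by (intro real_sqrt_le_mono mult_left_mono) auto
        also have "C2 * (p * p) * sqrt C4 = (C2 * sqrt C4) * p\<^sup>2" by (simp add: power2_eq_square)
        finally show ?thesis using p by (simp only: real_sqrt_mult real_sqrt_abs abs_of_pos)
      qed
      ultimately show "C1 / sqrt \<alpha> * (p * p) / (p / 2) + C2 * (p * p) / (p / 2) + 2 * sqrt (C2 * (p * p) * \<tau>)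
          + \<bar>\<tau> - \<sigma>\<bar> / (p / 2) + 4 * (p / 2) * \<sigma> \<le> C * p"
        unfolding C_def by (simp add: distrib_right)
    qed (use t in simp)
    also have "\<dots> = C * (1 / n powr (\<delta> / 4)) * (1 / t)" by (simp add: p_def powr_minus_divide)
    finally show ?thesis by (simp add: Y_def \<sigma>_def n_def)
  qed
  then show ?thesis by blast
qed

end

theorem proposition5p1:
  fixes F R :: "real ^ 'd \<Rightarrow> real ^ 'd" and xstar :: "real ^ 'd"
    and \<Phi> norm_s :: "real ^ 'd \<Rightarrow> real" and grad :: "real ^ 'd \<Rightarrow> real ^ 'd"
    and \<gamma> L\<^sub>s l u r C\<^sub>r \<delta> L\<^sub>F \<alpha> A\<^sub>1 :: real
    and J V \<Sigma>\<^sub>b :: "real ^ 'd ^ 'd"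
    and Nv :: "'v measure" and Nw :: "'w measure"
    and A :: "'v \<Rightarrow> real ^ 'd \<Rightarrow> real ^ 'd" and b :: "'w \<Rightarrow> real ^ 'd"
  assumes root: "F xstar = 0"
    and A1: "lyapunov_condition F xstar \<Phi> grad norm_s \<gamma> L\<^sub>s l u"
    and A2: "operator_condition F xstar J R r C\<^sub>r \<delta> L\<^sub>F"
    and alpha_pos: "\<alpha> > 0"
    and V: "J ** V + V ** transpose J + mat 1 = 0"
    and iota: "1 / (4 * lambda_max V) * \<alpha> > 2"
    and gamma: "3 * \<delta> * \<gamma> * \<alpha> > 2"
  shows "\<exists>K\<^sub>0. \<forall>K \<ge> K\<^sub>0. \<forall>(M :: 'm measure) x v w \<alpha>s y S.
    K \<ge> 2 \<longrightarrow> \<alpha>s = step_size \<alpha> K \<longrightarrow> (\<forall>k. \<alpha>s k \<le> 1) \<longrightarrow>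
    prob_space M \<longrightarrow>
    noise_condition M Nv Nw xstar x v w A A\<^sub>1 b \<Sigma>\<^sub>b \<longrightarrow>
    sa_iterates M F \<alpha>s x v w A b \<longrightarrow>
    y = scaled_error \<alpha>s xstar x \<longrightarrow>
    S = covariance \<alpha>s (shifted_jacobian \<alpha> J) \<Sigma>\<^sub>b (\<integral>\<omega>. outer (y 0 \<omega>) (y 0 \<omega>) \<partial>M) \<longrightarrow>
    (\<exists>C p. \<forall>k.
       wasserstein1 (distr M borel (y k)) (distr std_gaussian borel (\<lambda>z. mat_sqrt (S k) *v z))
         \<le> ennreal (1 / 2) \<longrightarrow>
       (\<forall>a > 0. \<forall>\<uu>. norm \<uu> = 1 \<longrightarrow>
          \<bar>measure M {\<omega> \<in> space M. y k \<omega> \<bullet> \<uu> > a}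
             - gauss_ccdf (ereal a / ereal (norm (\<uu> v* mat_sqrt (S k))))\<bar>
          \<le> C * (ln (real k + K) ^ p / (real k + K) powr (\<delta> / 4)) * (1 / a)))"
proof -
  interpret stable_step F R xstar \<Phi> norm_s grad \<gamma> L\<^sub>s l u r C\<^sub>r \<delta> L\<^sub>F J \<alpha> V
    by unfold_locales (use assms in auto)
  \<comment> \<open>\<open>\<delta> \<le> 1\<close> turns the hypothesis into
    \<open>\<gamma> \<alpha> > 2 / 3\<close>, the form in which the Lyapunov drift needs it.\<close>
  have "3 * \<delta> * \<gamma> * \<alpha> \<le> 3 * 1 * \<gamma> * \<alpha>"
    using pos alpha_pos by (intro mult_right_mono mult_left_mono) auto
  with gamma have ga: "\<gamma> * \<alpha> > 2 / 3" by simp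
  show ?thesis
  \<comment> \<open>The threshold depends only on the operator, \<alpha> and
    \<open>A\<^sub>1\<close>, so it can be fixed before the probability space and the
    process.\<close>
  proof (rule exI[of _ "K_min A\<^sub>1"], intro allI impI)
    fix K and M :: "'m measure" and x v w \<alpha>s y S
    assume K: "K_min A\<^sub>1 \<le> K" and \<alpha>s: "\<alpha>s = step_size \<alpha> K" and "prob_space M"
      and noise: "noise_condition M Nv Nw xstar x v w A A\<^sub>1 b \<Sigma>\<^sub>b"
      and iter: "sa_iterates M F \<alpha>s x v w A b"
      and y: "y = scaled_error \<alpha>s xstar x"
      and S: "S = covariance \<alpha>s (shifted_jacobian \<alpha> J) \<Sigma>\<^sub>b (\<integral>\<omega>. outer (y 0 \<omega>) (y 0 \<omega>) \<partial>M)"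
    interpret prob_space M by fact
    interpret sa_process F R xstar \<Phi> norm_s grad \<gamma> L\<^sub>s l u r C\<^sub>r \<delta> L\<^sub>F J \<alpha> V M Nv Nw A A\<^sub>1 b \<Sigma>\<^sub>b K x v w
      by unfold_locales (use ga K noise iter \<alpha>s in auto)
    have y_eq: "y k \<omega> = e k \<omega> /\<^sub>R sqrt (h k)" for k \<omega>
      by (simp add: y scaled_error_def \<alpha>s h_eq e_def)
    define S\<^sub>0 where "S\<^sub>0 = (\<integral>\<omega>. outer (y 0 \<omega>) (y 0 \<omega>) \<partial>M)"
    have "square_integrable (y 0)" unfolding y_eq[abs_def] by (intro square_integrable_scaleR e_L2)
    then have S0_inner: "a \<bullet> (S\<^sub>0 *v c) = expectation (\<lambda>\<omega>. (a \<bullet> y 0 \<omega>) * (c \<bullet> y 0 \<omega>))" for a c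
      unfolding S\<^sub>0_def by (rule integral_outer)
    have "transpose S\<^sub>0 = S\<^sub>0"
    proof (rule matrix_eq_inner)
      fix a c
      have "a \<bullet> (transpose S\<^sub>0 *v c) = c \<bullet> (S\<^sub>0 *v a)"
        by (metis dot_lmul_matrix inner_commute transpose_matrix_vector)
      then show "a \<bullet> (transpose S\<^sub>0 *v c) = a \<bullet> (S\<^sub>0 *v c)" by (simp add: S0_inner mult.commute)
    qed
    moreover have "0 \<le> a \<bullet> (S\<^sub>0 *v a)" for a
      unfolding S0_inner by (intro Bochner_Integration.integral_nonneg) auto
    ultimately have "pos_semidef S\<^sub>0" by (simp add: pos_semidef_def)
    from projection_tail_bound[OF this] obtain C where
      C: "\<And>k t a. t > 0 \<Longrightarrow> norm a = 1 \<Longrightarrow>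
        \<bar>prob {\<omega> \<in> space M. (e k \<omega> /\<^sub>R sqrt (h k)) \<bullet> a > t}
           - gauss_ccdf (ereal t / ereal (norm (a v* mat_sqrt (Cov S\<^sub>0 k))))\<bar>
        \<le> C * (1 / (real k + K) powr (\<delta> / 4)) * (1 / t)" by blast
    have "S = Cov S\<^sub>0" unfolding S \<alpha>s S\<^sub>0_def ..
    \<comment> \<open>The exponent of the logarithm is taken to be 0, so its power is the constant
      1.\<close>
    then show "\<exists>C p. \<forall>k.
       wasserstein1 (distr M borel (y k)) (distr std_gaussian borel (\<lambda>z. mat_sqrt (S k) *v z))
         \<le> ennreal (1 / 2) \<longrightarrow>
       (\<forall>a > 0. \<forall>\<uu>. norm \<uu> = 1 \<longrightarrow>
          \<bar>measure M {\<omega> \<in> space M. y k \<omega> \<bullet> \<uu> > a}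
             - gauss_ccdf (ereal a / ereal (norm (\<uu> v* mat_sqrt (S k))))\<bar>
          \<le> C * (ln (real k + K) ^ p / (real k + K) powr (\<delta> / 4)) * (1 / a))"
      using C by (intro exI[of _ C] exI[of _ 0]) (simp add: y_eq)
  qed
qed

end
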